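(* Let $b\in\mathbb{K}_{d,1}$ and $M>0$. There are constants $C=C(d,\alpha,M)$ and $C'=C'(d,\alpha,M,b)$ such that for all $a\in(0,M]$, $$|p^{a,b}(t,x,y)|\le C\,e^{C't}\,p^a\!\left(2\beta_Lt/\beta_U,x,y\right),\qquad t>0,\ x,y\in\mathbb{R}^d.$$ Consequently, for any $T>0$ there is a constant $C''=C''(d,\alpha,M,T)$ such that $$|p^{a,b}(t,x,y)|\le C''e^{C't}\,q^a_{d,\beta_U^2/(2\beta_L)}(t,x-y),\qquad t\in(0,T],\ x,y\in\mathbb{R}^d.$$
   Context: Standing assumption: $d\ge2$, $\alpha\in(0,2)$. $M_f(r)=\sup_x\int_{|x-y|<r}|f(y)||x-y|^{1-d}dy$ and $f\in\mathbb{K}_{d,1}$ iff $M_f(r)\to0$ as $r\downarrow0$. For $a>0$, $p^a(t,x,y)=p^a(t,x-y)$ with $\int p^a(t,z)e^{iz\cdot\xi}dz=e^{-t(|\xi|^2+a^\alpha|\xi|^\alpha)}$. $q^a_{d,\beta}(t,z)=t^{-d/2}e^{-\beta|z|^2/t}+t^{-d/2}\wedge\frac{a^\alpha t}{|z|^{d+\alpha}}$. $\beta_L,\beta_U>0$ are constants (independent of $M,T$) such that for all $M,T>0$ there exist $C_L,C_U>0$ with $C_Lq^a_{d,\beta_L}(t,z)\le p^a(t,z)\le C_Uq^a_{d,\beta_U}(t,z)$ for $a\in(0,M]$, $t\in(0,T]$, $z\in\mathbb{R}^d$. Define $p_0^{a,b}=p^a$, $p_k^{a,b}(t,x,y)=\int_0^t\int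 p_{k-1}^{a,b}(t-s,x,z)b(z)\cdot\nabla_zp^a(s,z,y)dzds$. $p^{a,b}$ is the jointly continuous function on $(0,\infty)\times\mathbb{R}^d\times\mathbb{R}^d$ which equals $\sum_{k\ge0}p_k^{a,b}$ (absolutely convergent) on $(0,t_*]\times\mathbb{R}^d\times\mathbb{R}^d$ for a suitable $t_*>0$ and satisfies the Chapman–Kolmogorov equation $p^{a,b}(t+s,x,y)=\int p^{a,b}(t,x,z)p^{a,b}(s,z,y)dz$ for all $t,s>0$ (the fundamental solution of $\Delta+a^\alpha\Delta^{\alpha/2}+b\cdot\nabla$). *)

theory Defs
  imports "HOL-Analysis.Analysis"
begin

definition kato_M :: "('a::euclidean_space \<Rightarrow> real) \<Rightarrow> real \<Rightarrow> ennreal" where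
  "kato_M f r = (SUP x. \<integral>\<^sup>+ y. indicator (ball x r) y *
       ennreal (\<bar>f y\<bar> * dist x y powr (1 - real DIM('a))) \<partial>lborel)"

definition kato_class :: "('a::euclidean_space \<Rightarrow> real) \<Rightarrow> bool" where
  "kato_class f \<longleftrightarrow> ((\<lambda>r. kato_M f r) \<longlongrightarrow> 0) (at_right 0)"

text \<open>Heat kernel p^a(t,z) of Delta + a^alpha Delta^{alpha/2}, given by Fourier inversion of
  exp(-t(|xi|^2 + a^alpha |xi|^alpha)) (the imaginary part vanishes by symmetry).\<close>
definition pa :: "real \<Rightarrow> real \<Rightarrow> real \<Rightarrow> 'a::euclidean_space \<Rightarrow> real" where
  "pa \<alpha> a t z = (1 / (2 * pi) ^ DIM('a)) *
     (LINT \<xi>|lborel. cos (z \<bullet> \<xi>) * exp (- t * ((norm \<xi>)\<^sup>2 + a powr \<alpha> * norm \<xi> powr \<alpha>)))"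

text \<open>q^a_{d,beta}(t,z); at z = 0 the second summand is t^{-d/2} (since a^alpha t/|z|^{d+alpha} = infinity).\<close>
definition qa :: "real \<Rightarrow> real \<Rightarrow> real \<Rightarrow> real \<Rightarrow> 'a::euclidean_space \<Rightarrow> real" where
  "qa \<alpha> a \<beta> t z = t powr (- real DIM('a) / 2) * exp (- \<beta> * (norm z)\<^sup>2 / t) +
     (if z = 0 then t powr (- real DIM('a) / 2)
      else min (t powr (- real DIM('a) / 2)) (a powr \<alpha> * t / norm z powr (real DIM('a) + \<alpha>)))"

text \<open>The iterated kernels p_k^{a,b}; b(z).grad_z p^a(s,z,y) is the directional derivative
  of z |-> p^a(s, z - y) in direction b(z).\<close>
fun pk :: "real \<Rightarrow> real \<Rightarrow> ('a::euclidean_space \<Rightarrow> 'a) \<Rightarrow> nat \<Rightarrow> real \<Rightarrow> 'a \<Rightarrow> 'a \<Rightarrow> real" where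
  "pk \<alpha> a b 0 t x y = pa \<alpha> a t (x - y)"
| "pk \<alpha> a b (Suc k) t x y =
     (LINT s:{0<..<t}|lborel. (LINT z|lborel.
        pk \<alpha> a b k (t - s) x z * frechet_derivative (\<lambda>w. pa \<alpha> a s (w - y)) (at z) (b z)))"

definition fund_sol :: "real \<Rightarrow> real \<Rightarrow> ('a::euclidean_space \<Rightarrow> 'a) \<Rightarrow> (real \<Rightarrow> 'a \<Rightarrow> 'a \<Rightarrow> real) \<Rightarrow> bool" where
  "fund_sol \<alpha> a b P \<longleftrightarrow>
     continuous_on ({0<..} \<times> UNIV \<times> UNIV) (\<lambda>(t, x, y). P t x y) \<and>
     (\<exists>ts>0. \<forall>t\<in>{0<..ts}. \<forall>x y. summable (\<lambda>k. \<bar>pk \<alpha> a b k t x y\<bar>) \<and>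
                                 P t x y = (\<Sum>k. pk \<alpha> a b k t x y)) \<and>
     (\<forall>t>0. \<forall>s>0. \<forall>x y. P (t + s) x y = (LINT z|lborel. P t x z * P s z y))"

definition two_sided_constants :: "'a::euclidean_space itself \<Rightarrow> real \<Rightarrow> real \<Rightarrow> real \<Rightarrow> bool" where
  "two_sided_constants _ \<alpha> \<beta>L \<beta>U \<longleftrightarrow> \<beta>L > 0 \<and> \<beta>U > 0 \<and>
     (\<forall>M>0. \<forall>T>0. \<exists>CL>0. \<exists>CU>0. \<forall>a\<in>{0<..M}. \<forall>t\<in>{0<..T}. \<forall>z::'a.
        CL * qa \<alpha> a \<beta>L t z \<le> pa \<alpha> a t z \<and> pa \<alpha> a t z \<le> CU * qa \<alpha> a \<beta>U t z)"

end

theory Submission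
  imports Defs "HOL-Probability.Probability"
begin

text \<open>
  Convolving \<open>p^a(t)\<close> with a Gaussian of variance parameter \<open>\<tau>\<close> gives \<open>p^{a'}(t + \<tau>)\<close> with
  \<open>a'^\<alpha> (t + \<tau>) = a^\<alpha> t\<close>. Splitting off the Gaussian part of time \<open>t/3\<close> therefore bounds
  \<open>\<bar>\<nabla>p^a(t)\<bar>\<close> by \<open>C t^{-1/2} p^{a'}(4t/3)\<close>, hence by \<open>C t^{-1/2} q_{\<gamma>'}(t)\<close> with \<open>\<gamma>' = 3\<beta>U/4\<close>,
  so that no information on dimension \<open>d + 2\<close> is needed. For \<open>\<gamma> < \<gamma>'\<close> the product
  \<open>q_\<gamma>(u, x - z) q_{\<gamma>'}(v, z - y)\<close> is at most \<open>C q_\<gamma>(u + v, x - y)\<close> times a sum of two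
  polynomially decaying kernels whose time integrals are controlled by the Kato modulus of \<open>b\<close>.
  With \<open>\<gamma> = \<beta>U/2\<close> the perturbation series is thus geometric on a time interval depending only on
  \<open>M\<close> and \<open>b\<close>, and \<open>q_\<gamma>(t)\<close> is at most a multiple of \<open>p^a(2\<beta>L t/\<beta>U)\<close>. The interval on which a given
  fundamental solution equals its series may be shorter; the Chapman-Kolmogorov equation carries
  Duhamel's formula over to the whole interval, and there its solution is unique. The semigroup
  property of \<open>p^a\<close> turns the bound into exponential growth for large times.
\<close>

section \<open>Fourier analysis of the kernel\<close>

text \<open>The factor 2 in the time change \<open>c = 2 * \<beta>L / \<beta>U\<close> is what
  leaves room for the argument. The lower bound for the kernel at time \<open>c * t\<close> has
  Gaussian exponent \<open>\<beta>L / c = \<beta>U / 2\<close>, and this is the smallest \<gamma>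
  for which that bound yields control of \<open>qa\<close> with exponent \<gamma> by
  \<open>pa\<close> at time \<open>c * t\<close>. The gradient, on the other hand, loses part of the
  exponent: splitting off a Gaussian share \<theta> of the time and doubling it leaves
  \<open>\<beta>U / (1 + \<theta>)\<close>, and \<theta> = 1/3 gives
  \<open>3 * \<beta>U / 4\<close>. The gap between the two exponents is spent in the three-point
  inequality, where the surplus Gaussian decay of one factor is converted into a power-law kernel
  that can be integrated in time against \<open>b\<close>. The drift enters only through the length
  \<open>t0\<close> of the interval on which its Kato modulus is so small that every iteration at
  least halves the bound. The constant \<open>C\<close> of the geometric series is therefore fixed
  before \<open>b\<close> is chosen, and \<open>b\<close> appears only in the growth rate
  \<open>ln C / t0\<close>.\<close>

lemma distr_lborel_reflect: "distr lborel borel (\<lambda>w. z - w) = (lborel :: 'a::euclidean_space measure)"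
  using lborel_affine[of "-1" z] by (simp add: density_1)

lemma distr_lborel_translate: "distr lborel borel (\<lambda>w. w + z) = (lborel :: 'a::euclidean_space measure)"
  using lborel_affine[of 1 z] by (simp add: density_1 add.commute)

lemma nn_integral_reflect:
  fixes f :: "'a::euclidean_space \<Rightarrow> ennreal"
  assumes "f \<in> borel_measurable borel"
  shows "(\<integral>\<^sup>+w. f (z - w) \<partial>lborel) = (\<integral>\<^sup>+w. f w \<partial>lborel)"
  using nn_integral_distr[of "\<lambda>w. z - w" lborel borel f] assms
  by (simp add: distr_lborel_reflect)

lemma integrable_reflect:
  fixes f :: "'a::euclidean_space \<Rightarrow> 'b::{banach, second_countable_topology}"
  assumes "integrable lborel f"
  shows "integrable lborel (\<lambda>w. f (z - w))"
  using integrable_distr[of "\<lambda>w. z - w" lborel borel f] assms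
  by (simp add: distr_lborel_reflect)

lemma integral_reflect:
  fixes f :: "'a::euclidean_space \<Rightarrow> 'b::{banach, second_countable_topology}"
  assumes "f \<in> borel_measurable borel"
  shows "(LINT w|lborel. f (z - w)) = (LINT w|lborel. f w)"
  using integral_distr[of "\<lambda>w. z - w" lborel borel f] assms
  by (simp add: distr_lborel_reflect)

lemma integral_scale:
  fixes f :: "'a::euclidean_space \<Rightarrow> real"
  assumes "c > 0" "f \<in> borel_measurable borel"
  shows "(LINT w|lborel. f w) = c ^ DIM('a) * (LINT w|lborel. f (z + c *\<^sub>R w))"
proof -
  have "(LINT w|lborel. f w) = integral\<^sup>L (density (distr lborel borel (\<lambda>x. z + c *\<^sub>R x)) (\<lambda>_. ennreal (\<bar>c\<bar>^DIM('a)))) f"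
    using lborel_affine[of c z] assms by (simp add: ennreal_power)
  also have "\<dots> = c ^ DIM('a) * (LINT w|lborel. f (z + c *\<^sub>R w))"
    using assms by (subst integral_density) (auto simp: integral_distr)
  finally show ?thesis .
qed

lemma nn_integral_scale:
  fixes f :: "'a::euclidean_space \<Rightarrow> ennreal"
  assumes "c > 0" "f \<in> borel_measurable borel"
  shows "(\<integral>\<^sup>+w. f w \<partial>lborel) = ennreal (c ^ DIM('a)) * (\<integral>\<^sup>+w. f (z + c *\<^sub>R w) \<partial>lborel)"
proof -
  have "(\<integral>\<^sup>+w. f w \<partial>lborel) = integral\<^sup>N (density (distr lborel borel (\<lambda>x. z + c *\<^sub>R x)) (\<lambda>_. ennreal (\<bar>c\<bar>^DIM('a)))) f"
    using lborel_affine[of c z] assms by (simp add: ennreal_power)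
  also have "\<dots> = ennreal (c ^ DIM('a)) * (\<integral>\<^sup>+w. f (z + c *\<^sub>R w) \<partial>lborel)"
    using assms by (subst nn_integral_density) (auto simp: nn_integral_distr nn_integral_cmult)
  finally show ?thesis .
qed

text \<open>Rescaling the characteristic function of the standard normal law by the standard
  deviation \<open>sqrt (2 * \<tau>)\<close>.\<close>

lemma has_bochner_integral_gaussian_iexp:
  fixes \<tau> \<xi> :: real
  assumes "\<tau> > 0"
  shows "has_bochner_integral lborel (\<lambda>x. exp (- x\<^sup>2 / (4 * \<tau>)) *\<^sub>R iexp (\<xi> * x))
           (complex_of_real (sqrt (4 * pi * \<tau>) * exp (- \<tau> * \<xi>\<^sup>2)))"
proof -
  define \<sigma> where "\<sigma> = sqrt (2 * \<tau>)"
  have \<sigma>: "\<sigma> > 0" "\<sigma>\<^sup>2 = 2 * \<tau>" using assms by (auto simp: \<sigma>_def)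
  define t where "t = \<sigma> * \<xi>"
  have int: "integrable lborel (\<lambda>x. std_normal_density x *\<^sub>R iexp (t * x))"
  proof (rule Bochner_Integration.integrable_bound)
    show "integrable lborel (\<lambda>x. std_normal_density x)" by simp
  qed auto
  have eq: "(LINT x|lborel. std_normal_density x *\<^sub>R iexp (t * x)) = complex_of_real (exp (- (t^2) / 2))"
  proof -
    have "char std_normal_distribution t = complex_of_real (exp (- (t^2) / 2))"
      by (simp add: char_std_normal_distribution)
    then show ?thesis
      unfolding char_def by (subst (asm) integral_density) auto
  qed
  have "has_bochner_integral lborel (\<lambda>x. std_normal_density x *\<^sub>R iexp (t * x)) (complex_of_real (exp (- (t^2) / 2)))"
    using int eq by (simp add: has_bochner_integral_iff)
  then have "has_bochner_integral lborel (\<lambda>x. std_normal_density (0 + (1/\<sigma>) * x) *\<^sub>R iexp (t * (0 + (1/\<sigma>) * x)))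
      (complex_of_real (exp (- (t^2) / 2)) /\<^sub>R \<bar>1/\<sigma>\<bar>)"
    by (subst (asm) lborel_has_bochner_integral_real_affine_iff[of "1/\<sigma>" _ _ 0]) (use \<sigma> in auto)
  then have "has_bochner_integral lborel (\<lambda>x. sqrt (2 * pi) *\<^sub>R (std_normal_density (0 + (1/\<sigma>) * x) *\<^sub>R iexp (t * (0 + (1/\<sigma>) * x))))
      (sqrt (2 * pi) *\<^sub>R (complex_of_real (exp (- (t^2) / 2)) /\<^sub>R \<bar>1/\<sigma>\<bar>))"
    by (intro has_bochner_integral_scaleR_right) auto
  moreover have "sqrt (2 * pi) *\<^sub>R (std_normal_density (0 + (1/\<sigma>) * x) *\<^sub>R iexp (t * (0 + (1/\<sigma>) * x))) =
       exp (- x\<^sup>2 / (4 * \<tau>)) *\<^sub>R iexp (\<xi> * x)" for x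
    using \<sigma> by (simp add: std_normal_density_def t_def power_divide field_simps)
  moreover have "sqrt (2 * pi) *\<^sub>R (complex_of_real (exp (- (t^2) / 2)) /\<^sub>R \<bar>1/\<sigma>\<bar>) =
       complex_of_real (sqrt (4 * pi * \<tau>) * exp (- \<tau> * \<xi>\<^sup>2))"
  proof -
    have "t\<^sup>2 / 2 = \<tau> * \<xi>\<^sup>2" using \<sigma> by (simp add: t_def power_mult_distrib)
    moreover have "sqrt (2 * pi) * \<sigma> = sqrt (4 * pi * \<tau>)"
      by (simp add: \<sigma>_def real_sqrt_mult[symmetric])
    ultimately show ?thesis
      using \<sigma> by (simp add: scaleR_conv_of_real flip: of_real_mult)
  qed
  ultimately show ?thesis by simp
qed

text \<open>Complex values are needed here: exponentials of \<open>w \<bullet> \<xi>\<close> factor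
  over the coordinates, cosines do not. The real part is taken only after all coordinates have been
  integrated.\<close>

lemma has_bochner_integral_lborel_prod:
  fixes f :: "'a::euclidean_space \<Rightarrow> real \<Rightarrow> complex"
  assumes "\<And>b. b \<in> Basis \<Longrightarrow> has_bochner_integral lborel (f b) (I b)"
  shows "has_bochner_integral lborel (\<lambda>w::'a. \<Prod>b\<in>Basis. f b (w \<bullet> b)) (\<Prod>b\<in>Basis. I b)"
proof -
  interpret product_sigma_finite "\<lambda>_::'a. lborel :: real measure" ..
  have f: "integrable lborel (f b)" "integral\<^sup>L lborel (f b) = I b" if "b \<in> Basis" for b
    using assms[OF that] by (auto simp: has_bochner_integral_iff)
  have [measurable]: "f b \<in> borel_measurable borel" if "b \<in> Basis" for b
    using f(1)[OF that] by auto
  have m: "(\<lambda>f. \<Sum>b\<in>Basis. f b *\<^sub>R b) \<in> (\<Pi>\<^sub>M b\<in>Basis. lborel) \<rightarrow>\<^sub>M (borel :: 'a measure)"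
    by measurable
  have m2: "(\<lambda>w::'a. \<Prod>b\<in>Basis. f b (w \<bullet> b)) \<in> borel_measurable borel"
    by measurable
  have e: "(\<Prod>b\<in>Basis. f b ((\<Sum>b\<in>Basis. g b *\<^sub>R b) \<bullet> b)) = (\<Prod>b\<in>Basis. f b (g b))" for g
    by (intro prod.cong) auto
  have "has_bochner_integral (\<Pi>\<^sub>M b\<in>(Basis::'a set). lborel) (\<lambda>x. \<Prod>b\<in>Basis. f b (x b)) (\<Prod>b\<in>Basis. I b)"
    unfolding has_bochner_integral_iff
    using product_integrable_prod[of Basis f] product_integral_prod[of Basis f] f by auto
  then show ?thesis
    unfolding lborel_eq[where 'a='a]
    by (subst has_bochner_integral_iff, subst integrable_distr_eq[OF m m2], subst integral_distr[OF m m2])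
       (simp add: e has_bochner_integral_iff)
qed

lemma has_bochner_integral_gaussian_cos:
  fixes \<xi> :: "'a::euclidean_space"
  assumes "\<tau> > 0"
  shows "has_bochner_integral lborel (\<lambda>w::'a. exp (- (norm w)\<^sup>2 / (4 * \<tau>)) * cos (w \<bullet> \<xi>))
           ((4 * pi * \<tau>) powr (real DIM('a) / 2) * exp (- \<tau> * (norm \<xi>)\<^sup>2))"
proof -
  have norm2: "(\<Sum>b\<in>Basis. (w \<bullet> b)\<^sup>2) = (norm w)\<^sup>2" for w :: 'a
    using euclidean_inner[of w w] unfolding power2_norm_eq_inner by (simp add: power2_eq_square)
  have "has_bochner_integral lborel
     (\<lambda>w::'a. \<Prod>b\<in>Basis. (exp (- (w \<bullet> b)\<^sup>2 / (4 * \<tau>)) *\<^sub>R iexp ((\<xi> \<bullet> b) * (w \<bullet> b))))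
     (\<Prod>b\<in>(Basis::'a set). complex_of_real (sqrt (4 * pi * \<tau>) * exp (- \<tau> * (\<xi> \<bullet> b)\<^sup>2)))"
    by (rule has_bochner_integral_lborel_prod[OF has_bochner_integral_gaussian_iexp[OF assms]])
  moreover have "(\<Prod>b\<in>Basis. (exp (- (w \<bullet> b)\<^sup>2 / (4 * \<tau>)) *\<^sub>R iexp ((\<xi> \<bullet> b) * (w \<bullet> b))))
     = exp (- (norm w)\<^sup>2 / (4 * \<tau>)) *\<^sub>R iexp (w \<bullet> \<xi>)" for w :: 'a
  proof -
    have "(\<Prod>b\<in>Basis. (exp (- (w \<bullet> b)\<^sup>2 / (4 * \<tau>)) *\<^sub>R iexp ((\<xi> \<bullet> b) * (w \<bullet> b))))
       = of_real (\<Prod>b\<in>Basis. exp (- (w \<bullet> b)\<^sup>2 / (4 * \<tau>))) * (\<Prod>b\<in>Basis. iexp ((\<xi> \<bullet> b) * (w \<bullet> b)))"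
      by (simp add: scaleR_conv_of_real prod.distrib)
    also have "\<dots> = of_real (exp (\<Sum>b\<in>Basis. - (w \<bullet> b)\<^sup>2 / (4 * \<tau>))) * exp (\<Sum>b\<in>Basis. \<i> * complex_of_real ((\<xi> \<bullet> b) * (w \<bullet> b)))"
      by (simp add: exp_sum)
    also have "(\<Sum>b\<in>Basis. - (w \<bullet> b)\<^sup>2 / (4 * \<tau>)) = - (norm w)\<^sup>2 / (4 * \<tau>)"
      by (simp add: norm2[symmetric] sum_divide_distrib sum_negf)
    also have "(\<Sum>b\<in>Basis. \<i> * complex_of_real ((\<xi> \<bullet> b) * (w \<bullet> b))) = \<i> * complex_of_real (w \<bullet> \<xi>)"
      by (simp add: euclidean_inner[of w \<xi>] sum_distrib_left mult_ac)
    finally show ?thesis by (simp add: scaleR_conv_of_real)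
  qed
  moreover have "(\<Prod>b\<in>(Basis::'a set). complex_of_real (sqrt (4 * pi * \<tau>) * exp (- \<tau> * (\<xi> \<bullet> b)\<^sup>2)))
     = complex_of_real ((4 * pi * \<tau>) powr (real DIM('a) / 2) * exp (- \<tau> * (norm \<xi>)\<^sup>2))"
  proof -
    have "(\<Prod>b\<in>(Basis::'a set). (sqrt (4 * pi * \<tau>) * exp (- \<tau> * (\<xi> \<bullet> b)\<^sup>2)))
       = sqrt (4 * pi * \<tau>) ^ DIM('a) * exp (\<Sum>b\<in>Basis. - \<tau> * (\<xi> \<bullet> b)\<^sup>2)"
      by (simp add: prod.distrib exp_sum)
    also have "(\<Sum>b\<in>Basis. - \<tau> * (\<xi> \<bullet> b)\<^sup>2) = - \<tau> * (norm \<xi>)\<^sup>2"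
      by (simp add: norm2[symmetric] sum_distrib_left sum_negf)
    also have "sqrt (4 * pi * \<tau>) ^ DIM('a) = (4 * pi * \<tau>) powr (real DIM('a) / 2)"
      using assms by (simp add: powr_half_sqrt[symmetric] powr_powr flip: powr_realpow)
    finally show ?thesis by (simp only: of_real_prod[symmetric])
  qed
  ultimately have "has_bochner_integral lborel (\<lambda>w::'a. exp (- (norm w)\<^sup>2 / (4 * \<tau>)) *\<^sub>R iexp (w \<bullet> \<xi>))
     (complex_of_real ((4 * pi * \<tau>) powr (real DIM('a) / 2) * exp (- \<tau> * (norm \<xi>)\<^sup>2)))"
    by simp
  then have "has_bochner_integral lborel (\<lambda>w::'a. Re (exp (- (norm w)\<^sup>2 / (4 * \<tau>)) *\<^sub>R iexp (w \<bullet> \<xi>)))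
     (Re (complex_of_real ((4 * pi * \<tau>) powr (real DIM('a) / 2) * exp (- \<tau> * (norm \<xi>)\<^sup>2))))"
    by (rule has_bochner_integral_bounded_linear[OF bounded_linear_Re])
  then show ?thesis by (simp add: Re_exp)
qed

lemma integrable_product_lborel:
  fixes f :: "'a::euclidean_space \<Rightarrow> real" and g :: "'b::euclidean_space \<Rightarrow> real"
  assumes f: "integrable lborel f" and g: "integrable lborel g"
  shows "integrable (lborel \<Otimes>\<^sub>M lborel) (\<lambda>(x, y). f x * g y)"
proof (rule lborel_pair.Fubini_integrable)
  have [measurable]: "f \<in> borel_measurable borel" "g \<in> borel_measurable borel"
    using assms by auto
  show "(\<lambda>(x, y). f x * g y) \<in> borel_measurable (lborel \<Otimes>\<^sub>M lborel)" by measurable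
  show "integrable lborel (\<lambda>x. LINT y|lborel. norm (case (x, y) of (x, y) \<Rightarrow> f x * g y))"
    using f by (auto simp: abs_mult)
  show "AE x in lborel. integrable lborel (\<lambda>y. case (x, y) of (x, y) \<Rightarrow> f x * g y)"
    using g by auto
qed

text \<open>Evenness kills the sine part of the transform. The free phase \<open>c\<close> serves
  two purposes: \<open>c = 0\<close> is used for the kernel itself and
  \<open>c = - (pi / 2)\<close>, which turns the cosine into a sine, for its gradient.\<close>

lemma integral_even_cos:
  fixes f :: "'a::euclidean_space \<Rightarrow> real"
  assumes f: "integrable lborel f" and even: "\<And>w. f (- w) = f w"
  shows "(LINT w|lborel. f (z - w) * cos (w \<bullet> \<xi> + c)) = cos (z \<bullet> \<xi> + c) * (LINT w|lborel. f w * cos (w \<bullet> \<xi>))"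
proof -
  have [measurable]: "f \<in> borel_measurable borel" using f by auto
  have ic: "integrable lborel (\<lambda>w. f w * cos (w \<bullet> \<xi>))"
    by (rule Bochner_Integration.integrable_bound[OF f]) (auto simp: abs_mult intro!: mult_left_le)
  have si: "integrable lborel (\<lambda>w. f w * sin (w \<bullet> \<xi>))"
    by (rule Bochner_Integration.integrable_bound[OF f]) (auto simp: abs_mult intro!: mult_left_le)
  have "(LINT w|lborel. f w * sin (w \<bullet> \<xi>)) = (LINT w|lborel. f (0 - w) * sin ((0 - w) \<bullet> \<xi>))"
    by (rule integral_reflect[symmetric]) measurable
  also have "\<dots> = - (LINT w|lborel. f w * sin (w \<bullet> \<xi>))"
    by (simp add: even)
  finally have s0: "(LINT w|lborel. f w * sin (w \<bullet> \<xi>)) = 0" by simp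
  have "(LINT w|lborel. f (z - w) * cos (w \<bullet> \<xi> + c)) = (LINT w|lborel. f (z - w) * cos ((z - (z - w)) \<bullet> \<xi> + c))"
    by simp
  also have "\<dots> = (LINT w|lborel. f w * cos ((z - w) \<bullet> \<xi> + c))"
    by (rule integral_reflect[of "\<lambda>w. f w * cos ((z - w) \<bullet> \<xi> + c)"]) measurable
  also have "\<dots> = (LINT w|lborel. cos (z \<bullet> \<xi> + c) * (f w * cos (w \<bullet> \<xi>)) + sin (z \<bullet> \<xi> + c) * (f w * sin (w \<bullet> \<xi>)))"
  proof (intro Bochner_Integration.integral_cong refl)
    fix w
    have "(z - w) \<bullet> \<xi> + c = (z \<bullet> \<xi> + c) - w \<bullet> \<xi>" by (simp add: inner_diff_left)
    then show "f w * cos ((z - w) \<bullet> \<xi> + c) = cos (z \<bullet> \<xi> + c) * (f w * cos (w \<bullet> \<xi>)) + sin (z \<bullet> \<xi> + c) * (f w * sin (w \<bullet> \<xi>))"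
      by (simp only: cos_diff) (simp add: algebra_simps)
  qed
  also have "\<dots> = cos (z \<bullet> \<xi> + c) * (LINT w|lborel. f w * cos (w \<bullet> \<xi>))"
    using ic si s0 by simp
  finally show ?thesis .
qed

text \<open>The convolution theorem in real form. Integrability of \<open>f\<close> and
  \<open>\<psi>\<close> makes the double integral absolutely convergent, so the order of integration
  may be exchanged and the inner integral evaluated by \<open>integral_even_cos\<close>.\<close>

lemma integral_even_fourier:
  fixes f :: "'a::euclidean_space \<Rightarrow> real"
  assumes f: "integrable lborel f" and even: "\<And>w. f (- w) = f w"
    and \<psi>: "integrable lborel \<psi>"
  shows "(LINT w|lborel. f (z - w) * (LINT \<xi>|lborel. cos (w \<bullet> \<xi> + c) * \<psi> \<xi>)) =
         (LINT \<xi>|lborel. cos (z \<bullet> \<xi> + c) * (LINT w|lborel. f w * cos (w \<bullet> \<xi>)) * \<psi> \<xi>)"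
proof -
  have [measurable]: "f \<in> borel_measurable borel" "\<psi> \<in> borel_measurable borel" using f \<psi> by auto
  have "integrable (lborel \<Otimes>\<^sub>M lborel) (\<lambda>(w, \<xi>). f (z - w) * \<psi> \<xi>)"
    by (rule integrable_product_lborel[OF integrable_reflect[OF f] \<psi>])
  then have int: "integrable (lborel \<Otimes>\<^sub>M lborel) (\<lambda>(w, \<xi>). f (z - w) * cos (w \<bullet> \<xi> + c) * \<psi> \<xi>)"
    by (rule Bochner_Integration.integrable_bound)
       (auto simp: abs_mult split_beta intro!: mult_right_mono mult_left_le)
  have "(LINT w|lborel. f (z - w) * (LINT \<xi>|lborel. cos (w \<bullet> \<xi> + c) * \<psi> \<xi>)) =
        (LINT w|lborel. LINT \<xi>|lborel. f (z - w) * cos (w \<bullet> \<xi> + c) * \<psi> \<xi>)"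
    by (simp add: mult.assoc)
  also have "\<dots> = (LINT \<xi>|lborel. LINT w|lborel. f (z - w) * cos (w \<bullet> \<xi> + c) * \<psi> \<xi>)"
    by (rule lborel_pair.Fubini_integral[OF int, symmetric])
  also have "\<dots> = (LINT \<xi>|lborel. (LINT w|lborel. f (z - w) * cos (w \<bullet> \<xi> + c)) * \<psi> \<xi>)"
    by simp
  also have "\<dots> = (LINT \<xi>|lborel. cos (z \<bullet> \<xi> + c) * (LINT w|lborel. f w * cos (w \<bullet> \<xi>)) * \<psi> \<xi>)"
    by (simp add: integral_even_cos[OF f even])
  finally show ?thesis .
qed

lemma integrable_gaussian:
  assumes "s > 0"
  shows "integrable lborel (\<lambda>\<xi>::'a::euclidean_space. exp (- s * (norm \<xi>)\<^sup>2))"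
  using has_bochner_integral_gaussian_cos[of "1 / (4 * s)" "0::'a"] assms
  by (auto simp: has_bochner_integral_iff mult.commute)

section \<open>The kernel and its derivative as Fourier integrals\<close>

definition phi :: "real \<Rightarrow> real \<Rightarrow> real \<Rightarrow> 'a::euclidean_space \<Rightarrow> real" where
  "phi \<alpha> a t \<xi> = exp (- t * ((norm \<xi>)\<^sup>2 + a powr \<alpha> * norm \<xi> powr \<alpha>))"

text \<open>The result of differentiating the Fourier integral of \<open>pa\<close> in direction
  \<open>e\<close>. The explicit formula is visibly jointly measurable in time, point and direction,
  which is needed once the direction is \<open>b z\<close>.\<close>

definition dpa :: "real \<Rightarrow> real \<Rightarrow> real \<Rightarrow> 'a::euclidean_space \<Rightarrow> 'a \<Rightarrow> real" where
  "dpa \<alpha> a t z e = - (1 / (2 * pi) ^ DIM('a)) * (LINT \<xi>|lborel. sin (z \<bullet> \<xi>) * ((e \<bullet> \<xi>) * phi \<alpha> a t \<xi>))"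

lemma pa_eq_phi: "pa \<alpha> a t (z::'a::euclidean_space) = (1 / (2 * pi) ^ DIM('a)) * (LINT \<xi>|lborel. cos (z \<bullet> \<xi>) * phi \<alpha> a t \<xi>)"
  unfolding pa_def phi_def by simp

lemma phi_measurable [measurable]:
  "(\<lambda>(t, \<xi>::'a::euclidean_space). phi \<alpha> a t \<xi>) \<in> borel_measurable (borel \<Otimes>\<^sub>M borel)"
  unfolding phi_def by measurable

lemma phi_minus [simp]: "phi \<alpha> a t (- \<xi>) = phi \<alpha> a t \<xi>"
  by (simp add: phi_def)

lemma phi_pos: "0 < phi \<alpha> a t \<xi>"
  by (simp add: phi_def)

lemma phi_le_gaussian: "t \<ge> 0 \<Longrightarrow> phi \<alpha> a t \<xi> \<le> exp (- t * (norm \<xi>)\<^sup>2)"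
  by (simp add: phi_def algebra_simps)

lemma phi_le_1: "t \<ge> 0 \<Longrightarrow> phi \<alpha> a t \<xi> \<le> 1"
  by (simp add: phi_def)

lemma phi_add: "phi \<alpha> a t \<xi> * phi \<alpha> a s \<xi> = phi \<alpha> a (t + s) \<xi>"
  by (simp add: phi_def algebra_simps flip: exp_add)

lemma integrable_phi_moments:
  assumes t: "t > 0"
  shows "integrable lborel (\<lambda>\<xi>::'a::euclidean_space. phi \<alpha> a t \<xi>)"
    and "integrable lborel (\<lambda>\<xi>::'a. norm \<xi> * phi \<alpha> a t \<xi>)"
    and "integrable lborel (\<lambda>\<xi>::'a. (norm \<xi>)\<^sup>2 * phi \<alpha> a t \<xi>)"
proof -
  have m: "(\<lambda>\<xi>::'a. phi \<alpha> a t \<xi>) \<in> borel_measurable borel"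
    by measurable
  note [measurable] = m
  show 0: "integrable lborel (\<lambda>\<xi>::'a. phi \<alpha> a t \<xi>)"
    by (rule Bochner_Integration.integrable_bound[OF integrable_gaussian[OF t]])
       (use t phi_le_gaussian[of t] in \<open>auto simp: less_imp_le[OF phi_pos] simp del: mult_minus_left intro!: always_eventually\<close>)
  show 2: "integrable lborel (\<lambda>\<xi>::'a. (norm \<xi>)\<^sup>2 * phi \<alpha> a t \<xi>)"
  proof (rule Bochner_Integration.integrable_bound)
    show "integrable lborel (\<lambda>\<xi>::'a. (2 / t) * exp (- (t / 2) * (norm \<xi>)\<^sup>2))"
      using t by (intro integrable_mult_right integrable_gaussian) auto
    have "(norm \<xi>)\<^sup>2 * phi \<alpha> a t \<xi> \<le> (2 / t) * exp (- (t / 2) * (norm \<xi>)\<^sup>2)" for \<xi> :: 'a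
    proof -
      define u where "u = t / 2 * (norm \<xi>)\<^sup>2"
      have "(norm \<xi>)\<^sup>2 * phi \<alpha> a t \<xi> \<le> (norm \<xi>)\<^sup>2 * exp (- t * (norm \<xi>)\<^sup>2)"
        using t by (intro mult_left_mono phi_le_gaussian) auto
      also have "\<dots> = (2 / t) * (u * exp (- 2 * u))" using t by (simp add: u_def)
      also have "u \<le> exp u" using exp_ge_add_one_self[of u] by linarith
      then have "(2 / t) * (u * exp (- 2 * u)) \<le> (2 / t) * (exp u * exp (- 2 * u))"
        using t by (intro mult_left_mono mult_right_mono) auto
      also have "\<dots> = (2 / t) * exp (- (t / 2) * (norm \<xi>)\<^sup>2)"
        by (simp add: u_def flip: exp_add)
      finally show ?thesis .
    qed
    then show "AE \<xi>::'a in lborel. norm ((norm \<xi>)\<^sup>2 * phi \<alpha> a t \<xi>) \<le> norm ((2 / t) * exp (- (t / 2) * (norm \<xi>)\<^sup>2))"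
      using t by (auto simp: less_imp_le[OF phi_pos])
  qed measurable
  show "integrable lborel (\<lambda>\<xi>::'a. norm \<xi> * phi \<alpha> a t \<xi>)"
  proof (rule Bochner_Integration.integrable_bound)
    show "integrable lborel (\<lambda>\<xi>::'a. phi \<alpha> a t \<xi> + (norm \<xi>)\<^sup>2 * phi \<alpha> a t \<xi>)"
      using 0 2 by simp
    have "norm \<xi> * phi \<alpha> a t \<xi> \<le> phi \<alpha> a t \<xi> + (norm \<xi>)\<^sup>2 * phi \<alpha> a t \<xi>" for \<xi> :: 'a
    proof -
      have "2 * norm \<xi> \<le> 1 + (norm \<xi>)\<^sup>2" using sum_squares_bound[of 1 "norm \<xi>"] by simp
      then have "norm \<xi> \<le> 1 + (norm \<xi>)\<^sup>2" using norm_ge_zero[of \<xi>] by linarith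
      then have "norm \<xi> * phi \<alpha> a t \<xi> \<le> (1 + (norm \<xi>)\<^sup>2) * phi \<alpha> a t \<xi>"
        by (intro mult_right_mono less_imp_le[OF phi_pos])
      then show ?thesis by (simp add: algebra_simps)
    qed
    then show "AE \<xi>::'a in lborel. norm (norm \<xi> * phi \<alpha> a t \<xi>) \<le> norm (phi \<alpha> a t \<xi> + (norm \<xi>)\<^sup>2 * phi \<alpha> a t \<xi>)"
      by (auto simp: less_imp_le[OF phi_pos] abs_of_nonneg)
  qed measurable
qed

lemma integrable_trig_phi:
  fixes z :: "'a::euclidean_space"
  assumes t: "t > 0"
  shows "integrable lborel (\<lambda>\<xi>. cos (z \<bullet> \<xi>) * phi \<alpha> a t \<xi>)"
    and "integrable lborel (\<lambda>\<xi>. sin (z \<bullet> \<xi>) * ((e \<bullet> \<xi>) * phi \<alpha> a t \<xi>))"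
    and "integrable lborel (\<lambda>\<xi>::'a. (e \<bullet> \<xi>) * phi \<alpha> a t \<xi>)"
proof -
  show "integrable lborel (\<lambda>\<xi>. cos (z \<bullet> \<xi>) * phi \<alpha> a t \<xi>)"
    by (rule Bochner_Integration.integrable_bound[OF integrable_phi_moments(1)[OF t, of \<alpha> a]])
       (auto simp: abs_mult intro!: mult_left_le_one_le)
  have i: "integrable lborel (\<lambda>\<xi>::'a. norm e * (norm \<xi> * phi \<alpha> a t \<xi>))"
    by (intro integrable_mult_right integrable_phi_moments(2)[OF t])
  have e: "\<bar>e \<bullet> \<xi>\<bar> * phi \<alpha> a t \<xi> \<le> norm e * (norm \<xi> * phi \<alpha> a t \<xi>)" for \<xi>
    using mult_right_mono[OF Cauchy_Schwarz_ineq2[of e \<xi>] less_imp_le[OF phi_pos[of \<alpha> a t \<xi>]]]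
    by (simp add: mult.assoc)
  show 3: "integrable lborel (\<lambda>\<xi>::'a. (e \<bullet> \<xi>) * phi \<alpha> a t \<xi>)"
    by (rule Bochner_Integration.integrable_bound[OF i])
       (use e in \<open>auto simp: abs_mult less_imp_le[OF phi_pos]\<close>)
  show "integrable lborel (\<lambda>\<xi>. sin (z \<bullet> \<xi>) * ((e \<bullet> \<xi>) * phi \<alpha> a t \<xi>))"
    by (rule Bochner_Integration.integrable_bound[OF 3])
       (auto simp: abs_mult less_imp_le[OF phi_pos] intro!: mult_left_le_one_le)
qed

lemma pa_le:
  assumes t: "t > 0"
  shows "pa \<alpha> a t (z::'a::euclidean_space) \<le> (1 / (2 * pi) ^ DIM('a)) * (LINT \<xi>::'a|lborel. phi \<alpha> a t \<xi>)"
  unfolding pa_eq_phi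
  by (intro mult_left_mono integral_mono integrable_trig_phi(1)[OF t] integrable_phi_moments(1)[OF t])
     (auto simp: mult_right_mono[OF cos_le_one less_imp_le[OF phi_pos], simplified])

lemma pa_minus [simp]: "pa \<alpha> a t (- z) = pa \<alpha> a t z"
  by (simp add: pa_eq_phi)

lemma pa_measurable [measurable]:
  "(\<lambda>(t, z::'a::euclidean_space). pa \<alpha> a t z) \<in> borel_measurable (borel \<Otimes>\<^sub>M borel)"
  unfolding pa_eq_phi by measurable

lemma dpa_measurable [measurable]:
  "(\<lambda>(t, z::'a::euclidean_space, e). dpa \<alpha> a t z e) \<in> borel_measurable (borel \<Otimes>\<^sub>M borel \<Otimes>\<^sub>M borel)"
  unfolding dpa_def by measurable

lemma cos_taylor_remainder: "\<bar>cos (A + B) - cos A + B * sin A\<bar> \<le> (B::real)\<^sup>2"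
proof -
  have r: "cmod (iexp B - (1 + \<i> * B)) \<le> B\<^sup>2 / 2"
    using iexp_approx1[of B 1] by (simp add: numeral_2_eq_2)
  have "\<bar>Re (iexp B - (1 + \<i> * B))\<bar> \<le> B\<^sup>2 / 2" "\<bar>Im (iexp B - (1 + \<i> * B))\<bar> \<le> B\<^sup>2 / 2"
    using abs_Re_le_cmod[of "iexp B - (1 + \<i> * B)"] abs_Im_le_cmod[of "iexp B - (1 + \<i> * B)"] r by linarith+
  then have c: "\<bar>cos B - 1\<bar> \<le> B\<^sup>2 / 2" and s: "\<bar>sin B - B\<bar> \<le> B\<^sup>2 / 2"
    by (auto simp: Re_exp Im_exp)
  have "cos (A + B) - cos A + B * sin A = cos A * (cos B - 1) - sin A * (sin B - B)"
    by (simp add: cos_add algebra_simps)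
  also have "\<bar>\<dots>\<bar> \<le> \<bar>cos A\<bar> * \<bar>cos B - 1\<bar> + \<bar>sin A\<bar> * \<bar>sin B - B\<bar>"
    by (metis abs_mult abs_triangle_ineq4)
  also have "\<dots> \<le> 1 * \<bar>cos B - 1\<bar> + 1 * \<bar>sin B - B\<bar>"
    by (intro add_mono mult_right_mono) auto
  also have "\<dots> \<le> B\<^sup>2" using add_mono[OF c s] by simp
  finally show ?thesis .
qed

lemma pa_has_derivative:
  fixes z :: "'a::euclidean_space"
  assumes t: "t > 0"
  shows "(pa \<alpha> a t has_derivative dpa \<alpha> a t z) (at z)"
proof -
  let ?c = "1 / (2 * pi) ^ DIM('a)"
  define K where "K = ?c * (LINT \<xi>::'a|lborel. (norm \<xi>)\<^sup>2 * phi \<alpha> a t \<xi>)"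
  have lin: "linear (dpa \<alpha> a t z)"
  proof (rule linearI)
    fix e f :: 'a and r :: real
    show "dpa \<alpha> a t z (e + f) = dpa \<alpha> a t z e + dpa \<alpha> a t z f"
      using integrable_trig_phi(2)[OF t, of z e \<alpha> a] integrable_trig_phi(2)[OF t, of z f \<alpha> a]
      by (simp add: dpa_def inner_add_left algebra_simps)
    have "(LINT \<xi>|lborel. sin (z \<bullet> \<xi>) * ((r *\<^sub>R e) \<bullet> \<xi> * phi \<alpha> a t \<xi>)) =
          (LINT \<xi>|lborel. r * (sin (z \<bullet> \<xi>) * (e \<bullet> \<xi> * phi \<alpha> a t \<xi>)))"
      by (simp add: mult_ac)
    then show "dpa \<alpha> a t z (r *\<^sub>R e) = r *\<^sub>R dpa \<alpha> a t z e"
      by (simp add: dpa_def)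
  qed
  \<comment> \<open>A quadratic remainder that is uniform in the direction gives total
    differentiability at once; its constant is the second moment of \<open>phi\<close>.\<close>
  have rem: "\<bar>pa \<alpha> a t (z + h) - pa \<alpha> a t z - dpa \<alpha> a t z h\<bar> \<le> K * (norm h)\<^sup>2" for h
  proof -
    define R where "R \<xi> = cos ((z + h) \<bullet> \<xi>) * phi \<alpha> a t \<xi> - cos (z \<bullet> \<xi>) * phi \<alpha> a t \<xi>
      + sin (z \<bullet> \<xi>) * ((h \<bullet> \<xi>) * phi \<alpha> a t \<xi>)" for \<xi>
    note ints = integrable_trig_phi(1)[OF t, of "z + h" \<alpha> a] integrable_trig_phi(1)[OF t, of z \<alpha> a]
        integrable_trig_phi(2)[OF t, of z h \<alpha> a]
    have Rint: "integrable lborel R"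
      unfolding R_def by (intro Bochner_Integration.integrable_add Bochner_Integration.integrable_diff ints)
    have eq: "pa \<alpha> a t (z + h) - pa \<alpha> a t z - dpa \<alpha> a t z h = ?c * (LINT \<xi>|lborel. R \<xi>)"
      unfolding R_def using ints
      by (simp only: pa_eq_phi dpa_def Bochner_Integration.integral_add Bochner_Integration.integral_diff
            Bochner_Integration.integrable_diff distrib_left right_diff_distrib)
    have Rle: "norm (R \<xi>) \<le> (norm h)\<^sup>2 * ((norm \<xi>)\<^sup>2 * phi \<alpha> a t \<xi>)" for \<xi>
    proof -
      have "R \<xi> = (cos (z \<bullet> \<xi> + h \<bullet> \<xi>) - cos (z \<bullet> \<xi>) + (h \<bullet> \<xi>) * sin (z \<bullet> \<xi>)) * phi \<alpha> a t \<xi>"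
        by (simp add: R_def inner_add_left algebra_simps)
      then have "norm (R \<xi>) \<le> (h \<bullet> \<xi>)\<^sup>2 * phi \<alpha> a t \<xi>"
        by (simp only: real_norm_def abs_mult abs_of_pos[OF phi_pos])
           (intro mult_right_mono cos_taylor_remainder less_imp_le[OF phi_pos])
      also have "\<dots> \<le> ((norm h)\<^sup>2 * (norm \<xi>)\<^sup>2) * phi \<alpha> a t \<xi>"
        using power_mono[OF Cauchy_Schwarz_ineq2[of h \<xi>], of 2]
        by (intro mult_right_mono less_imp_le[OF phi_pos]) (simp add: power_mult_distrib)
      finally show ?thesis by (simp only: mult.assoc)
    qed
    have "norm (LINT \<xi>|lborel. R \<xi>) \<le> (LINT \<xi>::'a|lborel. (norm h)\<^sup>2 * ((norm \<xi>)\<^sup>2 * phi \<alpha> a t \<xi>))"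
      by (intro Bochner_Integration.integral_norm_bound_integral[OF Rint] Rle integrable_mult_right integrable_phi_moments(3)[OF t])
    then have "\<bar>LINT \<xi>|lborel. R \<xi>\<bar> \<le> (norm h)\<^sup>2 * (LINT \<xi>::'a|lborel. (norm \<xi>)\<^sup>2 * phi \<alpha> a t \<xi>)"
      by simp
    from mult_left_mono[OF this, of ?c] show ?thesis
      unfolding eq K_def by (simp add: abs_mult mult_ac)
  qed
  have lim: "((\<lambda>h. norm (pa \<alpha> a t (z + h) - pa \<alpha> a t z - dpa \<alpha> a t z h) / norm h) \<longlongrightarrow> 0) (at 0)"
  proof (rule Lim_null_comparison)
    show "\<forall>\<^sub>F h in at 0. norm (norm (pa \<alpha> a t (z + h) - pa \<alpha> a t z - dpa \<alpha> a t z h) / norm h) \<le> K * norm h"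
      using rem by (auto simp: eventually_at_filter field_simps power2_eq_square)
    show "((\<lambda>h::'a. K * norm h) \<longlongrightarrow> 0) (at 0)"
      by (auto intro!: tendsto_eq_intros)
  qed
  show ?thesis
    unfolding has_derivative_at using lin lim by (simp add: linear_conv_bounded_linear)
qed

lemma frechet_derivative_pa:
  fixes z y :: "'a::euclidean_space"
  assumes "s > 0"
  shows "frechet_derivative (\<lambda>w. pa \<alpha> a s (w - y)) (at z) = dpa \<alpha> a s (z - y)"
proof -
  have "((\<lambda>w. pa \<alpha> a s (w - y)) has_derivative (\<lambda>h. dpa \<alpha> a s (z - y) h)) (at z)"
    by (rule has_derivative_compose[where g="pa \<alpha> a s" and f="\<lambda>w. w - y", OF _ pa_has_derivative[OF assms]])
       (auto intro!: derivative_eq_intros)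
  then show ?thesis by (intro frechet_derivative_at[symmetric])
qed

section \<open>Convolution with the heat kernel of the Laplacian at time \<tau>\<close>

definition gauss :: "real \<Rightarrow> 'a::euclidean_space \<Rightarrow> real" where
  "gauss \<tau> w = (4 * pi * \<tau>) powr (- real DIM('a) / 2) * exp (- (norm w)\<^sup>2 / (4 * \<tau>))"

lemma gauss_measurable [measurable]: "gauss \<tau> \<in> borel_measurable borel"
  unfolding gauss_def[abs_def] by measurable

lemma has_bochner_integral_gauss_cos:
  fixes \<xi> :: "'a::euclidean_space"
  assumes "\<tau> > 0"
  shows "has_bochner_integral lborel (\<lambda>w. gauss \<tau> w * cos (w \<bullet> \<xi>)) (exp (- \<tau> * (norm \<xi>)\<^sup>2))"
proof -
  let ?c = "(4 * pi * \<tau>) powr (- real DIM('a) / 2)"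
  have "has_bochner_integral lborel (\<lambda>w. ?c * (exp (- (norm w)\<^sup>2 / (4 * \<tau>)) * cos (w \<bullet> \<xi>)))
      (?c * ((4 * pi * \<tau>) powr (real DIM('a) / 2) * exp (- \<tau> * (norm \<xi>)\<^sup>2)))"
    by (intro has_bochner_integral_mult_right has_bochner_integral_gaussian_cos assms)
  moreover have "?c * (4 * pi * \<tau>) powr (real DIM('a) / 2) = 1"
    using assms by (simp flip: powr_add)
  ultimately show ?thesis by (simp add: gauss_def[abs_def] mult.assoc[symmetric])
qed

lemma integrable_gauss: "\<tau> > 0 \<Longrightarrow> integrable lborel (gauss \<tau> :: 'a::euclidean_space \<Rightarrow> real)"
  using has_bochner_integral_gauss_cos[of \<tau> "0::'a"] by (simp add: has_bochner_integral_iff)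

lemma integral_gauss_pa:
  fixes z :: "'a::euclidean_space"
  assumes \<tau>: "\<tau> > 0" and s: "s > 0" and a: "a' powr \<alpha> * (s + \<tau>) = a powr \<alpha> * s"
  shows "(LINT w|lborel. gauss \<tau> (z - w) * pa \<alpha> a s w) = pa \<alpha> a' (s + \<tau>) z"
proof -
  have "(LINT w|lborel. gauss \<tau> (z - w) * (LINT \<xi>|lborel. cos (w \<bullet> \<xi> + 0) * phi \<alpha> a s \<xi>)) =
         (LINT \<xi>|lborel. cos (z \<bullet> \<xi> + 0) * (LINT w|lborel. gauss \<tau> w * cos (w \<bullet> \<xi>)) * phi \<alpha> a s \<xi>)"
    by (rule integral_even_fourier[OF integrable_gauss[OF \<tau>] _ integrable_phi_moments(1)[OF s]])
       (simp add: gauss_def)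
  also have "\<dots> = (LINT \<xi>|lborel. cos (z \<bullet> \<xi>) * phi \<alpha> a' (s + \<tau>) \<xi>)"
  proof (intro Bochner_Integration.integral_cong refl)
    fix \<xi> :: 'a
    have "exp (- \<tau> * (norm \<xi>)\<^sup>2) * phi \<alpha> a s \<xi> = exp (- ((s + \<tau>) * (norm \<xi>)\<^sup>2 + (a powr \<alpha> * s) * norm \<xi> powr \<alpha>))"
      by (simp add: phi_def algebra_simps flip: exp_add)
    also have "\<dots> = phi \<alpha> a' (s + \<tau>) \<xi>"
      unfolding a[symmetric] by (simp add: phi_def algebra_simps)
    finally have "exp (- \<tau> * (norm \<xi>)\<^sup>2) * phi \<alpha> a s \<xi> = phi \<alpha> a' (s + \<tau>) \<xi>" .
    moreover have "(LINT w|lborel. gauss \<tau> w * cos (w \<bullet> \<xi>)) = exp (- \<tau> * (norm \<xi>)\<^sup>2)"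
      using has_bochner_integral_gauss_cos[OF \<tau>, of \<xi>] by (simp add: has_bochner_integral_iff)
    ultimately show "cos (z \<bullet> \<xi> + 0) * (LINT w|lborel. gauss \<tau> w * cos (w \<bullet> \<xi>)) * phi \<alpha> a s \<xi> = cos (z \<bullet> \<xi>) * phi \<alpha> a' (s + \<tau>) \<xi>"
      by (simp add: mult.assoc)
  qed
  finally show ?thesis by (simp add: pa_eq_phi)
qed

text \<open>Doubling the time of the Gaussian absorbs the linear factor produced by differentiating
  it. The bound is for finite increments so that it can be integrated against a kernel first and the
  increment sent to zero afterwards. In the proof \<open>x\<close> and \<open>y\<close> are the
  lengths of \<open>v\<close> and \<open>k\<close> in units of \<open>sqrt \<tau>\<close>.\<close>

lemma gauss_increment_bound:
  fixes v k :: "'a::euclidean_space"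
  assumes \<tau>: "\<tau> > 0"
  shows "\<bar>gauss \<tau> (v + k) - gauss \<tau> v\<bar> \<le>
    norm k * (8 + norm k / sqrt \<tau>) / (4 * sqrt \<tau>) * exp (3 * (norm k)\<^sup>2 / (4 * \<tau>)) * 2 powr (real DIM('a) / 2) * gauss (2 * \<tau>) v"
proof -
  define A where "A = (norm (v + k))\<^sup>2 / (4 * \<tau>)"
  define B where "B = (norm v)\<^sup>2 / (4 * \<tau>)"
  define x where "x = norm v / sqrt \<tau>"
  define y where "y = norm k / sqrt \<tau>"
  have xy: "0 \<le> x" "0 \<le> y" using \<tau> by (auto simp: x_def y_def)
  have x2: "x\<^sup>2 = (norm v)\<^sup>2 / \<tau>" "y\<^sup>2 = (norm k)\<^sup>2 / \<tau>" using \<tau> by (auto simp: x_def y_def power_divide)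
  have low: "(norm (v + k))\<^sup>2 \<ge> (norm v - norm k)\<^sup>2"
    by (rule power2_le_iff_abs_le[THEN iffD2]) (use norm_triangle_ineq3[of v "- k"] in auto)
  have up: "(norm (v + k))\<^sup>2 \<le> (norm v + norm k)\<^sup>2"
    by (intro power_mono norm_triangle_ineq) auto
  have AB: "\<bar>A - B\<bar> \<le> y * (2 * x + y) / 4"
  proof -
    have "(norm (v + k))\<^sup>2 - (norm v)\<^sup>2 \<le> norm k * (2 * norm v + norm k)"
      using up by (simp add: power2_eq_square algebra_simps)
    moreover have "(norm v)\<^sup>2 - (norm (v + k))\<^sup>2 \<le> norm k * (2 * norm v + norm k)"
    proof -
      have "(norm v)\<^sup>2 - (norm v - norm k)\<^sup>2 = norm k * (2 * norm v - norm k)"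
        by (simp add: power2_eq_square algebra_simps)
      also have "\<dots> \<le> norm k * (2 * norm v + norm k)" by (intro mult_left_mono) auto
      finally show ?thesis using low by linarith
    qed
    ultimately have "\<bar>(norm (v + k))\<^sup>2 - (norm v)\<^sup>2\<bar> \<le> norm k * (2 * norm v + norm k)" by linarith
    then have "\<bar>(norm (v + k))\<^sup>2 - (norm v)\<^sup>2\<bar> / (4 * \<tau>) \<le> norm k * (2 * norm v + norm k) / (4 * \<tau>)"
      using \<tau> by (intro divide_right_mono) auto
    moreover have "\<bar>A - B\<bar> = \<bar>(norm (v + k))\<^sup>2 - (norm v)\<^sup>2\<bar> / (4 * \<tau>)"
      using \<tau> by (simp add: A_def B_def flip: diff_divide_distrib)
    moreover have "norm k * (2 * norm v + norm k) / (4 * \<tau>) = y * (2 * x + y) / 4"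
    proof -
      have "sqrt \<tau> * sqrt \<tau> = \<tau>" using \<tau> by simp
      then show ?thesis using \<tau> by (simp add: x_def y_def field_simps)
    qed
    ultimately show ?thesis by simp
  qed
  \<comment> \<open>From \<open>(p - q)\<^sup>2 \<ge> 3/4 * p\<^sup>2 - 3 * q\<^sup>2\<close>:
    giving up a quarter of the decay in \<open>v\<close> makes the bound valid at both end points of
    the increment.\<close>
  have minAB: "min A B \<ge> 3 * x\<^sup>2 / 16 - 3 * y\<^sup>2 / 4"
  proof -
    have "(norm v - norm k)\<^sup>2 \<ge> 3 * (norm v)\<^sup>2 / 4 - 3 * (norm k)\<^sup>2"
      using zero_le_power2[of "norm v / 2 - 2 * norm k"] by (simp add: power2_eq_square algebra_simps)
    then have "3 * (norm v)\<^sup>2 / 4 - 3 * (norm k)\<^sup>2 \<le> (norm (v + k))\<^sup>2" using low by linarith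
    then have "(3 * (norm v)\<^sup>2 / 4 - 3 * (norm k)\<^sup>2) / (4 * \<tau>) \<le> A"
      unfolding A_def using \<tau> by (intro divide_right_mono) auto
    moreover have "3 * x\<^sup>2 / 16 - 3 * y\<^sup>2 / 4 = (3 * (norm v)\<^sup>2 / 4 - 3 * (norm k)\<^sup>2) / (4 * \<tau>)"
      using \<tau> by (simp add: x2 field_simps)
    moreover have "3 * x\<^sup>2 / 16 - 3 * y\<^sup>2 / 4 \<le> B"
    proof -
      have "3 * x\<^sup>2 / 16 - 3 * y\<^sup>2 / 4 \<le> 4 * x\<^sup>2 / 16" using zero_le_power2[of x] zero_le_power2[of y] by linarith
      also have "\<dots> = B" using \<tau> by (simp add: x2 B_def)
      finally show ?thesis .
    qed
    ultimately show ?thesis by simp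
  qed
  have expdiff: "\<bar>exp (- A) - exp (- B)\<bar> \<le> \<bar>A - B\<bar> * exp (- min A B)" for A B :: real
  proof -
    have *: "exp (- A) - exp (- B) \<le> (B - A) * exp (- A)" "0 \<le> exp (- A) - exp (- B)" if "A \<le> B" for A B :: real
    proof -
      have "1 + (A - B) \<le> exp (A - B)" by (rule exp_ge_add_one_self)
      then have "exp (- A) * (1 + (A - B)) \<le> exp (- A) * exp (A - B)" by (intro mult_left_mono) auto
      also have "\<dots> = exp (- B)" by (simp flip: exp_add)
      finally show "exp (- A) - exp (- B) \<le> (B - A) * exp (- A)" by (simp add: algebra_simps)
      show "0 \<le> exp (- A) - exp (- B)" using that by simp
    qed
    show ?thesis
    proof (cases "A \<le> B")
      case True then show ?thesis using *[of A B] by (simp add: min_def)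
    next
      case False then show ?thesis using *[of B A] by (simp add: min_def)
    qed
  qed
  have xe: "x * exp (- x\<^sup>2 / 16) \<le> 4"
  proof -
    have "2 * (x / 4) \<le> 1 + (x / 4)\<^sup>2" using zero_le_power2[of "x / 4 - 1"] by (simp add: power2_eq_square algebra_simps)
    then have "x \<le> 4 * (1 + (x / 4)\<^sup>2)" using xy by (simp add: power2_eq_square)
    also have "\<dots> \<le> 4 * exp ((x / 4)\<^sup>2)" by (intro mult_left_mono exp_ge_add_one_self) auto
    also have "\<dots> = 4 * exp (x\<^sup>2 / 16)" by (simp add: power_divide)
    finally have "x * exp (- x\<^sup>2 / 16) \<le> 4 * exp (x\<^sup>2 / 16) * exp (- x\<^sup>2 / 16)" by (intro mult_right_mono) auto
    also have "\<dots> = 4" by (simp add: mult.assoc flip: exp_add)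
    finally show ?thesis .
  qed
  have "\<bar>exp (- A) - exp (- B)\<bar> \<le> \<bar>A - B\<bar> * exp (- min A B)" by (rule expdiff)
  also have "\<dots> \<le> (y * (2 * x + y) / 4) * exp (- (3 * x\<^sup>2 / 16 - 3 * y\<^sup>2 / 4))"
    using minAB xy by (intro mult_mono AB) auto
  \<comment> \<open>The decay rate splits as 3/16 = 1/16 + 1/8. The first share absorbs the factor
    \<open>x\<close>, the second is the exponent of the Gaussian with doubled time.\<close>
  also have "\<dots> = (y / 4) * ((2 * (x * exp (- x\<^sup>2 / 16)) + y * exp (- x\<^sup>2 / 16))) * exp (3 * y\<^sup>2 / 4) * exp (- x\<^sup>2 / 8)"
  proof -
    have "exp (- (3 * x\<^sup>2 / 16 - 3 * y\<^sup>2 / 4)) = exp (- x\<^sup>2 / 16) * exp (3 * y\<^sup>2 / 4) * exp (- x\<^sup>2 / 8)"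
      by (simp flip: exp_add)
    then show ?thesis by (simp add: algebra_simps)
  qed
  also have "\<dots> \<le> (y / 4) * (2 * 4 + y * 1) * exp (3 * y\<^sup>2 / 4) * exp (- x\<^sup>2 / 8)"
    using xe xy by (intro mult_right_mono mult_left_mono add_mono) auto
  finally have main: "\<bar>exp (- A) - exp (- B)\<bar> \<le> (y / 4) * (8 + y) * exp (3 * y\<^sup>2 / 4) * exp (- x\<^sup>2 / 8)" by simp
  let ?c = "(4 * pi * \<tau>) powr (- real DIM('a) / 2)"
  have "\<bar>gauss \<tau> (v + k) - gauss \<tau> v\<bar> = ?c * \<bar>exp (- A) - exp (- B)\<bar>"
    by (simp add: gauss_def A_def B_def abs_mult flip: right_diff_distrib)
  also have "\<dots> \<le> ?c * ((y / 4) * (8 + y) * exp (3 * y\<^sup>2 / 4) * exp (- x\<^sup>2 / 8))"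
    by (intro mult_left_mono main) auto
  also have "\<dots> = (y / 4) * (8 + y) * exp (3 * y\<^sup>2 / 4) * (?c * exp (- x\<^sup>2 / 8))" by simp
  also have "?c * exp (- x\<^sup>2 / 8) = 2 powr (real DIM('a) / 2) * gauss (2 * \<tau>) v"
  proof -
    have "?c = 2 powr (real DIM('a) / 2) * (4 * pi * (2 * \<tau>)) powr (- real DIM('a) / 2)"
    proof -
      have "4 * pi * (2 * \<tau>) = 2 * (4 * pi * \<tau>)" by simp
      then have "(4 * pi * (2 * \<tau>)) powr (- real DIM('a) / 2) = 2 powr (- real DIM('a) / 2) * ?c"
        using \<tau> by (simp only: powr_mult)
      then show ?thesis by (simp add: powr_minus)
    qed
    moreover have "- x\<^sup>2 / 8 = - (norm v)\<^sup>2 / (4 * (2 * \<tau>))" by (simp add: x2)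
    ultimately show ?thesis by (simp only: gauss_def mult.assoc)
  qed
  finally show ?thesis
    using \<tau> by (simp add: y_def power_divide mult_ac)
qed

text \<open>Positivity of \<open>p^a\<close> is not derived from its Fourier transform but later read off the assumed lower bound.\<close>

locale positive_pa =
  fixes \<alpha> :: real and dummy :: "'a::euclidean_space itself"
  assumes \<alpha>_pos: "0 < \<alpha>" and \<alpha>_less_2: "\<alpha> < 2"
    and pa_nonneg: "\<And>a t (z::'a). 0 < a \<Longrightarrow> 0 < t \<Longrightarrow> 0 \<le> pa \<alpha> a t z"
begin

section \<open>Fourier inversion, semigroup property and gradient bound\<close>

lemma continuous_phi: "continuous_on UNIV (\<lambda>\<xi>::'a. phi \<alpha> a t \<xi>)"
  unfolding phi_def using \<alpha>_pos by (intro continuous_intros continuous_on_powr') auto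

text \<open>Integrability of \<open>pa\<close> is not yet available, so its transform is computed
  behind a wide Gaussian cut-off. On the Fourier side the cut-off becomes a Gaussian average at
  scale \<open>1 / n\<close>; the product formula for cosines makes it centre at both
  \<open>\<xi>0\<close> and \<open>- \<xi>0\<close>, and the substitution by \<open>1 / n\<close>
  moves the dependence on \<open>n\<close> into the argument of \<open>phi\<close>.\<close>

lemma fourier_pa_regularized:
  fixes \<xi>0 :: 'a
  assumes t: "t > 0" and n: "n > 0"
  shows "(LINT w|lborel. exp (- (norm w)\<^sup>2 / (4 * n\<^sup>2)) * cos (w \<bullet> \<xi>0) * pa \<alpha> a t w) =
    pi powr (- real DIM('a) / 2) * (LINT \<zeta>::'a|lborel. exp (- (norm \<zeta>)\<^sup>2) *
      ((phi \<alpha> a t (\<xi>0 + (1 / n) *\<^sub>R \<zeta>) + phi \<alpha> a t (- \<xi>0 + (1 / n) *\<^sub>R \<zeta>)) / 2))"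
proof -
  let ?d = "DIM('a)" and ?G = "\<lambda>w::'a. exp (- (norm w)\<^sup>2 / (4 * n\<^sup>2))"
  let ?f = "\<lambda>w::'a. ?G w * cos (w \<bullet> \<xi>0)"
  define k where "k = (4 * pi * n\<^sup>2) powr (real ?d / 2)"
  have n2: "n\<^sup>2 > 0" using n by simp
  note G = has_bochner_integral_gaussian_cos[OF n2, where 'a='a]
  have Gi: "integrable lborel (\<lambda>w. ?G w * cos (w \<bullet> \<xi>))" for \<xi>
    using G by (simp add: has_bochner_integral_iff)
  have GI: "(LINT w|lborel. ?G w * cos (w \<bullet> \<xi>)) = k * exp (- n\<^sup>2 * (norm \<xi>)\<^sup>2)" for \<xi>
    using G[of \<xi>] unfolding k_def has_bochner_integral_iff by blast
  have F: "(LINT w|lborel. ?f w * cos (w \<bullet> \<xi>)) = k * ((exp (- n\<^sup>2 * (norm (\<xi> - \<xi>0))\<^sup>2) + exp (- n\<^sup>2 * (norm (\<xi> + \<xi>0))\<^sup>2)) / 2)" for \<xi>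
  proof -
    have eq: "?f w * cos (w \<bullet> \<xi>) = (?G w * cos (w \<bullet> (\<xi> - \<xi>0)) + ?G w * cos (w \<bullet> (\<xi> + \<xi>0))) / 2" for w
      by (simp add: inner_diff_right inner_add_right cos_add cos_diff algebra_simps)
    have "(LINT w|lborel. ?f w * cos (w \<bullet> \<xi>)) = ((LINT w|lborel. ?G w * cos (w \<bullet> (\<xi> - \<xi>0))) + (LINT w|lborel. ?G w * cos (w \<bullet> (\<xi> + \<xi>0)))) / 2"
      by (simp only: eq integral_divide_zero Bochner_Integration.integral_add[OF Gi Gi])
    then show ?thesis unfolding GI by (simp add: algebra_simps)
  qed
  have sc: "(LINT \<xi>|lborel. exp (- n\<^sup>2 * (norm (\<xi> - \<eta>))\<^sup>2) * phi \<alpha> a t \<xi>) =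
     (1 / n) ^ ?d * (LINT \<zeta>::'a|lborel. exp (- (norm \<zeta>)\<^sup>2) * phi \<alpha> a t (\<eta> + (1 / n) *\<^sub>R \<zeta>))" for \<eta>
    using n by (subst integral_scale[of "1 / n" _ \<eta>]) (auto simp: power_divide)
  have gi: "integrable lborel (\<lambda>\<xi>. exp (- n\<^sup>2 * (norm (\<xi> - \<eta>))\<^sup>2) * phi \<alpha> a t \<xi>)" for \<eta> :: 'a
    by (rule Bochner_Integration.integrable_bound[OF integrable_phi_moments(1)[OF t, of \<alpha> a]])
       (auto simp: abs_mult less_imp_le[OF phi_pos] intro!: always_eventually mult_left_le_one_le)
  have ei: "integrable lborel (\<lambda>\<zeta>::'a. exp (- (norm \<zeta>)\<^sup>2) * phi \<alpha> a t (\<eta> + (1 / n) *\<^sub>R \<zeta>))" for \<eta> :: 'a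
    by (rule Bochner_Integration.integrable_bound[OF integrable_gaussian[of 1]])
       (auto simp: abs_mult less_imp_le[OF phi_pos] phi_le_1[OF less_imp_le[OF t]] intro!: always_eventually mult_left_le)
  have "(LINT w|lborel. ?f (0 - w) * (LINT \<xi>|lborel. cos (w \<bullet> \<xi> + 0) * phi \<alpha> a t \<xi>)) =
        (LINT \<xi>|lborel. cos (0 \<bullet> \<xi> + 0) * (LINT w|lborel. ?f w * cos (w \<bullet> \<xi>)) * phi \<alpha> a t \<xi>)"
    by (rule integral_even_fourier[OF Gi _ integrable_phi_moments(1)[OF t]]) simp
  also have "\<dots> = (LINT \<xi>|lborel. (k / 2) * (exp (- n\<^sup>2 * (norm (\<xi> - \<xi>0))\<^sup>2) * phi \<alpha> a t \<xi> + exp (- n\<^sup>2 * (norm (\<xi> - (- \<xi>0)))\<^sup>2) * phi \<alpha> a t \<xi>))"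
    unfolding F by (intro Bochner_Integration.integral_cong) (auto simp: algebra_simps)
  also have "\<dots> = (k / 2) * ((LINT \<xi>|lborel. exp (- n\<^sup>2 * (norm (\<xi> - \<xi>0))\<^sup>2) * phi \<alpha> a t \<xi>) + (LINT \<xi>|lborel. exp (- n\<^sup>2 * (norm (\<xi> - (- \<xi>0)))\<^sup>2) * phi \<alpha> a t \<xi>))"
    by (subst integral_mult_right_zero) (subst Bochner_Integration.integral_add[OF gi gi], rule refl)
  also have "\<dots> = k * (1 / n) ^ ?d * ((LINT \<zeta>::'a|lborel. exp (- (norm \<zeta>)\<^sup>2) * phi \<alpha> a t (\<xi>0 + (1 / n) *\<^sub>R \<zeta>)) + (LINT \<zeta>::'a|lborel. exp (- (norm \<zeta>)\<^sup>2) * phi \<alpha> a t (- \<xi>0 + (1 / n) *\<^sub>R \<zeta>))) / 2"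
    unfolding sc by (simp add: algebra_simps)
  also have "\<dots> = k * (1 / n) ^ ?d * (LINT \<zeta>::'a|lborel. exp (- (norm \<zeta>)\<^sup>2) *
      ((phi \<alpha> a t (\<xi>0 + (1 / n) *\<^sub>R \<zeta>) + phi \<alpha> a t (- \<xi>0 + (1 / n) *\<^sub>R \<zeta>)) / 2))"
  proof -
    have "exp (- (norm \<zeta>)\<^sup>2) * ((phi \<alpha> a t (\<xi>0 + (1 / n) *\<^sub>R \<zeta>) + phi \<alpha> a t (- \<xi>0 + (1 / n) *\<^sub>R \<zeta>)) / 2) =
       (exp (- (norm \<zeta>)\<^sup>2) * phi \<alpha> a t (\<xi>0 + (1 / n) *\<^sub>R \<zeta>) + exp (- (norm \<zeta>)\<^sup>2) * phi \<alpha> a t (- \<xi>0 + (1 / n) *\<^sub>R \<zeta>)) / 2" for \<zeta> :: 'a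
      by (simp add: algebra_simps)
    then show ?thesis by (simp only: integral_divide_zero Bochner_Integration.integral_add[OF ei ei] times_divide_eq_right)
  qed
  finally have I: "(LINT w|lborel. ?f (0 - w) * (LINT \<xi>|lborel. cos (w \<bullet> \<xi> + 0) * phi \<alpha> a t \<xi>)) = \<dots>" .
  have c: "1 / (2 * pi) ^ ?d * k * (1 / n) ^ ?d = pi powr (- real ?d / 2)"
  proof -
    have "k = (2 * pi * n) ^ ?d * pi powr (- real ?d / 2)"
    proof -
      have "4 * pi * n\<^sup>2 = (2 * pi * n)\<^sup>2 * pi powr (-1)"
        by (simp add: powr_minus power2_eq_square field_simps)
      then have "k = ((2 * pi * n)\<^sup>2) powr (real ?d / 2) * (pi powr (-1)) powr (real ?d / 2)"
        unfolding k_def by (simp only: powr_mult)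
      also have "((2 * pi * n)\<^sup>2) powr (real ?d / 2) = (2 * pi * n) ^ ?d"
      proof -
        have *: "(x\<^sup>2) powr (real j / 2) = x ^ j" if "x > 0" for x :: real and j :: nat
        proof -
          have "(x powr 2) powr (real j / 2) = x powr (real j)" unfolding powr_powr by simp
          then show ?thesis using that by (simp add: powr_realpow)
        qed
        show ?thesis using n by (intro *) simp
      qed
      finally show ?thesis by (simp only: powr_powr) simp
    qed
    then show ?thesis using n by (simp add: power_mult_distrib field_simps)
  qed
  have "(LINT w|lborel. ?f w * pa \<alpha> a t w) = (1 / (2 * pi) ^ ?d) * (LINT w|lborel. ?f (0 - w) * (LINT \<xi>|lborel. cos (w \<bullet> \<xi> + 0) * phi \<alpha> a t \<xi>))"
    by (subst integral_mult_right_zero[symmetric]) (simp add: pa_eq_phi mult_ac)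
  then show ?thesis unfolding I using c by (simp only: mult.assoc[symmetric])
qed

lemma fourier_pa_regularized_limit:
  fixes \<xi>0 :: 'a
  assumes t: "t > 0"
  shows "(\<lambda>n. LINT w|lborel. exp (- (norm w)\<^sup>2 / (4 * (real (Suc n))\<^sup>2)) * cos (w \<bullet> \<xi>0) * pa \<alpha> a t w) \<longlonglongrightarrow> phi \<alpha> a t \<xi>0"
proof -
  let ?h = "\<lambda>n \<zeta>::'a. exp (- (norm \<zeta>)\<^sup>2) *
      ((phi \<alpha> a t (\<xi>0 + (1 / real (Suc n)) *\<^sub>R \<zeta>) + phi \<alpha> a t (- \<xi>0 + (1 / real (Suc n)) *\<^sub>R \<zeta>)) / 2)"
  have "(\<lambda>n. LINT \<zeta>|lborel. ?h n \<zeta>) \<longlonglongrightarrow> (LINT \<zeta>::'a|lborel. exp (- (norm \<zeta>)\<^sup>2) * phi \<alpha> a t \<xi>0)"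
  proof (rule integral_dominated_convergence)
    show "integrable lborel (\<lambda>\<zeta>::'a. exp (- (norm \<zeta>)\<^sup>2))" using integrable_gaussian[of 1] by simp
    show "AE \<zeta> in lborel. (\<lambda>n. ?h n \<zeta>) \<longlonglongrightarrow> exp (- (norm \<zeta>)\<^sup>2) * phi \<alpha> a t \<xi>0"
    proof (rule AE_I2)
      fix \<zeta> :: 'a
      have l: "(\<lambda>n. phi \<alpha> a t (\<eta> + (1 / real (Suc n)) *\<^sub>R \<zeta>)) \<longlonglongrightarrow> phi \<alpha> a t \<eta>" for \<eta> :: 'a
      proof -
        have "(\<lambda>n. \<eta> + (1 / real (Suc n)) *\<^sub>R \<zeta>) \<longlonglongrightarrow> \<eta> + 0 *\<^sub>R \<zeta>"
          by (intro tendsto_intros lim_inverse_n'[THEN LIMSEQ_Suc])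
        then show ?thesis
          using continuous_phi[of a t] by (intro isCont_tendsto_compose[where g="phi \<alpha> a t"]) (auto simp: continuous_on_eq_continuous_at)
      qed
      have "(\<lambda>n. ?h n \<zeta>) \<longlonglongrightarrow> exp (- (norm \<zeta>)\<^sup>2) * ((phi \<alpha> a t \<xi>0 + phi \<alpha> a t (- \<xi>0)) / 2)"
        by (intro tendsto_intros l) auto
      then show "(\<lambda>n. ?h n \<zeta>) \<longlonglongrightarrow> exp (- (norm \<zeta>)\<^sup>2) * phi \<alpha> a t \<xi>0" by simp
    qed
    show "AE \<zeta> in lborel. norm (?h n \<zeta>) \<le> exp (- (norm \<zeta>)\<^sup>2)" for n
    proof (rule AE_I2)
      fix \<zeta> :: 'a
      let ?p = "phi \<alpha> a t (\<xi>0 + (1 / real (Suc n)) *\<^sub>R \<zeta>)" and ?q = "phi \<alpha> a t (- \<xi>0 + (1 / real (Suc n)) *\<^sub>R \<zeta>)"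
      have "0 < ?p" "0 < ?q" "?p \<le> 1" "?q \<le> 1" using t by (auto simp: phi_pos intro!: phi_le_1)
      then have "0 \<le> (?p + ?q) / 2" "(?p + ?q) / 2 \<le> 1" by auto
      then show "norm (?h n \<zeta>) \<le> exp (- (norm \<zeta>)\<^sup>2)"
        using mult_left_le[of "(?p + ?q) / 2" "exp (- (norm \<zeta>)\<^sup>2)"]
        by (simp only: real_norm_def abs_mult abs_of_nonneg exp_ge_zero)
    qed
  qed auto
  moreover have "(LINT \<zeta>::'a|lborel. exp (- (norm \<zeta>)\<^sup>2) * phi \<alpha> a t \<xi>0) = pi powr (real DIM('a) / 2) * phi \<alpha> a t \<xi>0"
    using has_bochner_integral_gaussian_cos[of "1/4" "0::'a"] by (simp add: has_bochner_integral_iff)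
  ultimately have "(\<lambda>n. pi powr (- real DIM('a) / 2) * (LINT \<zeta>|lborel. ?h n \<zeta>)) \<longlonglongrightarrow> pi powr (- real DIM('a) / 2) * (pi powr (real DIM('a) / 2) * phi \<alpha> a t \<xi>0)"
    by (intro tendsto_mult tendsto_const) (simp only:)
  moreover have "pi powr (- real DIM('a) / 2) * (pi powr (real DIM('a) / 2) * phi \<alpha> a t \<xi>0) = phi \<alpha> a t \<xi>0"
    by (simp add: mult.assoc[symmetric] flip: powr_add)
  ultimately show ?thesis
    by (subst fourier_pa_regularized[OF t]) (simp_all only: of_nat_0_less_iff zero_less_Suc)
qed

text \<open>Nonnegativity makes Fatou's lemma applicable to the cut-off integrals at frequency 0,
  which bounds the mass by \<open>phi\<close> at 0. With integrability established, dominated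
  convergence removes the cut-off at every other frequency.\<close>

lemma
  assumes a: "a > 0" and t: "t > 0"
  shows integrable_pa: "integrable lborel (pa \<alpha> a t :: 'a \<Rightarrow> real)"
    and nn_integral_pa_le: "(\<integral>\<^sup>+w. ennreal (pa \<alpha> a t (w::'a)) \<partial>lborel) \<le> 1"
    and fourier_pa: "(LINT w|lborel. pa \<alpha> a t w * cos (w \<bullet> (\<xi>::'a))) = phi \<alpha> a t \<xi>"
proof -
  let ?G = "\<lambda>n (w::'a). exp (- (norm w)\<^sup>2 / (4 * (real (Suc n))\<^sup>2))"
  have pm [measurable]: "(pa \<alpha> a t :: 'a \<Rightarrow> real) \<in> borel_measurable borel" by measurable
  note nn = pa_nonneg[OF a t]
  have Glim: "(\<lambda>n. ?G n w) \<longlonglongrightarrow> 1" for w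
  proof -
    have "(\<lambda>n. exp (- (norm w)\<^sup>2 / 4 * (1 / real (Suc n))\<^sup>2)) \<longlonglongrightarrow> exp (- (norm w)\<^sup>2 / 4 * 0\<^sup>2)"
      by (intro tendsto_intros lim_inverse_n'[THEN LIMSEQ_Suc])
    then show ?thesis by (simp add: power_divide)
  qed
  obtain K where K: "K \<ge> 0" "\<And>w::'a. pa \<alpha> a t w \<le> K"
    using pa_le[OF t, of \<alpha> a, where 'a='a] order_trans[OF nn pa_le[OF t]] by (rule that[rotated])
  have Gi: "integrable lborel (?G n)" for n
    using integrable_gaussian[of "1 / (4 * (real (Suc n))\<^sup>2)", where 'a='a] by simp
  have Gpi: "integrable lborel (\<lambda>w. ?G n w * pa \<alpha> a t w)" for n
    by (rule Bochner_Integration.integrable_bound[OF integrable_mult_left[OF Gi[of n], of K]])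
       (use K nn in \<open>auto simp: abs_mult intro!: always_eventually mult_left_mono\<close>)
  have le: "(\<integral>\<^sup>+w. ennreal (?G n w * pa \<alpha> a t w) \<partial>lborel) = ennreal (LINT w|lborel. ?G n w * cos (w \<bullet> 0) * pa \<alpha> a t w)" for n
    using Gpi[of n] nn by (subst nn_integral_eq_integral) auto
  have "(\<integral>\<^sup>+w. ennreal (pa \<alpha> a t (w::'a)) \<partial>lborel) = (\<integral>\<^sup>+w. liminf (\<lambda>n. ennreal (?G n w * pa \<alpha> a t w)) \<partial>lborel)"
  proof (intro nn_integral_cong)
    fix w :: 'a
    have "(\<lambda>n. ?G n w * pa \<alpha> a t w) \<longlonglongrightarrow> 1 * pa \<alpha> a t w" by (intro tendsto_intros Glim)
    then have "(\<lambda>n. ennreal (?G n w * pa \<alpha> a t w)) \<longlonglongrightarrow> ennreal (pa \<alpha> a t w)"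
      by (intro tendsto_ennrealI) simp
    then show "ennreal (pa \<alpha> a t w) = liminf (\<lambda>n. ennreal (?G n w * pa \<alpha> a t w))"
      by (simp add: lim_imp_Liminf)
  qed
  also have "\<dots> \<le> liminf (\<lambda>n. \<integral>\<^sup>+w. ennreal (?G n w * pa \<alpha> a t w) \<partial>lborel)"
    by (rule nn_integral_liminf) auto
  also have "\<dots> = ennreal (phi \<alpha> a t (0::'a))"
    unfolding le
    by (intro lim_imp_Liminf tendsto_ennrealI fourier_pa_regularized_limit[OF t]) auto
  also have "\<dots> \<le> 1" using phi_le_1[of t \<alpha> a 0] t by simp
  finally show le1: "(\<integral>\<^sup>+w. ennreal (pa \<alpha> a t (w::'a)) \<partial>lborel) \<le> 1" .
  show int: "integrable lborel (pa \<alpha> a t :: 'a \<Rightarrow> real)"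
    using le1 nn by (intro integrableI_nonneg) (auto intro: le_less_trans)
  have "(\<lambda>n. LINT w|lborel. ?G n w * cos (w \<bullet> \<xi>) * pa \<alpha> a t w) \<longlonglongrightarrow> (LINT w|lborel. pa \<alpha> a t w * cos (w \<bullet> \<xi>))"
  proof (rule integral_dominated_convergence[OF _ _ int])
    show "AE w in lborel. (\<lambda>n. ?G n w * cos (w \<bullet> \<xi>) * pa \<alpha> a t w) \<longlonglongrightarrow> pa \<alpha> a t w * cos (w \<bullet> \<xi>)"
    proof (rule AE_I2)
      fix w :: 'a
      have "(\<lambda>n. ?G n w * cos (w \<bullet> \<xi>) * pa \<alpha> a t w) \<longlonglongrightarrow> 1 * cos (w \<bullet> \<xi>) * pa \<alpha> a t w"
        by (intro tendsto_intros Glim)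
      then show "(\<lambda>n. ?G n w * cos (w \<bullet> \<xi>) * pa \<alpha> a t w) \<longlonglongrightarrow> pa \<alpha> a t w * cos (w \<bullet> \<xi>)" by (simp add: mult.commute)
    qed
    show "AE w in lborel. norm (?G n w * cos (w \<bullet> \<xi>) * pa \<alpha> a t w) \<le> pa \<alpha> a t w" for n
      using nn by (intro AE_I2) (auto simp: abs_mult intro!: mult_left_le_one_le mult_le_one)
  qed auto
  then show "(LINT w|lborel. pa \<alpha> a t w * cos (w \<bullet> \<xi>)) = phi \<alpha> a t \<xi>"
    using fourier_pa_regularized_limit[OF t] LIMSEQ_unique by blast
qed

lemma pa_semigroup:
  fixes z :: 'a
  assumes a: "a > 0" and t: "t > 0" and s: "s > 0"
  shows "(LINT w|lborel. pa \<alpha> a t (z - w) * pa \<alpha> a s w) = pa \<alpha> a (t + s) z"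
proof -
  have "(LINT w|lborel. pa \<alpha> a t (z - w) * (LINT \<xi>|lborel. cos (w \<bullet> \<xi> + 0) * phi \<alpha> a s \<xi>)) =
         (LINT \<xi>|lborel. cos (z \<bullet> \<xi> + 0) * (LINT w|lborel. pa \<alpha> a t w * cos (w \<bullet> \<xi>)) * phi \<alpha> a s \<xi>)"
    by (rule integral_even_fourier[OF integrable_pa[OF a t] _ integrable_phi_moments(1)[OF s]]) simp
  then have eq: "(LINT w|lborel. pa \<alpha> a t (z - w) * (LINT \<xi>|lborel. cos (w \<bullet> \<xi>) * phi \<alpha> a s \<xi>)) =
     (LINT \<xi>|lborel. cos (z \<bullet> \<xi>) * phi \<alpha> a (t + s) \<xi>)"
    by (simp only: fourier_pa[OF a t] mult.assoc phi_add add_0_right)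
  have "pa \<alpha> a t (z - w) * pa \<alpha> a s w = (1 / (2 * pi) ^ DIM('a)) *
      (pa \<alpha> a t (z - w) * (LINT \<xi>|lborel. cos (w \<bullet> \<xi>) * phi \<alpha> a s \<xi>))" for w
    by (simp only: pa_eq_phi[of \<alpha> a s w] mult_ac)
  then show ?thesis
    by (simp only: integral_mult_right_zero eq pa_eq_phi[of \<alpha> a "t + s" z])
qed

lemma dpa_convolution:
  fixes z e :: 'a
  assumes a: "a > 0" and t: "t > 0" and s: "s > 0"
  shows "(LINT w|lborel. pa \<alpha> a t (z - w) * dpa \<alpha> a s w e) = dpa \<alpha> a (t + s) z e"
proof -
  \<comment> \<open>With this phase the cosine version of the convolution theorem covers the sine
    integral that defines \<open>dpa\<close>.\<close>
  have cs: "cos (x + - (pi / 2)) = sin x" for x :: real by (simp add: cos_diff)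
  have "(LINT w|lborel. pa \<alpha> a t (z - w) * (LINT \<xi>|lborel. cos (w \<bullet> \<xi> + - (pi / 2)) * ((e \<bullet> \<xi>) * phi \<alpha> a s \<xi>))) =
         (LINT \<xi>|lborel. cos (z \<bullet> \<xi> + - (pi / 2)) * (LINT w|lborel. pa \<alpha> a t w * cos (w \<bullet> \<xi>)) * ((e \<bullet> \<xi>) * phi \<alpha> a s \<xi>))"
    by (rule integral_even_fourier[OF integrable_pa[OF a t] _ integrable_trig_phi(3)[OF s]]) simp
  then have eq: "(LINT w|lborel. pa \<alpha> a t (z - w) * (LINT \<xi>|lborel. sin (w \<bullet> \<xi>) * ((e \<bullet> \<xi>) * phi \<alpha> a s \<xi>))) =
         (LINT \<xi>|lborel. sin (z \<bullet> \<xi>) * phi \<alpha> a t \<xi> * ((e \<bullet> \<xi>) * phi \<alpha> a s \<xi>))"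
    unfolding cs fourier_pa[OF a t] .
  have "sin (z \<bullet> \<xi>) * phi \<alpha> a t \<xi> * ((e \<bullet> \<xi>) * phi \<alpha> a s \<xi>) = sin (z \<bullet> \<xi>) * ((e \<bullet> \<xi>) * phi \<alpha> a (t + s) \<xi>)" for \<xi>
    by (simp add: mult_ac flip: phi_add)
  with eq have eq: "(LINT w|lborel. pa \<alpha> a t (z - w) * (LINT \<xi>|lborel. sin (w \<bullet> \<xi>) * ((e \<bullet> \<xi>) * phi \<alpha> a s \<xi>))) =
      (LINT \<xi>|lborel. sin (z \<bullet> \<xi>) * ((e \<bullet> \<xi>) * phi \<alpha> a (t + s) \<xi>))"
    by (simp only:)
  have "pa \<alpha> a t (z - w) * dpa \<alpha> a s w e = - (1 / (2 * pi) ^ DIM('a)) *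
      (pa \<alpha> a t (z - w) * (LINT \<xi>|lborel. sin (w \<bullet> \<xi>) * ((e \<bullet> \<xi>) * phi \<alpha> a s \<xi>)))" for w
    by (simp only: dpa_def[of \<alpha> a s w e] mult_ac)
  then show ?thesis
    by (simp only: integral_mult_right_zero eq dpa_def[of \<alpha> a "t + s" z e])
qed

text \<open>The derivative is made to fall on the Gaussian factor of the convolution. Difference
  quotients are estimated under the integral sign, where the doubled Gaussian recombines with the
  same second factor to a kernel of time \<open>2 * t / 3 + 2 * t / 3\<close>; only the resulting
  numerical inequality is passed to the limit. In the constant, 2 is 8/4 from the increment bound,
  \<open>2 powr (d / 2)\<close> comes from renormalising the doubled Gaussian, and
  \<open>sqrt 3\<close> from \<tau> = t / 3.\<close>

lemma dpa_bound:
  fixes z e :: 'a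
  assumes a: "a > 0" and t: "t > 0" and a': "a' > 0" "a' powr \<alpha> * (4 / 3) = a powr \<alpha>"
  shows "\<bar>dpa \<alpha> a t z e\<bar> \<le> 2 * 2 powr (real DIM('a) / 2) * sqrt 3 / sqrt t * norm e * pa \<alpha> a' (4 / 3 * t) z"
proof -
  define \<tau> where "\<tau> = t / 3"
  define s where "s = 2 * t / 3"
  txt \<open>\<open>p^a(t)\<close> is the convolution of \<open>gauss (t/3)\<close> with \<open>p^{a''}(2t/3)\<close>.\<close>
  define a'' where "a'' = a * (3 / 2) powr (1 / \<alpha>)"
  have \<tau>: "\<tau> > 0" and s: "s > 0" and a'': "a'' > 0" using t a by (auto simp: \<tau>_def s_def a''_def)
  have pa'': "a'' powr \<alpha> = a powr \<alpha> * (3 / 2)"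
    using a \<alpha>_pos by (simp add: a''_def powr_mult powr_powr)
  have c1: "(LINT w|lborel. gauss \<tau> (y - w) * pa \<alpha> a'' s w) = pa \<alpha> a t y" for y :: 'a
  proof -
    have "s + \<tau> = t" by (simp add: \<tau>_def s_def)
    then show ?thesis
      using integral_gauss_pa[OF \<tau> s, of a \<alpha> a'' y] by (simp add: pa'' s_def)
  qed
  have c2: "(LINT w|lborel. gauss (2 * \<tau>) (z - w) * pa \<alpha> a'' s w) = pa \<alpha> a' (4 / 3 * t) z"
  proof -
    have st: "s + 2 * \<tau> = 4 / 3 * t" by (simp add: \<tau>_def s_def)
    have "a' powr \<alpha> * (4 / 3 * t) = (a' powr \<alpha> * (4 / 3)) * t" by simp
    also have "\<dots> = a'' powr \<alpha> * s" by (simp only: a'(2) pa'' s_def)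
    finally show ?thesis
      using integral_gauss_pa[of "2 * \<tau>" s a' \<alpha> a'' z] \<tau> s st by simp
  qed
  have gi: "integrable lborel (\<lambda>w. gauss \<sigma> (y - w) * pa \<alpha> a'' s w)" if "\<sigma> > 0" for \<sigma> and y :: 'a
  proof -
    have "norm (gauss \<sigma> (y - w) * pa \<alpha> a'' s w) \<le> norm ((4 * pi * \<sigma>) powr (- real DIM('a) / 2) * pa \<alpha> a'' s w)" for w
      using pa_nonneg[OF a'' s, of w] that by (simp add: gauss_def abs_mult mult_right_mono mult_left_le)
    then show ?thesis
      by (intro Bochner_Integration.integrable_bound[OF integrable_mult_right[OF integrable_pa[OF a'' s], of "(4 * pi * \<sigma>) powr (- real DIM('a) / 2)"]])
         (auto intro!: always_eventually borel_measurable_times)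
  qed
  let ?C = "2 powr (real DIM('a) / 2) * pa \<alpha> a' (4 / 3 * t) z"
  let ?B = "\<lambda>h. norm e * (8 + h * norm e / sqrt \<tau>) / (4 * sqrt \<tau>) * exp (3 * (h * norm e)\<^sup>2 / (4 * \<tau>)) * ?C"
  have diff: "\<bar>(pa \<alpha> a t (z + h *\<^sub>R e) - pa \<alpha> a t z) / h\<bar> \<le> ?B h" if h: "h > 0" for h
  proof -
    let ?k = "h * norm e * (8 + h * norm e / sqrt \<tau>) / (4 * sqrt \<tau>) * exp (3 * (h * norm e)\<^sup>2 / (4 * \<tau>)) * 2 powr (real DIM('a) / 2)"
    have nk: "norm (h *\<^sub>R e) = h * norm e" using h by simp
    have eq: "pa \<alpha> a t (z + h *\<^sub>R e) - pa \<alpha> a t z = (LINT w|lborel. gauss \<tau> (z + h *\<^sub>R e - w) * pa \<alpha> a'' s w - gauss \<tau> (z - w) * pa \<alpha> a'' s w)"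
      by (subst Bochner_Integration.integral_diff[OF gi[OF \<tau>] gi[OF \<tau>]]) (simp add: c1)
    have "\<bar>pa \<alpha> a t (z + h *\<^sub>R e) - pa \<alpha> a t z\<bar> \<le> (LINT w|lborel. ?k * (gauss (2 * \<tau>) (z - w) * pa \<alpha> a'' s w))"
      unfolding eq
    proof (rule Bochner_Integration.integral_abs_bound_integral)
      show "\<bar>gauss \<tau> (z + h *\<^sub>R e - w) * pa \<alpha> a'' s w - gauss \<tau> (z - w) * pa \<alpha> a'' s w\<bar> \<le> ?k * (gauss (2 * \<tau>) (z - w) * pa \<alpha> a'' s w)" for w
      proof -
        have zw: "z + h *\<^sub>R e - w = (z - w) + h *\<^sub>R e" by simp
        have "\<bar>gauss \<tau> ((z - w) + h *\<^sub>R e) - gauss \<tau> (z - w)\<bar> \<le> ?k * gauss (2 * \<tau>) (z - w)"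
          using gauss_increment_bound[OF \<tau>, of "z - w" "h *\<^sub>R e"] unfolding nk .
        then have "\<bar>gauss \<tau> ((z - w) + h *\<^sub>R e) - gauss \<tau> (z - w)\<bar> * pa \<alpha> a'' s w \<le> ?k * gauss (2 * \<tau>) (z - w) * pa \<alpha> a'' s w"
          using pa_nonneg[OF a'' s] by (rule mult_right_mono)
        moreover have "\<bar>gauss \<tau> (z + h *\<^sub>R e - w) * pa \<alpha> a'' s w - gauss \<tau> (z - w) * pa \<alpha> a'' s w\<bar> =
            \<bar>gauss \<tau> ((z - w) + h *\<^sub>R e) - gauss \<tau> (z - w)\<bar> * pa \<alpha> a'' s w"
          unfolding zw by (simp only: left_diff_distrib[symmetric] abs_mult abs_of_nonneg[OF pa_nonneg[OF a'' s]])
        ultimately show ?thesis by (simp only: mult.assoc)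
      qed
      show "integrable lborel (\<lambda>w. gauss \<tau> (z + h *\<^sub>R e - w) * pa \<alpha> a'' s w - gauss \<tau> (z - w) * pa \<alpha> a'' s w)"
        by (intro Bochner_Integration.integrable_diff gi \<tau>)
      show "integrable lborel (\<lambda>w. ?k * (gauss (2 * \<tau>) (z - w) * pa \<alpha> a'' s w))"
        by (intro integrable_mult_right gi) (use \<tau> in simp)
    qed
    then have "\<bar>pa \<alpha> a t (z + h *\<^sub>R e) - pa \<alpha> a t z\<bar> \<le> ?k * pa \<alpha> a' (4 / 3 * t) z"
      by (simp only: integral_mult_right_zero c2)
    then have le: "\<bar>pa \<alpha> a t (z + h *\<^sub>R e) - pa \<alpha> a t z\<bar> / h \<le> ?k * pa \<alpha> a' (4 / 3 * t) z / h"
      using h by (intro divide_right_mono) auto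
    have cancel: "h * u * v / w * x * y * q / h = u * v / w * x * (y * q)" for u v w x y q :: real
    proof -
      have "h * u * v / w * x * y * q / h = (h * (u * v / w * x * (y * q))) / h"
        by (simp only: mult.assoc times_divide_eq_left times_divide_eq_right)
      also have "\<dots> = u * v / w * x * (y * q)" by (rule nonzero_mult_div_cancel_left) (use h in simp)
      finally show ?thesis .
    qed
    have "\<bar>(pa \<alpha> a t (z + h *\<^sub>R e) - pa \<alpha> a t z) / h\<bar> = \<bar>pa \<alpha> a t (z + h *\<^sub>R e) - pa \<alpha> a t z\<bar> / h"
      using h by (simp only: abs_divide abs_of_pos)
    also note le
    also note cancel
    finally show ?thesis .
  qed
  have lim: "((\<lambda>h. (pa \<alpha> a t (z + h *\<^sub>R e) - pa \<alpha> a t z) / h) \<longlongrightarrow> dpa \<alpha> a t z e) (at_right 0)"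
  proof -
    have "((\<lambda>h. pa \<alpha> a t (z + h *\<^sub>R e)) has_derivative (\<lambda>h. dpa \<alpha> a t z (h *\<^sub>R e))) (at 0)"
      using pa_has_derivative[OF t, of \<alpha> a z]
      by (intro has_derivative_compose[where g="pa \<alpha> a t" and f="\<lambda>h. z + h *\<^sub>R e"]) (auto intro!: derivative_eq_intros)
    moreover have "dpa \<alpha> a t z (h *\<^sub>R e) = dpa \<alpha> a t z e * h" for h
      using linear_scale[OF has_derivative_linear[OF pa_has_derivative[OF t, of \<alpha> a z]], of h e] by simp
    ultimately have "((\<lambda>h. pa \<alpha> a t (z + h *\<^sub>R e)) has_field_derivative dpa \<alpha> a t z e) (at 0)"
      unfolding has_field_derivative_def by (simp add: fun_eq_iff)
    then have "((\<lambda>h. (pa \<alpha> a t (z + h *\<^sub>R e) - pa \<alpha> a t z) / h) \<longlongrightarrow> dpa \<alpha> a t z e) (at 0)"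
      by (simp add: DERIV_def)
    then show ?thesis by (rule filterlim_mono) (auto simp: at_le)
  qed
  have limB: "(?B \<longlongrightarrow> norm e * (8 + 0 * norm e / sqrt \<tau>) / (4 * sqrt \<tau>) * exp (3 * (0 * norm e)\<^sup>2 / (4 * \<tau>)) * ?C) (at_right 0)"
    using \<tau> by (intro tendsto_intros) auto
  have "\<bar>dpa \<alpha> a t z e\<bar> \<le> norm e * (8 + 0 * norm e / sqrt \<tau>) / (4 * sqrt \<tau>) * exp (3 * (0 * norm e)\<^sup>2 / (4 * \<tau>)) * ?C"
  proof (rule tendsto_le[OF _ limB tendsto_rabs[OF lim]])
    show "\<forall>\<^sub>F h in at_right 0. \<bar>(pa \<alpha> a t (z + h *\<^sub>R e) - pa \<alpha> a t z) / h\<bar> \<le> ?B h"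
      using diff by (auto simp: eventually_at_filter)
  qed simp
  also have "\<dots> = 2 * 2 powr (real DIM('a) / 2) * sqrt 3 / sqrt t * norm e * pa \<alpha> a' (4 / 3 * t) z"
    using t by (simp add: \<tau>_def real_sqrt_divide field_simps)
  finally show ?thesis .
qed

end

section \<open>A pointwise bound for products of kernels\<close>

text \<open>The jump part of \<open>q\<close> with radial argument \<open>R = \<bar>z\<bar>\<close>; the value at \<open>R = 0\<close> replaces \<open>min t^{-d/2} \<infinity>\<close>.\<close>

definition jump :: "real \<Rightarrow> real \<Rightarrow> real \<Rightarrow> real \<Rightarrow> real \<Rightarrow> real" where
  "jump d \<alpha> c t R = (if R = 0 then t powr (- d / 2) else min (t powr (- d / 2)) (c / R powr (d + \<alpha>)))"

definition bell :: "real \<Rightarrow> real \<Rightarrow> real \<Rightarrow> real \<Rightarrow> real" where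
  "bell d \<beta> t R = t powr (- d / 2) * exp (- \<beta> * R\<^sup>2 / t)"

lemma qa_eq_bell_jump:
  "qa \<alpha> a \<beta> t (z::'a::euclidean_space) = bell (real DIM('a)) \<beta> t (norm z) + jump (real DIM('a)) \<alpha> (a powr \<alpha> * t) t (norm z)"
  by (simp add: qa_def bell_def jump_def)

text \<open>In the multiplied form the case \<open>R = 0\<close> needs no special treatment, since
  \<open>0 powr (d + \<alpha>)\<close> is 0. Upper estimates by \<open>jump\<close> below are
  reduced to these two conditions.\<close>

lemma le_jump_iff:
  assumes "c \<ge> 0" "R \<ge> 0"
  shows "V \<le> jump d \<alpha> c t R \<longleftrightarrow> V \<le> t powr (- d / 2) \<and> V * R powr (d + \<alpha>) \<le> c"
  using assms by (auto simp: jump_def pos_le_divide_eq)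

lemma jump_nonneg: "c \<ge> 0 \<Longrightarrow> 0 \<le> jump d \<alpha> c t R"
  by (auto simp: jump_def)

lemma jump_le_powr: "jump d \<alpha> c t R \<le> t powr (- d / 2)"
  by (auto simp: jump_def)

lemma jump_mult_le: "c \<ge> 0 \<Longrightarrow> R \<ge> 0 \<Longrightarrow> jump d \<alpha> c t R * R powr (d + \<alpha>) \<le> c"
  using le_jump_iff[of c R "jump d \<alpha> c t R" d \<alpha> t] by simp

lemma jump_mono_scale:
  assumes "0 \<le> c" "c \<le> K * c'" "1 \<le> K" "0 \<le> c'" "0 \<le> R"
  shows "jump d \<alpha> c t R \<le> K * jump d \<alpha> c' t R"
proof -
  have K: "K > 0" using assms by simp
  have "jump d \<alpha> c t R / K \<le> jump d \<alpha> c' t R"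
    unfolding le_jump_iff[OF assms(4,5)]
  proof
    have "jump d \<alpha> c t R / K \<le> jump d \<alpha> c t R / 1"
      using assms by (intro divide_left_mono jump_nonneg) auto
    then show "jump d \<alpha> c t R / K \<le> t powr (- d / 2)" using jump_le_powr[of d \<alpha> c t R] by simp
    have "jump d \<alpha> c t R * R powr (d + \<alpha>) \<le> K * c'"
      using jump_mult_le[of c R d \<alpha> t] assms by linarith
    then show "jump d \<alpha> c t R / K * R powr (d + \<alpha>) \<le> c'" using K by (simp add: field_simps)
  qed
  then show ?thesis using K by (simp add: field_simps)
qed

lemma bell_nonneg: "0 \<le> bell d \<beta> t R"
  by (simp add: bell_def)

lemma bell_le_powr: "\<beta> \<ge> 0 \<Longrightarrow> t > 0 \<Longrightarrow> bell d \<beta> t R \<le> t powr (- d / 2)"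
  unfolding bell_def by (intro mult_left_le) auto

lemma powr_mult_gaussian_le:
  fixes m \<beta> :: real
  assumes m: "m > 0" and \<beta>: "\<beta> > 0"
  obtains C where "C \<ge> 1" "\<And>s w. s > 0 \<Longrightarrow> w \<ge> 0 \<Longrightarrow> w powr m * exp (- \<beta> * w\<^sup>2 / s) \<le> C * s powr (m / 2)"
proof
  \<comment> \<open>Chosen so that \<open>m / 2 * e = \<beta>\<close>: the inequality
    \<open>ln (e * x) \<le> e * x - 1\<close>, multiplied by \<open>m / 2\<close>, then produces
    exactly the exponent \<open>\<beta> * x\<close>.\<close>
  define e where "e = 2 * \<beta> / m"
  have e: "e > 0" using assms by (simp add: e_def)
  let ?C = "max 1 (exp (m / 2 * (- 1 - ln e)))"
  show "?C \<ge> 1" by simp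
  show "w powr m * exp (- \<beta> * w\<^sup>2 / s) \<le> ?C * s powr (m / 2)" if s: "s > 0" and w: "w \<ge> 0" for s w
  proof (cases "w = 0")
    case False
    with w have w: "w > 0" by simp
    define x where "x = w\<^sup>2 / s"
    have x: "x > 0" using w s by (simp add: x_def)
    have "ln (e * x) \<le> e * x - 1" using e x by (intro ln_le_minus_one) auto
    then have "ln x \<le> e * x - 1 - ln e" using e x by (simp add: ln_mult)
    then have "m / 2 * ln x \<le> m / 2 * (e * x - 1 - ln e)" using m by (intro mult_left_mono) auto
    also have "\<dots> = \<beta> * x + m / 2 * (- 1 - ln e)" using m by (simp add: e_def field_simps)
    finally have "x powr (m / 2) \<le> exp (\<beta> * x) * exp (m / 2 * (- 1 - ln e))"
      using x by (simp add: powr_def flip: exp_add)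
    then have "x powr (m / 2) * exp (- \<beta> * x) \<le> exp (\<beta> * x) * exp (m / 2 * (- 1 - ln e)) * exp (- \<beta> * x)"
      by (intro mult_right_mono) auto
    also have "\<dots> = exp (m / 2 * (- 1 - ln e))" by (simp add: mult_ac flip: exp_add)
    finally have b: "x powr (m / 2) * exp (- \<beta> * x) \<le> ?C" by simp
    have "w\<^sup>2 = w powr 2" using w by simp
    then have "w\<^sup>2 powr (m / 2) = w powr m" by (simp only: powr_powr) simp
    then have "w powr m = x powr (m / 2) * s powr (m / 2)"
      using s by (simp add: x_def flip: powr_mult)
    then have "w powr m * exp (- \<beta> * w\<^sup>2 / s) = (x powr (m / 2) * exp (- \<beta> * x)) * s powr (m / 2)"
      by (simp add: x_def)
    also have "\<dots> \<le> ?C * s powr (m / 2)" by (intro mult_right_mono b) auto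
    finally show ?thesis .
  qed (use m in simp)
qed

text \<open>A Gaussian at time \<open>s\<close> decays faster than the power
  \<open>d + \<alpha>\<close> of the distance measured in units of \<open>sqrt s\<close>. The jump
  coefficient \<open>s powr (\<alpha> / 2)\<close> is the one dictated by this scaling, which is why
  it appears in the envelope.\<close>

lemma bell_le_envelope:
  assumes d: "d > 0" and \<alpha>: "\<alpha> > 0" and \<beta>: "\<beta> > 0"
  obtains C where "C \<ge> 1" "\<And>s w. s > 0 \<Longrightarrow> w \<ge> 0 \<Longrightarrow> bell d \<beta> s w \<le> C * jump d \<alpha> (s powr (\<alpha> / 2)) s w"
proof -
  have "d + \<alpha> > 0" using d \<alpha> by simp
  then obtain C where C: "C \<ge> 1" and le: "\<And>s w. s > 0 \<Longrightarrow> w \<ge> 0 \<Longrightarrow> w powr (d + \<alpha>) * exp (- \<beta> * w\<^sup>2 / s) \<le> C * s powr ((d + \<alpha>) / 2)"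
    using powr_mult_gaussian_le \<beta> by blast
  have "bell d \<beta> s w \<le> C * jump d \<alpha> (s powr (\<alpha> / 2)) s w" if s: "s > 0" and w: "w \<ge> 0" for s w
  proof -
    have "bell d \<beta> s w / C \<le> jump d \<alpha> (s powr (\<alpha> / 2)) s w"
      unfolding le_jump_iff[OF powr_ge_zero w]
    proof
      have "bell d \<beta> s w / C \<le> bell d \<beta> s w / 1"
        using C by (intro divide_left_mono bell_nonneg) auto
      then show "bell d \<beta> s w / C \<le> s powr (- d / 2)"
        using bell_le_powr[of \<beta> s d w] \<beta> s by simp
      have "bell d \<beta> s w * w powr (d + \<alpha>) = s powr (- d / 2) * (w powr (d + \<alpha>) * exp (- \<beta> * w\<^sup>2 / s))"
        by (simp add: bell_def)
      also have "\<dots> \<le> s powr (- d / 2) * (C * s powr ((d + \<alpha>) / 2))"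
        by (intro mult_left_mono le s w) auto
      also have "\<dots> = C * s powr (\<alpha> / 2)"
        using s by (simp add: add_divide_distrib flip: powr_add)
      finally show "bell d \<beta> s w / C * w powr (d + \<alpha>) \<le> s powr (\<alpha> / 2)"
        using C by (simp add: field_simps)
    qed
    then show ?thesis using C by (simp add: field_simps)
  qed
  with C that show ?thesis by blast
qed

text \<open>The Cauchy-Schwarz inequality behind convolution of Gaussians: the exponents of two
  steps dominate the exponent of the combined step. The defect is the square of
  \<open>q * X - p * Y\<close>.\<close>

lemma sum_squares_over_ge:
  fixes X Y p q :: real
  assumes "p > 0" "q > 0" "0 \<le> R" "R \<le> X + Y"
  shows "X\<^sup>2 / p + Y\<^sup>2 / q \<ge> R\<^sup>2 / (p + q)"
proof -
  have "R\<^sup>2 / (p + q) \<le> (X + Y)\<^sup>2 / (p + q)"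
    using assms by (intro divide_right_mono power_mono) auto
  also have "\<dots> \<le> X\<^sup>2 / p + Y\<^sup>2 / q"
  proof -
    have "X\<^sup>2 / p + Y\<^sup>2 / q - (X + Y)\<^sup>2 / (p + q) = (q * X - p * Y)\<^sup>2 / (p * q * (p + q))"
      using assms(1,2) by (simp add: divide_simps add_nonneg_eq_0_iff) (simp add: power2_eq_square algebra_simps)
    also have "\<dots> \<ge> 0" using assms by simp
    finally show ?thesis by simp
  qed
  finally show ?thesis .
qed

lemma powr_half_le:
  fixes t u d :: real
  assumes "0 < t" "t \<le> 2 * u" "0 < d"
  shows "u powr (- d / 2) \<le> 2 powr (d / 2) * t powr (- d / 2)"
proof -
  have "u powr (- d / 2) \<le> (t / 2) powr (- d / 2)"
    using assms by (intro powr_mono2') auto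
  also have "\<dots> = 2 powr (d / 2) * t powr (- d / 2)"
    using assms by (simp add: powr_divide powr_minus field_simps)
  finally show ?thesis .
qed

text \<open>\<open>A * B\<close> is \<open>min A B\<close> times \<open>max A B\<close>. The smaller
  factor yields the kernel at the total time; the larger one is paid for by whichever of the two
  envelopes belongs to it.\<close>

lemma product_le_min_mult_sum:
  fixes A B :: real
  assumes "0 \<le> A" "0 \<le> B" "0 \<le> C" "A \<le> C * hX" "B \<le> C * hY" "0 \<le> hX" "0 \<le> hY" "min A B \<le> D"
  shows "A * B \<le> C * D * (hX + hY)"
proof -
  have "A * B = min A B * max A B" by (simp add: min_def max_def)
  also have "\<dots> \<le> D * (C * (hX + hY))"
  proof (rule mult_mono)
    have "C * hX \<le> C * (hX + hY)" "C * hY \<le> C * (hX + hY)"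
      using assms by (auto intro!: mult_left_mono)
    then show "max A B \<le> C * (hX + hY)" using assms by linarith
    show "0 \<le> D" using assms by (meson min.boundedI order_trans)
  qed (use assms in auto)
  finally show ?thesis by (simp add: mult_ac)
qed

text \<open>A scale-invariant kernel, independent of \<open>a\<close>, that dominates both parts of \<open>q\<close> for small times.\<close>

abbreviation envelope :: "real \<Rightarrow> real \<Rightarrow> real \<Rightarrow> real \<Rightarrow> real" where
  "envelope d \<alpha> s w \<equiv> jump d \<alpha> (s powr (\<alpha> / 2)) s w"

lemma envelope_nonneg: "0 \<le> envelope d \<alpha> s w"
  by (rule jump_nonneg) simp

text \<open>Two quantities have to be left over from the product: the Gaussian at time
  \<open>u + v\<close> and an integrable factor at the shorter of the times. If
  \<open>v \<le> u\<close>, the surplus \<open>\<gamma>' - \<gamma>\<close> in the second factor is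
  the remainder. If \<open>u < v\<close>, the first factor is weakened from \<gamma> to
  \<open>l\<close> and the difference is kept; the stronger exponent \<open>\<gamma>'\<close> on the
  longer time \<open>v\<close> makes up for the loss. In both cases the prefactor of the longer time
  is comparable with that of \<open>u + v\<close>.\<close>

lemma bell_bell_3P:
  assumes d: "d > 0" and \<alpha>: "\<alpha> > 0" and \<gamma>: "0 < \<gamma>" "\<gamma> < \<gamma>'"
  obtains C where "C \<ge> 1"
    "\<And>u v X Y R. u > 0 \<Longrightarrow> v > 0 \<Longrightarrow> X \<ge> 0 \<Longrightarrow> Y \<ge> 0 \<Longrightarrow> 0 \<le> R \<Longrightarrow> R \<le> X + Y \<Longrightarrow>
      bell d \<gamma> u X * bell d \<gamma>' v Y \<le> C * bell d \<gamma> (u + v) R * (envelope d \<alpha> u X + envelope d \<alpha> v Y)"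
proof -
  txt \<open>\<open>1/l + 1/\<gamma>' = 2/\<gamma>\<close>, so that \<open>u/l + v/\<gamma>' \<le> (u + v)/\<gamma>\<close> whenever \<open>u \<le> v\<close>.\<close>
  define l where "l = \<gamma> * \<gamma>' / (2 * \<gamma>' - \<gamma>)"
  have l: "0 < l" "l < \<gamma>" "1 / l = 2 / \<gamma> - 1 / \<gamma>'"
  proof -
    have p: "2 * \<gamma>' - \<gamma> > 0" using \<gamma> by simp
    show "0 < l" using \<gamma> p by (simp add: l_def)
    have "\<gamma> * \<gamma>' < \<gamma> * (2 * \<gamma>' - \<gamma>)" using \<gamma> by (intro mult_strict_left_mono) auto
    then show "l < \<gamma>" using p by (simp add: l_def pos_divide_less_eq)
    show "1 / l = 2 / \<gamma> - 1 / \<gamma>'" using \<gamma> p by (simp add: l_def diff_divide_distrib)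
  qed
  have g: "\<gamma>' - \<gamma> > 0" "\<gamma> - l > 0" using \<gamma> l by auto
  obtain C1 where C1: "C1 \<ge> 1" "\<And>s w. s > 0 \<Longrightarrow> w \<ge> 0 \<Longrightarrow> bell d (\<gamma>' - \<gamma>) s w \<le> C1 * envelope d \<alpha> s w"
    by (rule bell_le_envelope[OF d \<alpha> g(1)], rule that)
  obtain C2 where C2: "C2 \<ge> 1" "\<And>s w. s > 0 \<Longrightarrow> w \<ge> 0 \<Longrightarrow> bell d (\<gamma> - l) s w \<le> C2 * envelope d \<alpha> s w"
    by (rule bell_le_envelope[OF d \<alpha> g(2)], rule that)
  let ?D = "2 powr (d / 2)"
  define C where "C = ?D * max C1 C2"
  have D1: "?D \<ge> 1" using d by (intro ge_one_powr_ge_zero) auto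
  have C: "C \<ge> 1" using D1 C1 mult_mono[of 1 ?D 1 "max C1 C2"] by (simp add: C_def)
  have "bell d \<gamma> u X * bell d \<gamma>' v Y \<le> C * bell d \<gamma> (u + v) R * (envelope d \<alpha> u X + envelope d \<alpha> v Y)"
    if uv: "u > 0" "v > 0" and XY: "X \<ge> 0" "Y \<ge> 0" "0 \<le> R" "R \<le> X + Y" for u v X Y R
  proof -
    let ?E = "u powr (- d / 2) * v powr (- d / 2)"
    let ?t = "u + v"
    have prod: "bell d \<gamma> u X * bell d \<gamma>' v Y = ?E * exp (- (\<gamma> * X\<^sup>2 / u + \<gamma>' * Y\<^sup>2 / v))"
      by (simp add: bell_def exp_add[symmetric] mult_ac)
    have main: "bell d \<gamma> u X * bell d \<gamma>' v Y \<le> ?D * bell d \<gamma> ?t R * bell d k s w"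
      if le: "\<gamma> * X\<^sup>2 / u + \<gamma>' * Y\<^sup>2 / v \<ge> \<gamma> * R\<^sup>2 / ?t + k * w\<^sup>2 / s"
       and E: "?E \<le> ?D * ?t powr (- d / 2) * s powr (- d / 2)" for k s w
    proof -
      have "?E * exp (- (\<gamma> * X\<^sup>2 / u + \<gamma>' * Y\<^sup>2 / v)) \<le> (?D * ?t powr (- d / 2) * s powr (- d / 2)) * exp (- (\<gamma> * R\<^sup>2 / ?t + k * w\<^sup>2 / s))"
        using le by (intro mult_mono E) auto
      also have "\<dots> = ?D * bell d \<gamma> ?t R * bell d k s w"
        by (simp add: bell_def exp_add[symmetric] mult_ac)
      finally show ?thesis unfolding prod .
    qed
    have fin: "?D * bell d \<gamma> ?t R * h \<le> C * bell d \<gamma> ?t R * (envelope d \<alpha> u X + envelope d \<alpha> v Y)"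
      if "h \<le> max C1 C2 * (envelope d \<alpha> u X + envelope d \<alpha> v Y)" for h
    proof -
      have "?D * bell d \<gamma> ?t R * h \<le> ?D * bell d \<gamma> ?t R * (max C1 C2 * (envelope d \<alpha> u X + envelope d \<alpha> v Y))"
        using that by (intro mult_left_mono) (auto simp: bell_nonneg)
      then show ?thesis by (simp add: C_def mult_ac)
    qed
    show ?thesis
    proof (cases "v \<le> u")
      case True
      have "X\<^sup>2 / u + Y\<^sup>2 / v \<ge> R\<^sup>2 / ?t" by (rule sum_squares_over_ge) (use uv XY in auto)
      then have "\<gamma> * (X\<^sup>2 / u + Y\<^sup>2 / v) \<ge> \<gamma> * (R\<^sup>2 / ?t)" using \<gamma> by (intro mult_left_mono) auto
      then have "\<gamma> * X\<^sup>2 / u + \<gamma>' * Y\<^sup>2 / v \<ge> \<gamma> * R\<^sup>2 / ?t + (\<gamma>' - \<gamma>) * Y\<^sup>2 / v"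
        by (simp add: algebra_simps diff_divide_distrib)
      moreover have "?E \<le> ?D * ?t powr (- d / 2) * v powr (- d / 2)"
        using uv True d by (intro mult_right_mono powr_half_le) auto
      ultimately have "bell d \<gamma> u X * bell d \<gamma>' v Y \<le> ?D * bell d \<gamma> ?t R * bell d (\<gamma>' - \<gamma>) v Y"
        by (rule main)
      also have "\<dots> \<le> C * bell d \<gamma> ?t R * (envelope d \<alpha> u X + envelope d \<alpha> v Y)"
      proof (rule fin)
        have "bell d (\<gamma>' - \<gamma>) v Y \<le> C1 * envelope d \<alpha> v Y" using C1 uv XY by auto
        also have "\<dots> \<le> max C1 C2 * (envelope d \<alpha> u X + envelope d \<alpha> v Y)"
          using C1 by (intro mult_mono) (auto simp: envelope_nonneg)
        finally show "bell d (\<gamma>' - \<gamma>) v Y \<le> max C1 C2 * (envelope d \<alpha> u X + envelope d \<alpha> v Y)" .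
      qed
      finally show ?thesis .
    next
      case False
      have pq: "u / l + v / \<gamma>' \<le> ?t / \<gamma>"
      proof -
        have "u / l = u * (2 / \<gamma> - 1 / \<gamma>')" using l(3) by (metis mult.right_neutral times_divide_eq_right)
        moreover have "(u - v) * (1 / \<gamma> - 1 / \<gamma>') \<le> 0"
          using False \<gamma> by (intro mult_nonpos_nonneg) (auto simp: field_simps)
        moreover have "u * (2 / \<gamma> - 1 / \<gamma>') = 2 * (u / \<gamma>) - u / \<gamma>'" by (simp add: right_diff_distrib)
        moreover have "(u - v) * (1 / \<gamma> - 1 / \<gamma>') = u / \<gamma> - u / \<gamma>' - (v / \<gamma> - v / \<gamma>')"
          by (simp add: right_diff_distrib diff_divide_distrib)
        moreover have "?t / \<gamma> = u / \<gamma> + v / \<gamma>" by (rule add_divide_distrib)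
        ultimately show ?thesis by linarith
      qed
      have "\<gamma> * R\<^sup>2 / ?t = R\<^sup>2 / (?t / \<gamma>)" by simp
      also have "\<dots> \<le> R\<^sup>2 / (u / l + v / \<gamma>')"
        using pq uv l \<gamma> by (intro divide_left_mono) (auto intro!: mult_pos_pos add_pos_pos divide_pos_pos)
      also have "\<dots> \<le> X\<^sup>2 / (u / l) + Y\<^sup>2 / (v / \<gamma>')"
        by (rule sum_squares_over_ge) (use uv XY l \<gamma> in auto)
      finally have "\<gamma> * X\<^sup>2 / u + \<gamma>' * Y\<^sup>2 / v \<ge> \<gamma> * R\<^sup>2 / ?t + (\<gamma> - l) * X\<^sup>2 / u"
        by (simp add: algebra_simps diff_divide_distrib)
      moreover have "?E \<le> ?D * ?t powr (- d / 2) * u powr (- d / 2)"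
        using uv False d powr_half_le[of ?t v d] mult_left_mono[of "v powr (- d / 2)" "?D * ?t powr (- d / 2)" "u powr (- d / 2)"]
        by (simp add: mult_ac)
      ultimately have "bell d \<gamma> u X * bell d \<gamma>' v Y \<le> ?D * bell d \<gamma> ?t R * bell d (\<gamma> - l) u X"
        by (rule main)
      also have "\<dots> \<le> C * bell d \<gamma> ?t R * (envelope d \<alpha> u X + envelope d \<alpha> v Y)"
      proof (rule fin)
        have "bell d (\<gamma> - l) u X \<le> C2 * envelope d \<alpha> u X" using C2 uv XY by auto
        also have "\<dots> \<le> max C1 C2 * (envelope d \<alpha> u X + envelope d \<alpha> v Y)"
          using C2 by (intro mult_mono) (auto simp: envelope_nonneg)
        finally show "bell d (\<gamma> - l) u X \<le> max C1 C2 * (envelope d \<alpha> u X + envelope d \<alpha> v Y)" .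
      qed
      finally show ?thesis .
    qed
  qed
  with C that show ?thesis by blast
qed

text \<open>For \<open>s \<le> 1\<close> and \<alpha> < 2 one has
  \<open>s \<le> s powr (\<alpha> / 2)\<close>; this is what ties the envelope to small times and
  makes it uniform in \<open>a \<le> M\<close>.\<close>

lemma jump_le_envelope:
  assumes \<alpha>: "0 < \<alpha>" "\<alpha> < 2" and a: "0 \<le> a" "a \<le> M" and s: "0 < s" "s \<le> 1" and w: "0 \<le> w"
  shows "jump d \<alpha> (a powr \<alpha> * s) s w \<le> max 1 (M powr \<alpha>) * envelope d \<alpha> s w"
proof (rule jump_mono_scale)
  have "a powr \<alpha> * s \<le> max 1 (M powr \<alpha>) * s powr (\<alpha> / 2)"
  proof (rule mult_mono)
    show "a powr \<alpha> \<le> max 1 (M powr \<alpha>)" using powr_mono2[of \<alpha> a M] \<alpha> a by simp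
    show "s \<le> s powr (\<alpha> / 2)" using powr_mono'[of "\<alpha> / 2" 1 s] \<alpha> s by simp
  qed (use s in auto)
  then show "a powr \<alpha> * s \<le> max 1 (M powr \<alpha>) * s powr (\<alpha> / 2)" .
qed (use w s in auto)

text \<open>The larger of \<open>X\<close> and \<open>Y\<close> is at least \<open>R / 2\<close> and
  the larger of \<open>u\<close> and \<open>v\<close> at least \<open>(u + v) / 2\<close>. Hence the
  smaller of the two jump factors satisfies both bounds that define the jump kernel at the total
  time, up to \<open>2 powr (d + \<alpha>)\<close>.\<close>

lemma jump_jump_3P:
  assumes d: "d > 0" and \<alpha>: "0 < \<alpha>" "\<alpha> < 2" and a: "0 \<le> a" "a \<le> M"
    and uv: "u > 0" "v > 0" "u + v \<le> 1" and XY: "X \<ge> 0" "Y \<ge> 0" "0 \<le> R" "R \<le> X + Y"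
  shows "jump d \<alpha> (a powr \<alpha> * u) u X * jump d \<alpha> (a powr \<alpha> * v) v Y \<le>
    max 1 (M powr \<alpha>) * (2 powr (d + \<alpha>) * jump d \<alpha> (a powr \<alpha> * (u + v)) (u + v) R) * (envelope d \<alpha> u X + envelope d \<alpha> v Y)"
proof (rule product_le_min_mult_sum)
  let ?A = "jump d \<alpha> (a powr \<alpha> * u) u X" and ?B = "jump d \<alpha> (a powr \<alpha> * v) v Y" and ?t = "u + v"
  let ?V = "min ?A ?B"
  have A0: "0 \<le> ?A" "0 \<le> ?B" using uv by (auto intro!: jump_nonneg)
  have "?V / 2 powr (d + \<alpha>) \<le> jump d \<alpha> (a powr \<alpha> * ?t) ?t R"
  proof (subst le_jump_iff)
    have 1: "?V \<le> 2 powr (d / 2) * ?t powr (- d / 2)"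
    proof (cases "u \<le> v")
      case True
      then show ?thesis using powr_half_le[of ?t v d] jump_le_powr[of d \<alpha> "a powr \<alpha> * v" v Y] uv d by auto
    next
      case False
      then show ?thesis using powr_half_le[of ?t u d] jump_le_powr[of d \<alpha> "a powr \<alpha> * u" u X] uv d by auto
    qed
    also have "\<dots> \<le> 2 powr (d + \<alpha>) * ?t powr (- d / 2)"
      using d \<alpha> by (intro mult_right_mono powr_mono) auto
    finally have 2: "?V / 2 powr (d + \<alpha>) \<le> ?t powr (- d / 2)" by (simp add: field_simps)
    have "?V * R powr (d + \<alpha>) \<le> 2 powr (d + \<alpha>) * (a powr \<alpha> * ?t)"
    proof -
      define Z where "Z = max X Y"
      have "R powr (d + \<alpha>) \<le> (2 * Z) powr (d + \<alpha>)"
        using XY d \<alpha> by (intro powr_mono2) (auto simp: Z_def)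
      also have "\<dots> = 2 powr (d + \<alpha>) * Z powr (d + \<alpha>)" by (simp add: powr_mult)
      finally have "?V * R powr (d + \<alpha>) \<le> ?V * (2 powr (d + \<alpha>) * Z powr (d + \<alpha>))"
        using A0 by (intro mult_left_mono) auto
      also have "\<dots> = 2 powr (d + \<alpha>) * (?V * Z powr (d + \<alpha>))" by simp
      also have "?V * Z powr (d + \<alpha>) \<le> a powr \<alpha> * ?t"
      proof (cases "X \<le> Y")
        case True
        have "?V * Z powr (d + \<alpha>) \<le> ?B * Y powr (d + \<alpha>)"
          using True by (auto simp: Z_def intro!: mult_right_mono)
        also have "\<dots> \<le> a powr \<alpha> * v" using uv XY by (intro jump_mult_le) auto
        also have "\<dots> \<le> a powr \<alpha> * ?t" using uv by (intro mult_left_mono) auto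
        finally show ?thesis .
      next
        case False
        have "?V * Z powr (d + \<alpha>) \<le> ?A * X powr (d + \<alpha>)"
          using False by (auto simp: Z_def intro!: mult_right_mono)
        also have "\<dots> \<le> a powr \<alpha> * u" using uv XY by (intro jump_mult_le) auto
        also have "\<dots> \<le> a powr \<alpha> * ?t" using uv by (intro mult_left_mono) auto
        finally show ?thesis .
      qed
      finally show ?thesis by simp
    qed
    then have 3: "?V / 2 powr (d + \<alpha>) * R powr (d + \<alpha>) \<le> a powr \<alpha> * ?t" by (simp add: field_simps)
    show "?V / 2 powr (d + \<alpha>) \<le> ?t powr (- d / 2) \<and> ?V / 2 powr (d + \<alpha>) * R powr (d + \<alpha>) \<le> a powr \<alpha> * ?t"
      using 2 3 by blast
  qed (use uv XY in auto)
  then show "?V \<le> 2 powr (d + \<alpha>) * jump d \<alpha> (a powr \<alpha> * ?t) ?t R" by (simp add: field_simps)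
  show "?A \<le> max 1 (M powr \<alpha>) * envelope d \<alpha> u X" by (rule jump_le_envelope) (use \<alpha> a uv XY in auto)
  show "?B \<le> max 1 (M powr \<alpha>) * envelope d \<alpha> v Y" by (rule jump_le_envelope) (use \<alpha> a uv XY in auto)
qed (use uv in \<open>auto intro!: jump_nonneg\<close>)

text \<open>The mixed product is the delicate one, since the two factors decay differently. If
  \<open>R\<^sup>2 \<le> u + v\<close>, the target is of full size
  \<open>(u + v) powr (- d / 2)\<close> and the min-max argument suffices. Otherwise the cases are
  distinguished by which factor has to cover the distance \<open>R\<close>, and by whether the jump
  factor is already in its decaying regime.\<close>

lemma bell_jump_3P:
  assumes d: "d > 0" and \<alpha>: "0 < \<alpha>" "\<alpha> < 2" and M: "M > 0" and \<gamma>: "0 < \<gamma>" "\<gamma> < \<gamma>'"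
  obtains C where "C \<ge> 1"
    "\<And>a u v X Y R. 0 < a \<Longrightarrow> a \<le> M \<Longrightarrow> u > 0 \<Longrightarrow> v > 0 \<Longrightarrow> u + v \<le> 1 \<Longrightarrow> X \<ge> 0 \<Longrightarrow> Y \<ge> 0 \<Longrightarrow> 0 \<le> R \<Longrightarrow> R \<le> X + Y \<Longrightarrow>
      bell d \<gamma> u X * jump d \<alpha> (a powr \<alpha> * v) v Y \<le>
      C * (bell d \<gamma> (u + v) R + jump d \<alpha> (a powr \<alpha> * (u + v)) (u + v) R) * (envelope d \<alpha> u X + envelope d \<alpha> v Y)"
proof -
  obtain C1 where C1: "C1 \<ge> 1" "\<And>u v X Y R. u > 0 \<Longrightarrow> v > 0 \<Longrightarrow> X \<ge> 0 \<Longrightarrow> Y \<ge> 0 \<Longrightarrow> 0 \<le> R \<Longrightarrow> R \<le> X + Y \<Longrightarrow>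
      bell d \<gamma> u X * bell d \<gamma>' v Y \<le> C1 * bell d \<gamma> (u + v) R * (envelope d \<alpha> u X + envelope d \<alpha> v Y)"
    by (rule bell_bell_3P[OF d \<alpha>(1) \<gamma>], rule that)
  obtain C2 where C2: "C2 \<ge> 1" "\<And>s w. s > 0 \<Longrightarrow> w \<ge> 0 \<Longrightarrow> bell d \<gamma> s w \<le> C2 * envelope d \<alpha> s w"
    by (rule bell_le_envelope[OF d \<alpha>(1) \<gamma>(1)], rule that)
  define m where "m = d + \<alpha>"
  have m: "m > 0" using d \<alpha> by (simp add: m_def)
  have "\<gamma> / 4 > 0" using \<gamma> by simp
  then obtain C3 where C3: "C3 \<ge> 1" "\<And>s w. s > 0 \<Longrightarrow> w \<ge> 0 \<Longrightarrow> w powr m * exp (- (\<gamma> / 4) * w\<^sup>2 / s) \<le> C3 * s powr (m / 2)"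
    using powr_mult_gaussian_le[OF m, of "\<gamma> / 4"] by blast
  define K where "K = max 1 (M powr \<alpha>)"
  have K: "K \<ge> 1" by (simp add: K_def)
  define H where "H = max C2 K"
  have H: "H \<ge> 1" using K by (simp add: H_def)
  \<comment> \<open>One entry for each case, in this order: \<open>R\<^sup>2 \<le> u + v\<close>,
    then \<open>far\<close>, \<open>mid\<close> and \<open>near\<close>.\<close>
  define C where "C = max (H * (2 powr (d / 2) * exp \<gamma>)) (max (H * (2 powr m * K)) (max (C3 * K) (exp \<gamma>' * C1)))"
  have Cge: "H * (2 powr (d / 2) * exp \<gamma>) \<le> C" "H * (2 powr m * K) \<le> C" "C3 * K \<le> C" "exp \<gamma>' * C1 \<le> C"
    by (auto simp: C_def)
  have C: "C \<ge> 1"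
  proof -
    have "1 * 1 \<le> C3 * K" using C3 K by (intro mult_mono) auto
    then show ?thesis using Cge by linarith
  qed
  have "bell d \<gamma> u X * jump d \<alpha> (a powr \<alpha> * v) v Y \<le>
      C * (bell d \<gamma> (u + v) R + jump d \<alpha> (a powr \<alpha> * (u + v)) (u + v) R) * (envelope d \<alpha> u X + envelope d \<alpha> v Y)"
    if a: "0 < a" "a \<le> M" and uv: "u > 0" "v > 0" "u + v \<le> 1" and XY: "X \<ge> 0" "Y \<ge> 0" "0 \<le> R" "R \<le> X + Y" for a u v X Y R
  proof -
    let ?t = "u + v" and ?h = "envelope d \<alpha> u X + envelope d \<alpha> v Y"
    let ?q = "bell d \<gamma> ?t R + jump d \<alpha> (a powr \<alpha> * ?t) ?t R"
    let ?A = "bell d \<gamma> u X" and ?B = "jump d \<alpha> (a powr \<alpha> * v) v Y"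
    define c where "c = a powr \<alpha>"
    have c: "c > 0" using a by (simp add: c_def)
    have h0: "0 \<le> ?h" by (intro add_nonneg_nonneg envelope_nonneg)
    have A0: "0 \<le> ?A" "0 \<le> ?B" using uv by (auto intro!: jump_nonneg bell_nonneg)
    have q: "bell d \<gamma> ?t R \<le> ?q" "jump d \<alpha> (a powr \<alpha> * ?t) ?t R \<le> ?q" "0 \<le> ?q"
      using uv by (auto intro!: jump_nonneg bell_nonneg add_nonneg_nonneg)
    have AH: "?A \<le> H * envelope d \<alpha> u X"
    proof -
      have "?A \<le> C2 * envelope d \<alpha> u X" using C2 uv XY by auto
      also have "\<dots> \<le> H * envelope d \<alpha> u X" by (intro mult_right_mono envelope_nonneg) (simp add: H_def)
      finally show ?thesis .
    qed
    have BH: "?B \<le> H * envelope d \<alpha> v Y"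
    proof -
      have "?B \<le> K * envelope d \<alpha> v Y" unfolding K_def by (rule jump_le_envelope) (use \<alpha> a uv XY in auto)
      also have "\<dots> \<le> H * envelope d \<alpha> v Y" by (intro mult_right_mono envelope_nonneg) (simp add: H_def)
      finally show ?thesis .
    qed
    have via_min: "?A * ?B \<le> C * ?q * ?h" if le: "min ?A ?B \<le> D * ?q" and D: "H * D \<le> C" for D
    proof -
      have "?A * ?B \<le> H * (D * ?q) * ?h"
        by (rule product_le_min_mult_sum[OF A0 _ AH BH _ _ le]) (use H in \<open>auto intro!: envelope_nonneg\<close>)
      also have "\<dots> = (H * D) * (?q * ?h)" by simp
      also have "\<dots> \<le> C * (?q * ?h)" by (intro mult_right_mono D mult_nonneg_nonneg q h0)
      finally show ?thesis by (simp add: mult.assoc)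
    qed
    show ?thesis
    proof (cases "R\<^sup>2 \<le> ?t")
      case True
      have "min ?A ?B \<le> 2 powr (d / 2) * ?t powr (- d / 2)"
      proof (cases "u \<le> v")
        case True
        then show ?thesis using powr_half_le[of ?t v d] jump_le_powr[of d \<alpha> "a powr \<alpha> * v" v Y] uv d by auto
      next
        case False
        then show ?thesis using powr_half_le[of ?t u d] bell_le_powr[of \<gamma> u d X] uv d \<gamma> by auto
      qed
      also have "?t powr (- d / 2) \<le> exp \<gamma> * bell d \<gamma> ?t R"
      proof -
        have "R\<^sup>2 / ?t \<le> 1" using True uv by simp
        then have "\<gamma> * (R\<^sup>2 / ?t) \<le> \<gamma> * 1" using \<gamma> by (intro mult_left_mono) auto
        then have "1 \<le> exp (\<gamma> - \<gamma> * R\<^sup>2 / ?t)" by simp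
        then have "?t powr (- d / 2) * 1 \<le> ?t powr (- d / 2) * exp (\<gamma> - \<gamma> * R\<^sup>2 / ?t)" by (intro mult_left_mono) auto
        also have "\<dots> = exp \<gamma> * bell d \<gamma> ?t R" by (simp add: bell_def exp_diff exp_minus field_simps)
        finally show ?thesis by simp
      qed
      then have "2 powr (d / 2) * ?t powr (- d / 2) \<le> 2 powr (d / 2) * (exp \<gamma> * ?q)"
        using q(1) by (intro mult_left_mono) (auto intro: order_trans mult_left_mono)
      finally have "min ?A ?B \<le> (2 powr (d / 2) * exp \<gamma>) * ?q" by (simp add: mult.assoc)
      then show ?thesis by (rule via_min) (rule Cge)
    next
      case False
      then have Rt: "?t < R\<^sup>2" by simp
      have R: "R > 0" using Rt uv XY by (cases "R = 0") auto
      have tR: "?t powr (m / 2) \<le> R powr m"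
      proof -
        have "?t powr (m / 2) \<le> (R\<^sup>2) powr (m / 2)" using Rt uv m by (intro powr_mono2) auto
        also have "R\<^sup>2 = R powr 2" using R by simp
        also have "(R powr 2) powr (m / 2) = R powr m" by (simp only: powr_powr) simp
        finally show ?thesis .
      qed
      \<comment> \<open>Beyond the parabolic scale the pure tail is comparable with the jump part:
        the cap \<open>?t powr (- d / 2)\<close> costs at most the factor \<open>K\<close>, because
        \<open>c * ?t \<le> K * ?t powr (\<alpha> / 2)\<close> for
        \<open>?t \<le> 1\<close>.\<close>
      have Jt: "c * ?t / R powr m \<le> K * ?q"
      proof -
        have "c * ?t / R powr m / K \<le> jump d \<alpha> (c * ?t) ?t R"
        proof (subst le_jump_iff)
          have "c * ?t \<le> K * ?t powr (\<alpha> / 2)"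
          proof (rule mult_mono)
            show "c \<le> K" unfolding c_def K_def using powr_mono2[of \<alpha> a M] \<alpha> a by simp
            show "?t \<le> ?t powr (\<alpha> / 2)" using powr_mono'[of "\<alpha> / 2" 1 ?t] \<alpha> uv by simp
          qed (use uv K in auto)
          also have "?t powr (\<alpha> / 2) = ?t powr (- d / 2) * ?t powr (m / 2)"
            using uv by (simp add: m_def add_divide_distrib flip: powr_add)
          also have "K * (?t powr (- d / 2) * ?t powr (m / 2)) \<le> K * (?t powr (- d / 2) * R powr m)"
            using K by (intro mult_left_mono tR) auto
          finally have "c * ?t / R powr m / K \<le> ?t powr (- d / 2)"
            using K R by (simp add: field_simps)
          moreover have "c * ?t / R powr m / K * R powr (d + \<alpha>) \<le> c * ?t"
          proof -
            have "c * ?t / R powr m / K * R powr (d + \<alpha>) = c * ?t / K" using R by (simp add: m_def)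
            also have "\<dots> \<le> c * ?t / 1" using K c uv by (intro divide_left_mono) auto
            finally show ?thesis by simp
          qed
          ultimately show "c * ?t / R powr m / K \<le> ?t powr (- d / 2) \<and> c * ?t / R powr m / K * R powr (d + \<alpha>) \<le> c * ?t" by blast
        qed (use c uv XY in auto)
        also have "\<dots> \<le> ?q" using q(2) by (simp add: c_def)
        finally have "c * ?t / R powr m / K * K \<le> ?q * K" using K by (intro mult_right_mono) auto
        then show ?thesis using K by (simp add: mult.commute)
      qed
      \<comment> \<open>In \<open>far\<close> the jump covers the distance. In \<open>mid\<close>
        the Gaussian factor covers it, and its decay is traded for a power. In \<open>near\<close>
        the jump factor has not started to decay, so it is bounded by a Gaussian and
        \<open>bell_bell_3P\<close> applies.\<close>
      consider (far) "Y \<ge> R / 2" | (mid) "Y < R / 2" "v \<le> Y\<^sup>2" | (near) "Y < R / 2" "Y\<^sup>2 < v" by linarith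
      then show ?thesis
      proof cases
        case far
        have "?B \<le> c * v / Y powr m"
          using far R by (simp add: jump_def c_def m_def)
        also have "\<dots> \<le> c * ?t / (R / 2) powr m"
          using far R c uv m by (intro frac_le powr_mono2) auto
        also have "\<dots> = 2 powr m * (c * ?t / R powr m)" using R by (simp add: powr_divide)
        also have "\<dots> \<le> 2 powr m * (K * ?q)" by (intro mult_left_mono Jt) auto
        finally have "min ?A ?B \<le> (2 powr m * K) * ?q" by (simp add: mult.assoc min.coboundedI2)
        then show ?thesis by (rule via_min) (rule Cge)
      next
        case mid
        have Y: "Y > 0" using mid uv XY by (cases "Y = 0") auto
        have X: "R / 2 \<le> X" using mid XY by linarith
        have B1: "?B \<le> c * v / Y powr m"
          using Y by (simp add: jump_def c_def m_def)
        have A1: "?A \<le> C3 * (u powr (\<alpha> / 2) / R powr m)"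
        proof -
          have "(R / 2)\<^sup>2 \<le> X\<^sup>2" using X R by (intro power_mono) auto
          then have "\<gamma> * (R / 2)\<^sup>2 / u \<le> \<gamma> * X\<^sup>2 / u" using \<gamma> uv by (intro divide_right_mono mult_left_mono) auto
          then have "?A \<le> u powr (- d / 2) * exp (- (\<gamma> / 4) * R\<^sup>2 / u)"
            unfolding bell_def by (intro mult_left_mono) (auto simp: power_divide)
          also have "\<dots> = u powr (- d / 2) * (R powr m * exp (- (\<gamma> / 4) * R\<^sup>2 / u)) / R powr m" using R by simp
          also have "\<dots> \<le> u powr (- d / 2) * (C3 * u powr (m / 2)) / R powr m"
            using C3 uv R by (intro divide_right_mono mult_left_mono) auto
          also have "\<dots> = C3 * ((u powr (- d / 2) * u powr (m / 2)) / R powr m)" by simp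
          also have "u powr (- d / 2) * u powr (m / 2) = u powr (\<alpha> / 2)"
            using uv by (simp add: m_def add_divide_distrib flip: powr_add)
          finally show ?thesis .
        qed
        have vh: "v powr (\<alpha> / 2) / Y powr m \<le> envelope d \<alpha> v Y"
        proof -
          have "v powr (m / 2) \<le> (Y\<^sup>2) powr (m / 2)" using mid uv m by (intro powr_mono2) auto
          also have "Y\<^sup>2 = Y powr 2" using Y by simp
          also have "(Y powr 2) powr (m / 2) = Y powr m" by (simp only: powr_powr) simp
          finally have "v powr (- d / 2) * v powr (m / 2) \<le> v powr (- d / 2) * Y powr m" by (intro mult_left_mono) auto
          moreover have "v powr (- d / 2) * v powr (m / 2) = v powr (\<alpha> / 2)"
            using uv by (simp add: m_def add_divide_distrib flip: powr_add)
          ultimately have "v powr (\<alpha> / 2) / Y powr m \<le> v powr (- d / 2)" using Y by (simp add: pos_divide_le_eq)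
          then show ?thesis using Y by (simp add: jump_def m_def)
        qed
        \<comment> \<open>An exchange between the factors: the Gaussian supplies
          \<open>u powr (\<alpha> / 2)\<close> and the jump supplies \<open>v\<close>, whereas the
          target needs the total time and the envelope at \<open>Y\<close> needs
          \<open>v powr (\<alpha> / 2)\<close>. Writing \<open>v\<close> as
          \<open>v powr (\<alpha> / 2) * v powr (1 - \<alpha> / 2)\<close> makes the exchange
          possible for \<alpha> < 2.\<close>
        have uvt: "u powr (\<alpha> / 2) * v \<le> ?t * v powr (\<alpha> / 2)"
        proof -
          have "u powr (\<alpha> / 2) * v \<le> ?t powr (\<alpha> / 2) * (v powr (\<alpha> / 2) * v powr (1 - \<alpha> / 2))"
            using uv \<alpha> by (intro mult_mono powr_mono2) (auto simp flip: powr_add)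
          also have "\<dots> \<le> ?t powr (\<alpha> / 2) * (v powr (\<alpha> / 2) * ?t powr (1 - \<alpha> / 2))"
            using uv \<alpha> by (intro mult_left_mono powr_mono2) auto
          also have "\<dots> = (?t powr (\<alpha> / 2) * ?t powr (1 - \<alpha> / 2)) * v powr (\<alpha> / 2)" by simp
          also have "?t powr (\<alpha> / 2) * ?t powr (1 - \<alpha> / 2) = ?t" using uv by (simp flip: powr_add)
          finally show ?thesis .
        qed
        have "?A * ?B \<le> (C3 * (u powr (\<alpha> / 2) / R powr m)) * (c * v / Y powr m)"
          using A0 C3 by (intro mult_mono A1 B1) auto
        also have "\<dots> = C3 * (c / R powr m / Y powr m) * (u powr (\<alpha> / 2) * v)" by simp
        also have "\<dots> \<le> C3 * (c / R powr m / Y powr m) * (?t * v powr (\<alpha> / 2))"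
          using C3 c by (intro mult_left_mono uvt) auto
        also have "\<dots> = C3 * (c * ?t / R powr m) * (v powr (\<alpha> / 2) / Y powr m)" by simp
        also have "\<dots> \<le> C3 * (K * ?q) * ?h"
        proof (rule mult_mono)
          show "C3 * (c * ?t / R powr m) \<le> C3 * (K * ?q)" using C3 by (intro mult_left_mono Jt) auto
          show "v powr (\<alpha> / 2) / Y powr m \<le> ?h" using vh envelope_nonneg[of d \<alpha> u X] by linarith
          show "0 \<le> C3 * (K * ?q)" using C3 K q by (intro mult_nonneg_nonneg) auto
        qed auto
        also have "\<dots> = (C3 * K) * (?q * ?h)" by simp
        also have "\<dots> \<le> C * (?q * ?h)" by (intro mult_right_mono Cge mult_nonneg_nonneg q h0)
        finally show ?thesis by (simp add: mult.assoc)
      next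
        case near
        have "?B \<le> exp \<gamma>' * bell d \<gamma>' v Y"
        proof -
          have "Y\<^sup>2 / v \<le> 1" using near uv by simp
          then have "\<gamma>' * (Y\<^sup>2 / v) \<le> \<gamma>' * 1" using \<gamma> by (intro mult_left_mono) auto
          then have "1 \<le> exp (\<gamma>' - \<gamma>' * Y\<^sup>2 / v)" by simp
          then have "v powr (- d / 2) * 1 \<le> v powr (- d / 2) * exp (\<gamma>' - \<gamma>' * Y\<^sup>2 / v)" by (intro mult_left_mono) auto
          also have "\<dots> = exp \<gamma>' * bell d \<gamma>' v Y" by (simp add: bell_def exp_diff exp_minus field_simps)
          finally show ?thesis using jump_le_powr[of d \<alpha> "a powr \<alpha> * v" v Y] by linarith
        qed
        then have "?A * ?B \<le> ?A * (exp \<gamma>' * bell d \<gamma>' v Y)" using A0 by (intro mult_left_mono) auto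
        also have "\<dots> = exp \<gamma>' * (?A * bell d \<gamma>' v Y)" by simp
        also have "\<dots> \<le> exp \<gamma>' * (C1 * bell d \<gamma> ?t R * ?h)"
          using uv XY by (intro mult_left_mono C1) auto
        also have "\<dots> = (exp \<gamma>' * C1) * (bell d \<gamma> ?t R * ?h)" by simp
        also have "\<dots> \<le> C * (?q * ?h)"
          using Cge q h0 C by (intro mult_mono) (auto simp: bell_nonneg)
        finally show ?thesis by (simp add: mult.assoc)
      qed
    qed
  qed
  with C that show ?thesis by blast
qed

lemma qa_3P:
  assumes \<alpha>: "0 < \<alpha>" "\<alpha> < 2" and M: "M > 0" and \<gamma>: "0 < \<gamma>" "\<gamma> < \<gamma>'"
  obtains C where "C \<ge> 1"
    "\<And>a u v x y z. 0 < a \<Longrightarrow> a \<le> M \<Longrightarrow> u > 0 \<Longrightarrow> v > 0 \<Longrightarrow> u + v \<le> 1 \<Longrightarrow>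
      qa \<alpha> a \<gamma> u (x - z) * qa \<alpha> a \<gamma>' v (z - y) \<le> C * qa \<alpha> a \<gamma> (u + v) (x - y :: 'a::euclidean_space) *
        (envelope (real DIM('a)) \<alpha> u (norm (x - z)) + envelope (real DIM('a)) \<alpha> v (norm (z - y)))"
proof -
  let ?d = "real DIM('a)"
  have d: "?d > 0" by simp
  obtain C1 where C1: "C1 \<ge> 1" "\<And>u v X Y R. u > 0 \<Longrightarrow> v > 0 \<Longrightarrow> X \<ge> 0 \<Longrightarrow> Y \<ge> 0 \<Longrightarrow> 0 \<le> R \<Longrightarrow> R \<le> X + Y \<Longrightarrow>
      bell ?d \<gamma> u X * bell ?d \<gamma>' v Y \<le> C1 * bell ?d \<gamma> (u + v) R * (envelope ?d \<alpha> u X + envelope ?d \<alpha> v Y)"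
    by (rule bell_bell_3P[OF d \<alpha>(1) \<gamma>], rule that)
  obtain C2 where C2: "C2 \<ge> 1"
    "\<And>a u v X Y R. 0 < a \<Longrightarrow> a \<le> M \<Longrightarrow> u > 0 \<Longrightarrow> v > 0 \<Longrightarrow> u + v \<le> 1 \<Longrightarrow> X \<ge> 0 \<Longrightarrow> Y \<ge> 0 \<Longrightarrow> 0 \<le> R \<Longrightarrow> R \<le> X + Y \<Longrightarrow>
      bell ?d \<gamma> u X * jump ?d \<alpha> (a powr \<alpha> * v) v Y \<le>
      C2 * (bell ?d \<gamma> (u + v) R + jump ?d \<alpha> (a powr \<alpha> * (u + v)) (u + v) R) * (envelope ?d \<alpha> u X + envelope ?d \<alpha> v Y)"
    by (rule bell_jump_3P[OF d \<alpha> M \<gamma>], rule that)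
  define C3 where "C3 = max 1 (M powr \<alpha>) * 2 powr (?d + \<alpha>)"
  define C where "C = C1 + 2 * C2 + C3"
  have C3: "C3 \<ge> 0" by (simp add: C3_def)
  have "qa \<alpha> a \<gamma> u (x - z) * qa \<alpha> a \<gamma>' v (z - y) \<le> C * qa \<alpha> a \<gamma> (u + v) (x - y) *
        (envelope ?d \<alpha> u (norm (x - z)) + envelope ?d \<alpha> v (norm (z - y)))"
    if a: "0 < a" "a \<le> M" and uv: "u > 0" "v > 0" "u + v \<le> 1" for a u v and x y z :: 'a
  proof -
    let ?X = "norm (x - z)" and ?Y = "norm (z - y)" and ?R = "norm (x - y)" and ?t = "u + v"
    let ?h = "envelope ?d \<alpha> u ?X + envelope ?d \<alpha> v ?Y"
    let ?q = "bell ?d \<gamma> ?t ?R + jump ?d \<alpha> (a powr \<alpha> * ?t) ?t ?R"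
    let ?Ju = "jump ?d \<alpha> (a powr \<alpha> * u) u ?X" and ?Jv = "jump ?d \<alpha> (a powr \<alpha> * v) v ?Y"
    have R: "?R \<le> ?X + ?Y" using norm_triangle_ineq[of "x - z" "z - y"] by simp
    have R': "?R \<le> ?Y + ?X" using R by simp
    have h0: "0 \<le> ?h" by (intro add_nonneg_nonneg envelope_nonneg)
    have J0: "0 \<le> ?Ju" "0 \<le> ?Jv" "0 \<le> jump ?d \<alpha> (a powr \<alpha> * ?t) ?t ?R" using uv by (auto intro!: jump_nonneg)
    have GG: "bell ?d \<gamma> u ?X * bell ?d \<gamma>' v ?Y \<le> C1 * ?q * ?h"
    proof -
      have "bell ?d \<gamma> u ?X * bell ?d \<gamma>' v ?Y \<le> C1 * bell ?d \<gamma> ?t ?R * ?h" using uv R by (intro C1) auto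
      also have "\<dots> \<le> C1 * ?q * ?h" using C1 J0 h0 by (intro mult_right_mono mult_left_mono) auto
      finally show ?thesis .
    qed
    have GJ: "bell ?d \<gamma> u ?X * ?Jv \<le> C2 * ?q * ?h" using uv a R by (intro C2) auto
    \<comment> \<open>Weakening \<open>\<gamma>'\<close> to \<gamma> turns this into the mirror
      image of \<open>GJ\<close>, with the roles of the two times and the two distances
      exchanged.\<close>
    have JG: "?Ju * bell ?d \<gamma>' v ?Y \<le> C2 * ?q * ?h"
    proof -
      have "\<gamma> * ?Y\<^sup>2 / v \<le> \<gamma>' * ?Y\<^sup>2 / v" using \<gamma> uv by (intro divide_right_mono mult_right_mono) auto
      then have "bell ?d \<gamma>' v ?Y \<le> bell ?d \<gamma> v ?Y"
        unfolding bell_def by (intro mult_left_mono) auto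
      then have "?Ju * bell ?d \<gamma>' v ?Y \<le> bell ?d \<gamma> v ?Y * ?Ju" using J0 by (simp add: mult.commute mult_right_mono)
      also have "\<dots> \<le> C2 * (bell ?d \<gamma> (v + u) ?R + jump ?d \<alpha> (a powr \<alpha> * (v + u)) (v + u) ?R) * (envelope ?d \<alpha> v ?Y + envelope ?d \<alpha> u ?X)"
        using uv a R' by (intro C2) auto
      finally show ?thesis by (simp only: add.commute[of v u] add.commute[of "envelope ?d \<alpha> v ?Y"])
    qed
    have JJ: "?Ju * ?Jv \<le> C3 * ?q * ?h"
    proof -
      have "?Ju * ?Jv \<le> max 1 (M powr \<alpha>) * (2 powr (?d + \<alpha>) * jump ?d \<alpha> (a powr \<alpha> * ?t) ?t ?R) * ?h"
        by (rule jump_jump_3P) (use d \<alpha> a uv R in auto)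
      also have "\<dots> = C3 * jump ?d \<alpha> (a powr \<alpha> * ?t) ?t ?R * ?h" by (simp add: C3_def)
      also have "\<dots> \<le> C3 * ?q * ?h" using C3 h0 by (intro mult_right_mono mult_left_mono) (auto simp: bell_nonneg)
      finally show ?thesis .
    qed
    have "qa \<alpha> a \<gamma> u (x - z) * qa \<alpha> a \<gamma>' v (z - y) =
       bell ?d \<gamma> u ?X * bell ?d \<gamma>' v ?Y + bell ?d \<gamma> u ?X * ?Jv + ?Ju * bell ?d \<gamma>' v ?Y + ?Ju * ?Jv"
      by (simp add: qa_eq_bell_jump algebra_simps)
    also have "\<dots> \<le> C1 * ?q * ?h + C2 * ?q * ?h + C2 * ?q * ?h + C3 * ?q * ?h"
      using GG GJ JG JJ by (intro add_mono)
    also have "\<dots> = C * ?q * ?h" by (simp only: C_def algebra_simps)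
    finally show ?thesis by (simp only: qa_eq_bell_jump)
  qed
  moreover have "C \<ge> 1" using C1 C2 C3 by (simp add: C_def)
  ultimately show ?thesis using that by blast
qed

section \<open>Time integrals and the Kato modulus\<close>

lemma jump_measurable [measurable]:
  assumes [measurable]: "f \<in> borel_measurable M" "g \<in> borel_measurable M" "h \<in> borel_measurable M"
  shows "(\<lambda>x. jump d \<alpha> (f x) (g x) (h x)) \<in> borel_measurable M"
  unfolding jump_def by measurable

lemma ball_measurable [measurable]: "ball x r \<in> sets borel"
  by simp

text \<open>The size of the time integral of \<open>s powr (- 1 / 2)\<close> times the envelope: the
  Kato singularity inside the parabolic radius \<open>sqrt t\<close>, the tail of a jump kernel
  outside. Both branches equal \<open>t powr ((1 - d) / 2)\<close> at
  \<open>w = sqrt t\<close>.\<close>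

definition kato_kernel :: "real \<Rightarrow> real \<Rightarrow> real \<Rightarrow> real \<Rightarrow> real" where
  "kato_kernel d \<alpha> t w = (if w < sqrt t then w powr (1 - d) else t powr ((1 + \<alpha>) / 2) / w powr (d + \<alpha>))"

lemma kato_kernel_measurable [measurable]: "kato_kernel d \<alpha> t \<in> borel_measurable borel"
  unfolding kato_kernel_def[abs_def] by measurable

lemma kato_kernel_nonneg: "0 \<le> kato_kernel d \<alpha> t w"
  by (simp add: kato_kernel_def)

lemma nn_integral_powr_from_0:
  assumes "p > - 1" "t \<ge> 0"
  shows "(\<integral>\<^sup>+s. ennreal (s powr p) * indicator {0<..<t} s \<partial>lborel) \<le> ennreal (t powr (p + 1) / (p + 1))"
proof -
  have "(\<integral>\<^sup>+s. ennreal (s powr p) * indicator {0<..<t} s \<partial>lborel) \<le> (\<integral>\<^sup>+s. ennreal (s powr p) * indicator {0..t} s \<partial>lborel)"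
    by (intro nn_integral_mono) (auto simp: indicator_def)
  also have "\<dots> = ennreal (t powr (p + 1) / (p + 1))"
    using has_integral_powr_from_0[of p t] assms by (intro nn_integral_has_integral_lebesgue') auto
  finally show ?thesis .
qed

lemma nn_integral_powr_to_inf:
  assumes "p < - 1" "t > 0"
  shows "(\<integral>\<^sup>+s. ennreal (s powr p) * indicator {t..} s \<partial>lborel) = ennreal (- (t powr (p + 1)) / (p + 1))"
  using has_integral_powr_to_inf[of p t] assms by (intro nn_integral_has_integral_lebesgue') auto

text \<open>The envelope changes regime at \<open>s = w\<^sup>2\<close>. Up to that time the tail
  bound integrates near 0; after it the bound \<open>s powr (- (d + 1) / 2)\<close> is integrable at
  infinity because \<open>d > 1\<close>, so the upper limit \<open>t\<close> may be dropped. When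
  \<open>w \<ge> sqrt t\<close> only the first regime occurs.\<close>

lemma envelope_time_integral:
  assumes d: "d > 1" and \<alpha>: "\<alpha> > 0" and t: "t > 0" and w: "w > 0"
  shows "(\<integral>\<^sup>+s. ennreal (s powr (- 1 / 2) * envelope d \<alpha> s w) * indicator {0<..<t} s \<partial>lborel) \<le>
     ennreal ((2 + 2 / (d - 1)) * kato_kernel d \<alpha> t w)"
proof -
  have ap: "0 < (\<alpha> - 1) / 2 + 1" using \<alpha> by (simp add: field_simps)
  have dp: "- (d + 1) / 2 + 1 < 0" using d by (simp add: field_simps)
  have far: "s powr (- 1 / 2) * envelope d \<alpha> s w \<le> 1 / w powr (d + \<alpha>) * s powr ((\<alpha> - 1) / 2)" for s
  proof -
    have "s powr (- 1 / 2) * envelope d \<alpha> s w \<le> s powr (- 1 / 2) * (s powr (\<alpha> / 2) / w powr (d + \<alpha>))"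
      using w by (intro mult_left_mono) (auto simp: jump_def)
    also have "\<dots> = 1 / w powr (d + \<alpha>) * (s powr (- 1 / 2) * s powr (\<alpha> / 2))" by simp
    also have "s powr (- 1 / 2) * s powr (\<alpha> / 2) = s powr ((\<alpha> - 1) / 2)"
      by (simp add: diff_divide_distrib flip: powr_add)
    finally show ?thesis .
  qed
  show ?thesis
  proof (cases "w < sqrt t")
    case False
    have "(\<integral>\<^sup>+s. ennreal (s powr (- 1 / 2) * envelope d \<alpha> s w) * indicator {0<..<t} s \<partial>lborel) \<le>
       (\<integral>\<^sup>+s. ennreal (1 / w powr (d + \<alpha>)) * (ennreal (s powr ((\<alpha> - 1) / 2)) * indicator {0<..<t} s) \<partial>lborel)"
    proof (rule nn_integral_mono)
      fix s :: real
      show "ennreal (s powr (- 1 / 2) * envelope d \<alpha> s w) * indicator {0<..<t} s \<le>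
          ennreal (1 / w powr (d + \<alpha>)) * (ennreal (s powr ((\<alpha> - 1) / 2)) * indicator {0<..<t} s)"
        using far by (auto simp: indicator_def ennreal_mult'[symmetric] intro!: ennreal_leI)
    qed
    also have "\<dots> = ennreal (1 / w powr (d + \<alpha>)) * (\<integral>\<^sup>+s. ennreal (s powr ((\<alpha> - 1) / 2)) * indicator {0<..<t} s \<partial>lborel)"
      by (intro nn_integral_cmult) auto
    also have "\<dots> \<le> ennreal (1 / w powr (d + \<alpha>)) * ennreal (t powr ((\<alpha> - 1) / 2 + 1) / ((\<alpha> - 1) / 2 + 1))"
      using \<alpha> t by (intro mult_left_mono nn_integral_powr_from_0) auto
    also have "\<dots> = ennreal (1 / w powr (d + \<alpha>) * (t powr ((\<alpha> - 1) / 2 + 1) / ((\<alpha> - 1) / 2 + 1)))"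
      using ap by (intro ennreal_mult[symmetric]) auto
    also have "\<dots> \<le> ennreal ((2 + 2 / (d - 1)) * kato_kernel d \<alpha> t w)"
    proof (rule ennreal_leI)
      have e: "(\<alpha> - 1) / 2 + 1 = (1 + \<alpha>) / 2" by (simp add: field_simps)
      have "1 / w powr (d + \<alpha>) * (t powr ((1 + \<alpha>) / 2) / ((1 + \<alpha>) / 2)) = 2 / (1 + \<alpha>) * kato_kernel d \<alpha> t w"
        using False by (simp add: kato_kernel_def mult_ac)
      also have "\<dots> \<le> (2 + 2 / (d - 1)) * kato_kernel d \<alpha> t w"
      proof (intro mult_right_mono kato_kernel_nonneg)
        have "2 / (1 + \<alpha>) \<le> 2" using \<alpha> by (simp add: field_simps)
        moreover have "2 / (d - 1) \<ge> 0" using d by simp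
        ultimately show "2 / (1 + \<alpha>) \<le> 2 + 2 / (d - 1)" by linarith
      qed
      finally show "1 / w powr (d + \<alpha>) * (t powr ((\<alpha> - 1) / 2 + 1) / ((\<alpha> - 1) / 2 + 1)) \<le> (2 + 2 / (d - 1)) * kato_kernel d \<alpha> t w"
        unfolding e .
    qed
    finally show ?thesis .
  next
    case True
    have w2: "w\<^sup>2 = w powr 2" using w by simp
    have "(\<integral>\<^sup>+s. ennreal (s powr (- 1 / 2) * envelope d \<alpha> s w) * indicator {0<..<t} s \<partial>lborel) \<le>
       (\<integral>\<^sup>+s. ennreal (1 / w powr (d + \<alpha>)) * (ennreal (s powr ((\<alpha> - 1) / 2)) * indicator {0<..<w\<^sup>2} s)
          + ennreal (s powr (- (d + 1) / 2)) * indicator {w\<^sup>2..} s \<partial>lborel)"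
    proof (rule nn_integral_mono)
      fix s :: real
      have 2: "s powr (- 1 / 2) * envelope d \<alpha> s w \<le> s powr (- (d + 1) / 2)" if "s > 0"
      proof -
        have "s powr (- 1 / 2) * envelope d \<alpha> s w \<le> s powr (- 1 / 2) * s powr (- d / 2)"
          by (intro mult_left_mono jump_le_powr) auto
        also have "\<dots> = s powr (- (d + 1) / 2)" by (simp add: field_simps flip: powr_add)
        finally show ?thesis .
      qed
      show "ennreal (s powr (- 1 / 2) * envelope d \<alpha> s w) * indicator {0<..<t} s \<le>
          ennreal (1 / w powr (d + \<alpha>)) * (ennreal (s powr ((\<alpha> - 1) / 2)) * indicator {0<..<w\<^sup>2} s)
          + ennreal (s powr (- (d + 1) / 2)) * indicator {w\<^sup>2..} s"
        using far 2 by (cases "s < w\<^sup>2") (auto simp: indicator_def ennreal_mult'[symmetric] intro!: ennreal_leI)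
    qed
    also have "\<dots> = ennreal (1 / w powr (d + \<alpha>)) * (\<integral>\<^sup>+s. ennreal (s powr ((\<alpha> - 1) / 2)) * indicator {0<..<w\<^sup>2} s \<partial>lborel)
        + (\<integral>\<^sup>+s. ennreal (s powr (- (d + 1) / 2)) * indicator {w\<^sup>2..} s \<partial>lborel)"
      by (subst nn_integral_add) (auto intro!: nn_integral_cmult)
    also have "\<dots> \<le> ennreal (1 / w powr (d + \<alpha>)) * ennreal ((w\<^sup>2) powr ((\<alpha> - 1) / 2 + 1) / ((\<alpha> - 1) / 2 + 1))
        + ennreal (- ((w\<^sup>2) powr (- (d + 1) / 2 + 1)) / (- (d + 1) / 2 + 1))"
      using \<alpha> w d by (intro add_mono mult_left_mono nn_integral_powr_from_0 eq_refl[OF nn_integral_powr_to_inf]) auto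
    also have "\<dots> = ennreal (1 / w powr (d + \<alpha>) * ((w\<^sup>2) powr ((\<alpha> - 1) / 2 + 1) / ((\<alpha> - 1) / 2 + 1))
        + (- ((w\<^sup>2) powr (- (d + 1) / 2 + 1)) / (- (d + 1) / 2 + 1)))"
    proof -
      have "0 \<le> - ((w\<^sup>2) powr (- (d + 1) / 2 + 1)) / (- (d + 1) / 2 + 1)"
        using dp by (intro divide_nonpos_nonpos) auto
      moreover have "ennreal p * ennreal q + ennreal r = ennreal (p * q + r)" if "0 \<le> p" "0 \<le> q" "0 \<le> r" for p q r
        using that by (simp add: ennreal_mult ennreal_plus)
      moreover have "0 \<le> (w\<^sup>2) powr ((\<alpha> - 1) / 2 + 1) / ((\<alpha> - 1) / 2 + 1)"
        using ap by (intro divide_nonneg_pos) auto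
      ultimately show ?thesis by (simp only: divide_nonneg_nonneg zero_le_one powr_ge_zero)
    qed
    also have "\<dots> \<le> ennreal ((2 + 2 / (d - 1)) * kato_kernel d \<alpha> t w)"
    proof (rule ennreal_leI)
      have e: "(\<alpha> - 1) / 2 + 1 = (1 + \<alpha>) / 2" "- (d + 1) / 2 + 1 = - ((d - 1) / 2)" by (simp_all add: field_simps)
      have p: "(w\<^sup>2) powr ((1 + \<alpha>) / 2) = w powr (1 + \<alpha>)" "(w\<^sup>2) powr (- ((d - 1) / 2)) = w powr (1 - d)"
        unfolding w2 powr_powr by (rule arg_cong[where f="(powr) w"], simp add: field_simps)+
      have "1 / w powr (d + \<alpha>) * w powr (1 + \<alpha>) = w powr (1 - d)"
        using w by (simp add: field_simps flip: powr_add powr_diff)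
      then have q: "1 / w powr (d + \<alpha>) * (w powr (1 + \<alpha>) / ((1 + \<alpha>) / 2)) = w powr (1 - d) / ((1 + \<alpha>) / 2)"
        by (metis times_divide_eq_right)
      have "w powr (1 - d) / ((1 + \<alpha>) / 2) + - (w powr (1 - d)) / - ((d - 1) / 2) = (2 / (1 + \<alpha>) + 2 / (d - 1)) * kato_kernel d \<alpha> t w"
        using True by (simp add: kato_kernel_def algebra_simps)
      also have "\<dots> \<le> (2 + 2 / (d - 1)) * kato_kernel d \<alpha> t w"
        using \<alpha> by (intro mult_right_mono kato_kernel_nonneg add_mono) (auto simp: field_simps)
      finally show "1 / w powr (d + \<alpha>) * ((w\<^sup>2) powr ((\<alpha> - 1) / 2 + 1) / ((\<alpha> - 1) / 2 + 1))
        + (- ((w\<^sup>2) powr (- (d + 1) / 2 + 1)) / (- (d + 1) / 2 + 1)) \<le> (2 + 2 / (d - 1)) * kato_kernel d \<alpha> t w"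
        unfolding e p q .
    qed
    finally show ?thesis .
  qed
qed

text \<open>Here the singularity at \<open>s = 0\<close> and the envelope run in opposite
  directions. For \<open>s \<ge> t / 2\<close> the weight is at most
  \<open>(t - s) powr (- 1 / 2)\<close> and reflection leads back to the previous integral. For
  \<open>s < t / 2\<close> the envelope is frozen at time \<open>t\<close>, at the cost of
  \<open>2 powr (d / 2)\<close>, and the weight integrates to \<open>2 * sqrt t\<close>.\<close>

lemma envelope_reflected_time_integral:
  assumes d: "d > 1" and \<alpha>: "\<alpha> > 0" and t: "t > 0" and w: "w > 0"
  shows "(\<integral>\<^sup>+s. ennreal (s powr (- 1 / 2) * envelope d \<alpha> (t - s) w) * indicator {0<..<t} s \<partial>lborel) \<le>
     ennreal ((2 + 2 / (d - 1) + 2 * 2 powr (d / 2)) * kato_kernel d \<alpha> t w)"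
proof -
  let ?D = "2 powr (d / 2)"
  have D: "?D \<ge> 1" using d by (intro ge_one_powr_ge_zero) auto
  have pw: "s powr (- 1 / 2) * envelope d \<alpha> (t - s) w \<le> (t - s) powr (- 1 / 2) * envelope d \<alpha> (t - s) w + ?D * envelope d \<alpha> t w * s powr (- 1 / 2)"
    if s: "0 < s" "s < t" for s
  proof (cases "t \<le> 2 * s")
    case True
    then have "s powr (- 1 / 2) \<le> (t - s) powr (- 1 / 2)" using s by (intro powr_mono2') auto
    then have "s powr (- 1 / 2) * envelope d \<alpha> (t - s) w \<le> (t - s) powr (- 1 / 2) * envelope d \<alpha> (t - s) w"
      by (intro mult_right_mono envelope_nonneg)
    moreover have "0 \<le> ?D * envelope d \<alpha> t w * s powr (- 1 / 2)"
      by (intro mult_nonneg_nonneg envelope_nonneg) auto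
    ultimately show ?thesis by linarith
  next
    case False
    have "envelope d \<alpha> (t - s) w / ?D \<le> envelope d \<alpha> t w"
    proof (subst le_jump_iff)
      have "envelope d \<alpha> (t - s) w \<le> ?D * t powr (- d / 2)"
        using jump_le_powr[of d \<alpha> "(t - s) powr (\<alpha> / 2)" "t - s" w] powr_half_le[of t "t - s" d] False s d t by auto
      moreover have "envelope d \<alpha> (t - s) w / ?D * w powr (d + \<alpha>) \<le> t powr (\<alpha> / 2)"
      proof -
        have "envelope d \<alpha> (t - s) w / ?D \<le> envelope d \<alpha> (t - s) w / 1"
          using D by (intro divide_left_mono envelope_nonneg) auto
        then have "envelope d \<alpha> (t - s) w / ?D * w powr (d + \<alpha>) \<le> envelope d \<alpha> (t - s) w / 1 * w powr (d + \<alpha>)"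
          by (intro mult_right_mono) auto
        also have "\<dots> \<le> (t - s) powr (\<alpha> / 2)"
          using jump_mult_le[of "(t - s) powr (\<alpha> / 2)" w d \<alpha> "t - s"] w by simp
        also have "\<dots> \<le> t powr (\<alpha> / 2)" using s \<alpha> by (intro powr_mono2) auto
        finally show ?thesis .
      qed
      ultimately show "envelope d \<alpha> (t - s) w / ?D \<le> t powr (- d / 2) \<and> envelope d \<alpha> (t - s) w / ?D * w powr (d + \<alpha>) \<le> t powr (\<alpha> / 2)"
        by (simp add: field_simps)
    qed (use w in auto)
    then have "envelope d \<alpha> (t - s) w \<le> ?D * envelope d \<alpha> t w" by (simp add: field_simps)
    then have "s powr (- 1 / 2) * envelope d \<alpha> (t - s) w \<le> s powr (- 1 / 2) * (?D * envelope d \<alpha> t w)"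
      by (intro mult_left_mono) auto
    moreover have "0 \<le> (t - s) powr (- 1 / 2) * envelope d \<alpha> (t - s) w"
      by (intro mult_nonneg_nonneg envelope_nonneg) auto
    ultimately show ?thesis by (simp add: mult_ac)
  qed
  have "(\<integral>\<^sup>+s. ennreal (s powr (- 1 / 2) * envelope d \<alpha> (t - s) w) * indicator {0<..<t} s \<partial>lborel) \<le>
    (\<integral>\<^sup>+s. ennreal ((t - s) powr (- 1 / 2) * envelope d \<alpha> (t - s) w) * indicator {0<..<t} (t - s)
       + ennreal (?D * envelope d \<alpha> t w) * (ennreal (s powr (- 1 / 2)) * indicator {0<..<t} s) \<partial>lborel)"
    using pw by (intro nn_integral_mono)
      (auto simp: indicator_def envelope_nonneg ennreal_mult'[symmetric] ennreal_plus[symmetric] simp del: ennreal_plus intro!: ennreal_leI)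
  also have "\<dots> = (\<integral>\<^sup>+s. ennreal ((t - s) powr (- 1 / 2) * envelope d \<alpha> (t - s) w) * indicator {0<..<t} (t - s) \<partial>lborel)
       + ennreal (?D * envelope d \<alpha> t w) * (\<integral>\<^sup>+s. ennreal (s powr (- 1 / 2)) * indicator {0<..<t} s \<partial>lborel)"
    by (subst nn_integral_add) (auto intro!: nn_integral_cmult)
  also have "(\<integral>\<^sup>+s. ennreal ((t - s) powr (- 1 / 2) * envelope d \<alpha> (t - s) w) * indicator {0<..<t} (t - s) \<partial>lborel)
     = (\<integral>\<^sup>+s. ennreal (s powr (- 1 / 2) * envelope d \<alpha> s w) * indicator {0<..<t} s \<partial>lborel)"
    by (rule nn_integral_reflect[of "\<lambda>s. ennreal (s powr (- 1 / 2) * envelope d \<alpha> s w) * indicator {0<..<t} s"]) measurable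
  also have "\<dots> + ennreal (?D * envelope d \<alpha> t w) * (\<integral>\<^sup>+s. ennreal (s powr (- 1 / 2)) * indicator {0<..<t} s \<partial>lborel)
     \<le> ennreal ((2 + 2 / (d - 1)) * kato_kernel d \<alpha> t w) + ennreal (?D * envelope d \<alpha> t w) * ennreal (t powr (- 1 / 2 + 1) / (- 1 / 2 + 1))"
    using t by (intro add_mono envelope_time_integral d \<alpha> w mult_left_mono nn_integral_powr_from_0) auto
  also have "\<dots> = ennreal ((2 + 2 / (d - 1)) * kato_kernel d \<alpha> t w + ?D * envelope d \<alpha> t w * (2 * t powr (1 / 2)))"
    using d by (subst ennreal_mult[symmetric]) (auto simp: envelope_nonneg kato_kernel_nonneg mult_ac intro!: ennreal_plus[symmetric])
  also have "\<dots> \<le> ennreal ((2 + 2 / (d - 1) + 2 * ?D) * kato_kernel d \<alpha> t w)"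
  proof (rule ennreal_leI)
    have "envelope d \<alpha> t w * t powr (1 / 2) \<le> kato_kernel d \<alpha> t w"
    proof (cases "w < sqrt t")
      case True
      have "envelope d \<alpha> t w * t powr (1 / 2) \<le> t powr (- d / 2) * t powr (1 / 2)"
        by (intro mult_right_mono jump_le_powr) auto
      also have "\<dots> = t powr ((1 - d) / 2)" by (simp add: diff_divide_distrib flip: powr_add)
      also have "\<dots> = (sqrt t) powr (1 - d)" using t by (simp add: powr_half_sqrt[symmetric] powr_powr)
      also have "\<dots> \<le> w powr (1 - d)" using True w d by (intro powr_mono2') auto
      finally show ?thesis using True by (simp add: kato_kernel_def)
    next
      case False
      have "envelope d \<alpha> t w * t powr (1 / 2) \<le> t powr (\<alpha> / 2) / w powr (d + \<alpha>) * t powr (1 / 2)"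
        using w by (intro mult_right_mono) (auto simp: jump_def)
      also have "\<dots> = (t powr (\<alpha> / 2) * t powr (1 / 2)) / w powr (d + \<alpha>)" by simp
      also have "t powr (\<alpha> / 2) * t powr (1 / 2) = t powr ((1 + \<alpha>) / 2)"
        by (simp add: add_divide_distrib add.commute flip: powr_add)
      finally show ?thesis using False by (simp add: kato_kernel_def)
    qed
    then have "2 * ?D * (envelope d \<alpha> t w * t powr (1 / 2)) \<le> 2 * ?D * kato_kernel d \<alpha> t w"
      by (intro mult_left_mono) auto
    then show "(2 + 2 / (d - 1)) * kato_kernel d \<alpha> t w + ?D * envelope d \<alpha> t w * (2 * t powr (1 / 2)) \<le> (2 + 2 / (d - 1) + 2 * ?D) * kato_kernel d \<alpha> t w"
      by (simp add: algebra_simps)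
  qed
  finally show ?thesis .
qed

section \<open>From the Kato modulus to space-time integrals\<close>

lemma kato_class_small:
  assumes "kato_class f" "\<eta> > 0"
  obtains r where "r > 0" "\<And>s. 0 < s \<Longrightarrow> s < r \<Longrightarrow> kato_M f s \<le> ennreal \<eta>"
proof -
  have "\<forall>\<^sub>F s in at_right 0. kato_M f s < ennreal \<eta>"
    using assms order_tendstoD(2)[of "kato_M f" 0 "at_right 0" "ennreal \<eta>"] by (simp add: kato_class_def)
  then obtain r where "r > 0" "\<And>s. 0 < s \<Longrightarrow> s < r \<Longrightarrow> kato_M f s < ennreal \<eta>"
    by (auto simp: eventually_at_right[of 0 1])
  then show ?thesis using that by (meson less_imp_le)
qed

lemma kato_M_ball_le:
  fixes f :: "'a::euclidean_space \<Rightarrow> real"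
  shows "(\<integral>\<^sup>+z. indicator (ball x r) z * ennreal (\<bar>f z\<bar> * dist x z powr (1 - real DIM('a))) \<partial>lborel) \<le> kato_M f r"
  unfolding kato_M_def by (rule SUP_upper) simp

lemma ball_integral_le_kato_M:
  fixes f :: "'a::euclidean_space \<Rightarrow> real"
  assumes [measurable]: "f \<in> borel_measurable borel" and r: "r > 0"
  shows "(\<integral>\<^sup>+z. indicator (ball v (r / 2)) z * ennreal \<bar>f z\<bar> \<partial>lborel) \<le> ennreal (r powr (real DIM('a) - 1)) * kato_M f r"
proof -
  let ?d = "real DIM('a)"
  have d: "?d \<ge> 1" using DIM_positive[where 'a='a] by linarith
  have "(\<integral>\<^sup>+z. indicator (ball v (r / 2)) z * ennreal \<bar>f z\<bar> \<partial>lborel) \<le>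
    (\<integral>\<^sup>+z. ennreal (r powr (?d - 1)) * (indicator (ball v r) z * ennreal (\<bar>f z\<bar> * dist v z powr (1 - ?d))) \<partial>lborel)"
  \<comment> \<open>The comparison may fail at \<open>z = v\<close>, where the weight takes the
    value \<open>0 powr (1 - ?d) = 0\<close>; off this null point it holds.\<close>
  proof (rule nn_integral_mono_AE)
    show "AE z in lborel. indicator (ball v (r / 2)) z * ennreal \<bar>f z\<bar> \<le>
        ennreal (r powr (?d - 1)) * (indicator (ball v r) z * ennreal (\<bar>f z\<bar> * dist v z powr (1 - ?d)))"
      using AE_lborel_singleton[of v]
    proof eventually_elim
      fix z :: 'a assume z: "z \<noteq> v"
      show "indicator (ball v (r / 2)) z * ennreal \<bar>f z\<bar> \<le>
        ennreal (r powr (?d - 1)) * (indicator (ball v r) z * ennreal (\<bar>f z\<bar> * dist v z powr (1 - ?d)))"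
      proof (cases "dist v z < r / 2")
        case True
        have "1 = dist v z powr (?d - 1) * dist v z powr (1 - ?d)" using z by (simp flip: powr_add)
        also have "\<dots> \<le> r powr (?d - 1) * dist v z powr (1 - ?d)"
          using True d r zero_le_dist[of v z] by (intro mult_right_mono powr_mono2 powr_ge_zero) linarith+
        finally have "\<bar>f z\<bar> * 1 \<le> \<bar>f z\<bar> * (r powr (?d - 1) * dist v z powr (1 - ?d))" by (intro mult_left_mono) auto
        then show ?thesis using True r by (simp add: indicator_def ennreal_mult'[symmetric] mult_ac ennreal_leI)
      qed (simp add: indicator_def)
    qed
  qed
  also have "\<dots> = ennreal (r powr (?d - 1)) * (\<integral>\<^sup>+z. (indicator (ball v r) z * ennreal (\<bar>f z\<bar> * dist v z powr (1 - ?d))) \<partial>lborel)"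
    by (intro nn_integral_cmult) measurable
  also have "\<dots> \<le> ennreal (r powr (?d - 1)) * kato_M f r"
    by (intro mult_left_mono kato_M_ball_le) auto
  finally show ?thesis .
qed

text \<open>The near part is the Kato modulus itself. For the far part, an integral over the centres
  of balls takes the place of a discrete covering; the total contribution of the centres is the
  integral \<open>I\<close> of the jump profile, rescaled to \<open>r = sqrt t\<close>. The powers
  of \<open>r\<close> cancel, so the constant does not depend on \<open>t\<close>.\<close>

lemma kato_kernel_integral_le:
  fixes f :: "'a::euclidean_space \<Rightarrow> real" and x :: 'a
  assumes f [measurable]: "f \<in> borel_measurable borel" and \<alpha>: "\<alpha> > 0" and t: "t > 0"
    and I: "(\<integral>\<^sup>+z. ennreal (jump (real DIM('a)) \<alpha> 1 1 (norm (z::'a))) \<partial>lborel) \<le> ennreal I" "I \<ge> 0"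
  shows "(\<integral>\<^sup>+z. ennreal (\<bar>f z\<bar> * kato_kernel (real DIM('a)) \<alpha> t (norm (x - z))) \<partial>lborel) \<le>
    ennreal (1 + 2 powr (real DIM('a) + \<alpha>) * I * 2 ^ DIM('a) / unit_ball_vol (real DIM('a))) * kato_M f (sqrt t)"
proof -
  let ?d = "real DIM('a)"
  define r where "r = sqrt t"
  define m where "m = ?d + \<alpha>"
  define V where "V = unit_ball_vol ?d * (r / 2) ^ DIM('a)"
  have r: "r > 0" using t by (simp add: r_def)
  have m: "m > 0" using \<alpha> by (simp add: m_def add_nonneg_pos)
  have ub: "unit_ball_vol ?d > 0" by simp
  have V: "V > 0" using r ub by (simp add: V_def)
  have tr: "t powr ((1 + \<alpha>) / 2) = r powr (1 + \<alpha>)"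
    using t by (simp add: r_def powr_half_sqrt[symmetric] powr_powr)
  txt \<open>Away from \<open>x\<close> the kernel is nearly constant on balls of radius \<open>r/2\<close>; averaging it over such balls
    reduces the far part to the integral of \<open>\<bar>f\<bar>\<close> over one ball.\<close>
  let ?far = "\<lambda>z. ennreal (\<bar>f z\<bar> * (r powr (1 + \<alpha>) / norm (x - z) powr m)) * indicator (- ball x r) z"
  let ?J = "\<lambda>v. ennreal (jump ?d \<alpha> 1 1 (norm ((x - v) /\<^sub>R r)))"
  have split: "(\<integral>\<^sup>+z. ennreal (\<bar>f z\<bar> * kato_kernel ?d \<alpha> t (norm (x - z))) \<partial>lborel) \<le>
      kato_M f r + (\<integral>\<^sup>+z. ?far z \<partial>lborel)"
  proof -
    have "(\<integral>\<^sup>+z. ennreal (\<bar>f z\<bar> * kato_kernel ?d \<alpha> t (norm (x - z))) \<partial>lborel) =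
      (\<integral>\<^sup>+z. indicator (ball x r) z * ennreal (\<bar>f z\<bar> * dist x z powr (1 - ?d)) + ?far z \<partial>lborel)"
      by (intro nn_integral_cong) (auto simp: kato_kernel_def tr indicator_def dist_norm m_def simp flip: r_def)
    also have "\<dots> = (\<integral>\<^sup>+z. indicator (ball x r) z * ennreal (\<bar>f z\<bar> * dist x z powr (1 - ?d)) \<partial>lborel) + (\<integral>\<^sup>+z. ?far z \<partial>lborel)"
      by (intro nn_integral_add) measurable
    also have "\<dots> \<le> kato_M f r + (\<integral>\<^sup>+z. ?far z \<partial>lborel)"
      by (intro add_mono kato_M_ball_le order_refl)
    finally show ?thesis .
  qed
  have J_int: "(\<integral>\<^sup>+v. ?J v \<partial>lborel) \<le> ennreal (r ^ DIM('a) * I)"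
  proof -
    have "(\<integral>\<^sup>+v. ?J v \<partial>lborel) = ennreal (r ^ DIM('a)) * (\<integral>\<^sup>+w. ?J (x + r *\<^sub>R w) \<partial>lborel)"
      using r by (intro nn_integral_scale) auto
    also have "(\<lambda>w. ?J (x + r *\<^sub>R w)) = (\<lambda>w. ennreal (jump ?d \<alpha> 1 1 (norm w)))"
      using r by (auto simp: fun_eq_iff)
    also have "ennreal (r ^ DIM('a)) * (\<integral>\<^sup>+w. ennreal (jump ?d \<alpha> 1 1 (norm (w::'a))) \<partial>lborel) \<le> ennreal (r ^ DIM('a)) * ennreal I"
      by (intro mult_left_mono I) auto
    also have "\<dots> = ennreal (r ^ DIM('a) * I)" using r I by (intro ennreal_mult[symmetric]) auto
    finally show ?thesis .
  qed
  \<comment> \<open>If \<open>norm (x - z) \<ge> r\<close> and \<open>v\<close> lies within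
    \<open>r / 2\<close> of \<open>z\<close>, then
    \<open>norm (x - v) \<le> 2 * norm (x - z)\<close>. The profile may thus be evaluated at
    \<open>v\<close> instead of \<open>z\<close>, for a factor \<open>2 powr m\<close>.\<close>
  have pw: "?far z * indicator (ball z (r / 2)) v \<le> ennreal (2 powr m * r powr (1 - ?d)) * (?J v * (indicator (ball v (r / 2)) z * ennreal \<bar>f z\<bar>))" for z v
  proof (cases "z \<in> - ball x r \<and> v \<in> ball z (r / 2)")
    case True
    then have far: "norm (x - z) \<ge> r" and near: "dist z v < r / 2" by (auto simp: dist_norm)
    have n0: "norm (x - z) > 0" using far r by linarith
    have "r powr m / norm (x - z) powr m / 2 powr m \<le> jump ?d \<alpha> 1 1 (norm ((x - v) /\<^sub>R r))"
    proof (subst le_jump_iff)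
      have "r powr m \<le> norm (x - z) powr m" using far r m by (intro powr_mono2) auto
      then have 1: "r powr m / norm (x - z) powr m \<le> 1" using n0 by simp
      have 2: "2 powr m \<ge> 1" using m by (intro ge_one_powr_ge_zero) auto
      have "r powr m / norm (x - z) powr m / 2 powr m \<le> r powr m / norm (x - z) powr m / 1"
        using 2 by (intro divide_left_mono) auto
      then have A: "r powr m / norm (x - z) powr m / 2 powr m \<le> 1" using 1 by simp
      have "norm (x - v) \<le> norm (x - z) + norm (z - v)" using norm_triangle_ineq[of "x - z" "z - v"] by simp
      also have "\<dots> \<le> 2 * norm (x - z)" using far near r by (simp add: dist_norm)
      finally have "norm (x - v) powr m \<le> (2 * norm (x - z)) powr m" using m by (intro powr_mono2) auto
      then have "norm (x - v) powr m \<le> 2 powr m * norm (x - z) powr m" by (simp add: powr_mult)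
      moreover have "norm ((x - v) /\<^sub>R r) powr m = norm (x - v) powr m / r powr m"
        using r by (simp add: powr_mult powr_divide divide_inverse inverse_powr mult.commute)
      ultimately have "r powr m / norm (x - z) powr m / 2 powr m * norm ((x - v) /\<^sub>R r) powr m \<le> 1"
        using n0 r by (simp add: field_simps)
      with A show "r powr m / norm (x - z) powr m / 2 powr m \<le> 1 powr (- ?d / 2) \<and> r powr m / norm (x - z) powr m / 2 powr m * norm ((x - v) /\<^sub>R r) powr (?d + \<alpha>) \<le> 1"
        by (simp add: m_def)
    qed auto
    then have "r powr m / norm (x - z) powr m \<le> 2 powr m * jump ?d \<alpha> 1 1 (norm ((x - v) /\<^sub>R r))"
    proof (subst (asm) pos_divide_le_eq)
      show "(0::real) < 2 powr m" by simp
    qed (simp only: mult.commute)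
    then have "r powr (1 - ?d) * (r powr m / norm (x - z) powr m) \<le> r powr (1 - ?d) * (2 powr m * jump ?d \<alpha> 1 1 (norm ((x - v) /\<^sub>R r)))"
      by (intro mult_left_mono) auto
    moreover have "r powr (1 - ?d) * r powr m = r powr (1 + \<alpha>)" by (simp add: m_def flip: powr_add)
    ultimately have "r powr (1 + \<alpha>) / norm (x - z) powr m \<le> 2 powr m * r powr (1 - ?d) * jump ?d \<alpha> 1 1 (norm ((x - v) /\<^sub>R r))"
      by (simp add: mult_ac)
    then have "\<bar>f z\<bar> * (r powr (1 + \<alpha>) / norm (x - z) powr m) \<le> \<bar>f z\<bar> * (2 powr m * r powr (1 - ?d) * jump ?d \<alpha> 1 1 (norm ((x - v) /\<^sub>R r)))"
      by (intro mult_left_mono) auto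
    also have "\<dots> = (2 powr m * r powr (1 - ?d)) * (jump ?d \<alpha> 1 1 (norm ((x - v) /\<^sub>R r)) * \<bar>f z\<bar>)" by simp
    finally have "ennreal (\<bar>f z\<bar> * (r powr (1 + \<alpha>) / norm (x - z) powr m)) \<le> ennreal (2 powr m * r powr (1 - ?d)) * (?J v * ennreal \<bar>f z\<bar>)"
      by (simp only: ennreal_mult'[symmetric] ennreal_leI jump_nonneg mult_nonneg_nonneg powr_ge_zero zero_le_one zero_le_numeral ennreal_mult[symmetric] abs_ge_zero)
    moreover have "z \<in> ball v (r / 2)" using near by (simp add: dist_commute)
    ultimately show ?thesis using True by simp
  qed (auto simp: indicator_def)
  \<comment> \<open>The volume \<open>V\<close> is written as an integral over the ball around
    \<open>z\<close>. Exchanging the integrals then lets \<open>z\<close> run over the ball around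
    \<open>v\<close>, on which the integral of \<open>f\<close> is controlled uniformly in
    \<open>v\<close>.\<close>
  have "ennreal V * (\<integral>\<^sup>+z. ?far z \<partial>lborel) = (\<integral>\<^sup>+z. ennreal V * ?far z \<partial>lborel)"
    by (intro nn_integral_cmult[symmetric]) measurable
  also have "\<dots> = (\<integral>\<^sup>+z. (\<integral>\<^sup>+v. ?far z * indicator (ball z (r / 2)) v \<partial>lborel) \<partial>lborel)"
  proof (intro nn_integral_cong)
    fix z :: 'a
    have "(\<integral>\<^sup>+v. ?far z * indicator (ball z (r / 2)) v \<partial>lborel) = ?far z * emeasure lborel (ball z (r / 2))"
      by (rule nn_integral_cmult_indicator) simp
    also have "emeasure lborel (ball z (r / 2)) = ennreal V"
      using r unfolding V_def by (intro emeasure_ball) simp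
    finally show "ennreal V * ?far z = (\<integral>\<^sup>+v. ?far z * indicator (ball z (r / 2)) v \<partial>lborel)"
      by (simp only: mult.commute)
  qed
  also have "\<dots> \<le> (\<integral>\<^sup>+z. (\<integral>\<^sup>+v. ennreal (2 powr m * r powr (1 - ?d)) * (?J v * (indicator (ball v (r / 2)) z * ennreal \<bar>f z\<bar>)) \<partial>lborel) \<partial>lborel)"
    by (intro nn_integral_mono pw)
  also have "\<dots> = (\<integral>\<^sup>+v. (\<integral>\<^sup>+z. ennreal (2 powr m * r powr (1 - ?d)) * (?J v * (indicator (ball v (r / 2)) z * ennreal \<bar>f z\<bar>)) \<partial>lborel) \<partial>lborel)"
  proof (rule lborel_pair.Fubini'[symmetric])
    have "(\<lambda>(z, v). ennreal (2 powr m * r powr (1 - ?d)) * (?J v * ((if dist v z < r / 2 then 1 else 0) * ennreal \<bar>f z\<bar>)))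
       \<in> borel_measurable (lborel \<Otimes>\<^sub>M lborel)" by measurable
    then show "(\<lambda>(z, v). ennreal (2 powr m * r powr (1 - ?d)) * (?J v * (indicator (ball v (r / 2)) z * ennreal \<bar>f z\<bar>)))
       \<in> borel_measurable (lborel \<Otimes>\<^sub>M lborel)" by (simp add: indicator_def)
  qed
  also have "\<dots> = (\<integral>\<^sup>+v. ennreal (2 powr m * r powr (1 - ?d)) * (?J v * (\<integral>\<^sup>+z. indicator (ball v (r / 2)) z * ennreal \<bar>f z\<bar> \<partial>lborel)) \<partial>lborel)"
    by (simp add: nn_integral_cmult)
  also have "\<dots> \<le> (\<integral>\<^sup>+v. ennreal (2 powr m * r powr (1 - ?d)) * (?J v * (ennreal (r powr (?d - 1)) * kato_M f r)) \<partial>lborel)"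
    by (intro nn_integral_mono mult_left_mono ball_integral_le_kato_M f r) auto
  also have "\<dots> = ennreal (2 powr m * r powr (1 - ?d)) * (ennreal (r powr (?d - 1)) * kato_M f r) * (\<integral>\<^sup>+v. ?J v \<partial>lborel)"
    by (subst nn_integral_cmult[symmetric]) (auto intro!: nn_integral_cong simp: mult_ac)
  also have "\<dots> \<le> ennreal (2 powr m * r powr (1 - ?d)) * (ennreal (r powr (?d - 1)) * kato_M f r) * ennreal (r ^ DIM('a) * I)"
    by (intro mult_left_mono J_int) auto
  also have "\<dots> = ennreal (2 powr m * r ^ DIM('a) * I) * kato_M f r"
  proof -
    have "2 powr m * r powr (1 - ?d) * r powr (?d - 1) * (r ^ DIM('a) * I) = 2 powr m * r ^ DIM('a) * I"
      using r by (simp add: mult.assoc flip: powr_add)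
    then have eq: "ennreal (2 powr m * r powr (1 - ?d)) * ennreal (r powr (?d - 1)) * ennreal (r ^ DIM('a) * I) = ennreal (2 powr m * r ^ DIM('a) * I)"
      using r I by (simp add: ennreal_mult[symmetric])
    have "u * (v * k) * w = (u * v * w) * k" for u v w k :: ennreal
      by (simp only: mult_ac)
    then show ?thesis unfolding eq[symmetric] by blast
  qed
  finally have *: "ennreal V * (\<integral>\<^sup>+z. ?far z \<partial>lborel) \<le> ennreal (2 powr m * r ^ DIM('a) * I) * kato_M f r" .
  have "(\<integral>\<^sup>+z. ?far z \<partial>lborel) = ennreal (1 / V) * (ennreal V * (\<integral>\<^sup>+z. ?far z \<partial>lborel))"
    using V by (simp add: mult.assoc[symmetric] ennreal_mult[symmetric])
  also have "\<dots> \<le> ennreal (1 / V) * (ennreal (2 powr m * r ^ DIM('a) * I) * kato_M f r)"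
    by (intro mult_left_mono *) auto
  also have "\<dots> = ennreal (1 / V * (2 powr m * r ^ DIM('a) * I)) * kato_M f r"
    using V r I by (subst ennreal_mult) (auto simp: mult.assoc)
  also have "1 / V * (2 powr m * r ^ DIM('a) * I) = 2 powr m * I * 2 ^ DIM('a) / unit_ball_vol ?d"
    using r ub by (simp add: V_def power_divide field_simps)
  finally have far: "(\<integral>\<^sup>+z. ?far z \<partial>lborel) \<le> ennreal (2 powr m * I * 2 ^ DIM('a) / unit_ball_vol ?d) * kato_M f r" .
  have "(\<integral>\<^sup>+z. ennreal (\<bar>f z\<bar> * kato_kernel ?d \<alpha> t (norm (x - z))) \<partial>lborel) \<le>
      kato_M f r + ennreal (2 powr m * I * 2 ^ DIM('a) / unit_ball_vol ?d) * kato_M f r"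
    using split far by (meson add_left_mono order_trans)
  also have "\<dots> = ennreal (1 + 2 powr m * I * 2 ^ DIM('a) / unit_ball_vol ?d) * kato_M f r"
    using I ub by (subst ennreal_plus) (auto simp: distrib_right)
  finally show ?thesis by (simp add: m_def r_def)
qed

lemma envelope_kato_integral:
  fixes f :: "'a::euclidean_space \<Rightarrow> real"
  assumes d: "DIM('a) \<ge> 2" and \<alpha>: "\<alpha> > 0"
    and I: "(\<integral>\<^sup>+z. ennreal (jump (real DIM('a)) \<alpha> 1 1 (norm (z::'a))) \<partial>lborel) < \<infinity>"
  obtains C where "C > 0"
    "\<And>(f :: 'a \<Rightarrow> real) t x y. f \<in> borel_measurable borel \<Longrightarrow> t > 0 \<Longrightarrow>
      (\<integral>\<^sup>+s. (\<integral>\<^sup>+z. ennreal (s powr (- 1 / 2) * \<bar>f z\<bar> *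
         (envelope (real DIM('a)) \<alpha> (t - s) (norm (x - z)) + envelope (real DIM('a)) \<alpha> s (norm (z - y)))) \<partial>lborel) * indicator {0<..<t} s \<partial>lborel)
      \<le> ennreal C * kato_M f (sqrt t)"
proof -
  let ?d = "real DIM('a)"
  have d1: "?d > 1" using d by simp
  obtain I' where I': "(\<integral>\<^sup>+z. ennreal (jump ?d \<alpha> 1 1 (norm (z::'a))) \<partial>lborel) = ennreal I'" "I' \<ge> 0"
    using I by (cases "\<integral>\<^sup>+z. ennreal (jump ?d \<alpha> 1 1 (norm (z::'a))) \<partial>lborel") auto
  define K where "K = 1 + 2 powr (?d + \<alpha>) * I' * 2 ^ DIM('a) / unit_ball_vol ?d"
  have K: "K > 0" using I' by (simp add: K_def add_pos_nonneg)
  define A where "A = 2 + 2 / (?d - 1) + 2 * 2 powr (?d / 2)"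
  have A: "A > 0" "2 + 2 / (?d - 1) \<le> A" using d1 by (auto simp: A_def intro!: add_pos_pos)
  \<comment> \<open>The time argument \<sigma> is instantiated with \<open>t - s\<close> for the
    envelope at \<open>x\<close> and with \<open>s\<close> for the one at \<open>y\<close>.\<close>
  have one: "(\<integral>\<^sup>+s. (\<integral>\<^sup>+z. ennreal (s powr (- 1 / 2) * \<bar>f z\<bar> * envelope ?d \<alpha> (\<sigma> s) (norm (x - z))) \<partial>lborel) * indicator {0<..<t} s \<partial>lborel)
      \<le> ennreal (A * K) * kato_M f (sqrt t)"
    if f [measurable]: "f \<in> borel_measurable borel" and t: "t > 0" and [measurable]: "\<sigma> \<in> borel_measurable borel"
     and \<sigma>: "\<And>w. w > 0 \<Longrightarrow> (\<integral>\<^sup>+s. ennreal (s powr (- 1 / 2) * envelope ?d \<alpha> (\<sigma> s) w) * indicator {0<..<t} s \<partial>lborel) \<le> ennreal (A * kato_kernel ?d \<alpha> t w)"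
    for f :: "'a \<Rightarrow> real" and t x \<sigma>
  proof -
    have "(\<integral>\<^sup>+s. (\<integral>\<^sup>+z. ennreal (s powr (- 1 / 2) * \<bar>f z\<bar> * envelope ?d \<alpha> (\<sigma> s) (norm (x - z))) \<partial>lborel) * indicator {0<..<t} s \<partial>lborel)
      = (\<integral>\<^sup>+s. (\<integral>\<^sup>+z. ennreal \<bar>f z\<bar> * (ennreal (s powr (- 1 / 2) * envelope ?d \<alpha> (\<sigma> s) (norm (x - z))) * indicator {0<..<t} s) \<partial>lborel) \<partial>lborel)"
      by (subst nn_integral_multc[symmetric])
         (auto intro!: nn_integral_cong simp: ennreal_mult'[symmetric] mult_ac indicator_def envelope_nonneg)
    also have "\<dots> = (\<integral>\<^sup>+z. (\<integral>\<^sup>+s. ennreal \<bar>f z\<bar> * (ennreal (s powr (- 1 / 2) * envelope ?d \<alpha> (\<sigma> s) (norm (x - z))) * indicator {0<..<t} s) \<partial>lborel) \<partial>lborel)"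
      by (rule lborel_pair.Fubini') measurable
    also have "\<dots> = (\<integral>\<^sup>+z. ennreal \<bar>f z\<bar> * (\<integral>\<^sup>+s. (ennreal (s powr (- 1 / 2) * envelope ?d \<alpha> (\<sigma> s) (norm (x - z))) * indicator {0<..<t} s) \<partial>lborel) \<partial>lborel)"
      by (simp add: nn_integral_cmult)
    also have "\<dots> \<le> (\<integral>\<^sup>+z. ennreal A * ennreal (\<bar>f z\<bar> * kato_kernel ?d \<alpha> t (norm (x - z))) \<partial>lborel)"
    proof (rule nn_integral_mono_AE)
      show "AE z in lborel. ennreal \<bar>f z\<bar> * (\<integral>\<^sup>+s. (ennreal (s powr (- 1 / 2) * envelope ?d \<alpha> (\<sigma> s) (norm (x - z))) * indicator {0<..<t} s) \<partial>lborel)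
          \<le> ennreal A * ennreal (\<bar>f z\<bar> * kato_kernel ?d \<alpha> t (norm (x - z)))"
        using AE_lborel_singleton[of x]
      proof eventually_elim
        fix z :: 'a assume "z \<noteq> x"
        then have "ennreal \<bar>f z\<bar> * (\<integral>\<^sup>+s. (ennreal (s powr (- 1 / 2) * envelope ?d \<alpha> (\<sigma> s) (norm (x - z))) * indicator {0<..<t} s) \<partial>lborel)
           \<le> ennreal \<bar>f z\<bar> * ennreal (A * kato_kernel ?d \<alpha> t (norm (x - z)))"
          by (intro mult_left_mono \<sigma>) auto
        also have "\<dots> = ennreal A * ennreal (\<bar>f z\<bar> * kato_kernel ?d \<alpha> t (norm (x - z)))"
          using A by (simp add: ennreal_mult[symmetric] kato_kernel_nonneg mult_ac)
        finally show "ennreal \<bar>f z\<bar> * (\<integral>\<^sup>+s. (ennreal (s powr (- 1 / 2) * envelope ?d \<alpha> (\<sigma> s) (norm (x - z))) * indicator {0<..<t} s) \<partial>lborel)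
          \<le> ennreal A * ennreal (\<bar>f z\<bar> * kato_kernel ?d \<alpha> t (norm (x - z)))" .
      qed
    qed
    also have "\<dots> = ennreal A * (\<integral>\<^sup>+z. ennreal (\<bar>f z\<bar> * kato_kernel ?d \<alpha> t (norm (x - z))) \<partial>lborel)"
      by (intro nn_integral_cmult) measurable
    also have "\<dots> \<le> ennreal A * (ennreal K * kato_M f (sqrt t))"
      unfolding K_def using I' by (intro mult_left_mono kato_kernel_integral_le f \<alpha> t) auto
    also have "\<dots> = ennreal (A * K) * kato_M f (sqrt t)"
      using A K by (simp add: ennreal_mult mult.assoc)
    finally show ?thesis .
  qed
  have "(\<integral>\<^sup>+s. (\<integral>\<^sup>+z. ennreal (s powr (- 1 / 2) * \<bar>f z\<bar> *
         (envelope ?d \<alpha> (t - s) (norm (x - z)) + envelope ?d \<alpha> s (norm (z - y)))) \<partial>lborel) * indicator {0<..<t} s \<partial>lborel)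
      \<le> ennreal (2 * (A * K)) * kato_M f (sqrt t)"
    if f [measurable]: "f \<in> borel_measurable borel" and t: "t > 0" for f :: "'a \<Rightarrow> real" and t x y
  proof -
    have "(\<integral>\<^sup>+s. (\<integral>\<^sup>+z. ennreal (s powr (- 1 / 2) * \<bar>f z\<bar> *
         (envelope ?d \<alpha> (t - s) (norm (x - z)) + envelope ?d \<alpha> s (norm (z - y)))) \<partial>lborel) * indicator {0<..<t} s \<partial>lborel)
      = (\<integral>\<^sup>+s. (\<integral>\<^sup>+z. ennreal (s powr (- 1 / 2) * \<bar>f z\<bar> * envelope ?d \<alpha> (t - s) (norm (x - z)))
          + ennreal (s powr (- 1 / 2) * \<bar>f z\<bar> * envelope ?d \<alpha> s (norm (y - z))) \<partial>lborel) * indicator {0<..<t} s \<partial>lborel)"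
    proof -
      have "ennreal (s powr (- 1 / 2) * \<bar>f z\<bar> * (envelope ?d \<alpha> (t - s) (norm (x - z)) + envelope ?d \<alpha> s (norm (z - y)))) =
         ennreal (s powr (- 1 / 2) * \<bar>f z\<bar> * envelope ?d \<alpha> (t - s) (norm (x - z)))
          + ennreal (s powr (- 1 / 2) * \<bar>f z\<bar> * envelope ?d \<alpha> s (norm (y - z)))" for s z
        unfolding distrib_left norm_minus_commute[of z y]
        by (intro ennreal_plus mult_nonneg_nonneg envelope_nonneg) auto
      then show ?thesis by (simp only:)
    qed
    also have "\<dots> = (\<integral>\<^sup>+s. (\<integral>\<^sup>+z. ennreal (s powr (- 1 / 2) * \<bar>f z\<bar> * envelope ?d \<alpha> (t - s) (norm (x - z))) \<partial>lborel) * indicator {0<..<t} s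
          + (\<integral>\<^sup>+z. ennreal (s powr (- 1 / 2) * \<bar>f z\<bar> * envelope ?d \<alpha> s (norm (y - z))) \<partial>lborel) * indicator {0<..<t} s \<partial>lborel)"
    proof (intro nn_integral_cong)
      fix s :: real
      have m1: "(\<lambda>z. ennreal (s powr (- 1 / 2) * \<bar>f z\<bar> * envelope ?d \<alpha> (t - s) (norm (x - z)))) \<in> borel_measurable lborel"
        and m2: "(\<lambda>z. ennreal (s powr (- 1 / 2) * \<bar>f z\<bar> * envelope ?d \<alpha> s (norm (y - z)))) \<in> borel_measurable lborel"
        by measurable
      show "(\<integral>\<^sup>+z. ennreal (s powr (- 1 / 2) * \<bar>f z\<bar> * envelope ?d \<alpha> (t - s) (norm (x - z)))
          + ennreal (s powr (- 1 / 2) * \<bar>f z\<bar> * envelope ?d \<alpha> s (norm (y - z))) \<partial>lborel) * indicator {0<..<t} s =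
        (\<integral>\<^sup>+z. ennreal (s powr (- 1 / 2) * \<bar>f z\<bar> * envelope ?d \<alpha> (t - s) (norm (x - z))) \<partial>lborel) * indicator {0<..<t} s
          + (\<integral>\<^sup>+z. ennreal (s powr (- 1 / 2) * \<bar>f z\<bar> * envelope ?d \<alpha> s (norm (y - z))) \<partial>lborel) * indicator {0<..<t} s"
        by (simp only: nn_integral_add[OF m1 m2] distrib_right)
    qed
    also have "\<dots> = (\<integral>\<^sup>+s. (\<integral>\<^sup>+z. ennreal (s powr (- 1 / 2) * \<bar>f z\<bar> * envelope ?d \<alpha> (t - s) (norm (x - z))) \<partial>lborel) * indicator {0<..<t} s \<partial>lborel)
          + (\<integral>\<^sup>+s. (\<integral>\<^sup>+z. ennreal (s powr (- 1 / 2) * \<bar>f z\<bar> * envelope ?d \<alpha> s (norm (y - z))) \<partial>lborel) * indicator {0<..<t} s \<partial>lborel)"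
      by (intro nn_integral_add) measurable
    also have "\<dots> \<le> ennreal (A * K) * kato_M f (sqrt t) + ennreal (A * K) * kato_M f (sqrt t)"
    proof (intro add_mono one f t)
      show "(\<integral>\<^sup>+s. ennreal (s powr (- 1 / 2) * envelope ?d \<alpha> (t - s) w) * indicator {0<..<t} s \<partial>lborel) \<le> ennreal (A * kato_kernel ?d \<alpha> t w)" if "w > 0" for w
        using envelope_reflected_time_integral[OF d1 \<alpha> t that] by (simp add: A_def)
      show "(\<integral>\<^sup>+s. ennreal (s powr (- 1 / 2) * envelope ?d \<alpha> s w) * indicator {0<..<t} s \<partial>lborel) \<le> ennreal (A * kato_kernel ?d \<alpha> t w)" if "w > 0" for w
        using envelope_time_integral[OF d1 \<alpha> t that] A(2)
        by (rule order_trans[OF _ ennreal_leI[OF mult_right_mono[OF _ kato_kernel_nonneg]]])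
    qed measurable
    also have "\<dots> = ennreal (2 * (A * K)) * kato_M f (sqrt t)"
    proof -
      have "ennreal (2 * (A * K)) = ennreal (A * K) + ennreal (A * K)"
        using A K by (simp flip: ennreal_plus)
      then show ?thesis by (simp only: distrib_right)
    qed
    finally show ?thesis .
  qed
  moreover have "2 * (A * K) > 0" using A K by simp
  ultimately show ?thesis using that by blast
qed

section \<open>Duhamel's formula for abstract kernels\<close>

lemma integral_translate:
  fixes f :: "'a::euclidean_space \<Rightarrow> 'b::{banach, second_countable_topology}"
  assumes "f \<in> borel_measurable borel"
  shows "(LINT w|lborel. f (w + z)) = (LINT w|lborel. f w)"
  using integral_distr[of "\<lambda>w. w + z" lborel borel f] assms
  by (simp add: distr_lborel_translate)

text \<open>A function that is not integrable has Bochner integral 0, which also obeys the bound.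
  The estimate can therefore be applied to Chapman-Kolmogorov integrals before their convergence is
  known.\<close>

lemma norm_integral_le_majorant:
  fixes f :: "'a \<Rightarrow> 'b::{banach, second_countable_topology}"
  assumes "integrable M g" "\<And>x. norm (f x) \<le> g x"
  shows "norm (LINT x|M. f x) \<le> (LINT x|M. g x)"
proof (cases "integrable M f")
  case True
  have "norm (LINT x|M. f x) \<le> (LINT x|M. norm (f x))" by (rule integral_norm_bound)
  also have "\<dots> \<le> (LINT x|M. g x)" using True assms by (intro integral_mono) auto
  finally show ?thesis .
next
  case False
  have "0 \<le> g x" for x using norm_ge_zero[of "f x"] assms(2)[of x] by linarith
  then show ?thesis using False by (simp add: not_integrable_integral_eq)
qed

lemma integral_swap_if_finite:
  fixes f :: "'b::euclidean_space \<Rightarrow> 'c::euclidean_space \<Rightarrow> real"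
  assumes m: "(\<lambda>(w, v). f w v) \<in> borel_measurable (borel \<Otimes>\<^sub>M borel)"
    and fin: "(\<integral>\<^sup>+w. (\<integral>\<^sup>+v. ennreal \<bar>f w v\<bar> \<partial>lborel) \<partial>lborel) < \<infinity>"
  shows "integrable (lborel \<Otimes>\<^sub>M lborel) (\<lambda>(w, v). f w v)"
    and "(LINT w|lborel. LINT v|lborel. f w v) = (LINT v|lborel. LINT w|lborel. f w v)"
    and "integrable lborel (\<lambda>w. LINT v|lborel. f w v)"
proof -
  have m': "(\<lambda>(w, v). f w v) \<in> borel_measurable (lborel \<Otimes>\<^sub>M lborel)" using m by simp
  show i: "integrable (lborel \<Otimes>\<^sub>M lborel) (\<lambda>(w, v). f w v)"
    unfolding integrable_iff_bounded
  proof
    have "(\<integral>\<^sup>+x. ennreal (norm (case x of (w, v) \<Rightarrow> f w v)) \<partial>(lborel \<Otimes>\<^sub>M lborel)) =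
        (\<integral>\<^sup>+w. (\<integral>\<^sup>+v. ennreal \<bar>f w v\<bar> \<partial>lborel) \<partial>lborel)"
      using m' by (subst lborel.nn_integral_fst[symmetric]) auto
    then show "(\<integral>\<^sup>+x. ennreal (norm (case x of (w, v) \<Rightarrow> f w v)) \<partial>(lborel \<Otimes>\<^sub>M lborel)) < \<infinity>" using fin by simp
  qed (rule m')
  show "(LINT w|lborel. LINT v|lborel. f w v) = (LINT v|lborel. LINT w|lborel. f w v)"
    by (rule lborel_pair.Fubini_integral[OF i, symmetric])
  show "integrable lborel (\<lambda>w. LINT v|lborel. f w v)"
    by (rule lborel_pair.integrable_fst[OF i])
qed

abbreviation measurable3 :: "(real \<Rightarrow> 'a::euclidean_space \<Rightarrow> 'a \<Rightarrow> real) \<Rightarrow> bool" where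
  "measurable3 F \<equiv> (\<lambda>(t, x, y). F t x y) \<in> borel_measurable (borel \<Otimes>\<^sub>M borel \<Otimes>\<^sub>M borel)"

lemma measurable3_compose:
  assumes "measurable3 F" and [measurable]: "f \<in> borel_measurable M" "g \<in> borel_measurable M" "h \<in> borel_measurable M"
  shows "(\<lambda>w. F (f w) (g w) (h w)) \<in> borel_measurable M"
proof -
  have "(\<lambda>w. (f w, g w, h w)) \<in> M \<rightarrow>\<^sub>M borel \<Otimes>\<^sub>M borel \<Otimes>\<^sub>M borel" by measurable
  from measurable_compose[OF this assms(1)] show ?thesis by simp
qed

text \<open>Because \<open>W\<close> reproduces itself under composition, each further use of the
  Chapman-Kolmogorov equation costs only a factor \<open>K\<close>. It serves twice: to carry a
  crude bound from a very short interval to \<open>t0\<close>, and for the growth at large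
  times.\<close>

lemma iterated_kernel_bound:
  fixes F W :: "real \<Rightarrow> 'a::euclidean_space \<Rightarrow> 'a \<Rightarrow> real"
  assumes K: "1 \<le> K" and FW: "\<And>t x y. 0 < t \<Longrightarrow> t \<le> \<tau> \<Longrightarrow> \<bar>F t x y\<bar> \<le> K * W t x y" and \<tau>: "0 < \<tau>"
    and CK: "\<And>t s x y. 0 < t \<Longrightarrow> 0 < s \<Longrightarrow> F (t + s) x y = (LINT z|lborel. F t x z * F s z y)"
    and W0: "\<And>t x y. 0 < t \<Longrightarrow> 0 \<le> W t x y"
    and Wm: "measurable3 W"
    and WW: "\<And>t s x y. 0 < t \<Longrightarrow> 0 < s \<Longrightarrow> (\<integral>\<^sup>+z. ennreal (W t x z * W s z y) \<partial>lborel) = ennreal (W (t + s) x y)"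
  shows "0 < t \<Longrightarrow> t \<le> real (Suc n) * \<tau> \<Longrightarrow> \<bar>F t x y\<bar> \<le> K ^ Suc n * W t x y"
proof (induction n arbitrary: t x y)
  note [measurable] = measurable3_compose[OF Wm]
  have W_has: "has_bochner_integral lborel (\<lambda>z. W t x z * W s z y) (W (t + s) x y)" if "0 < t" "0 < s" for t s x y
    using that W0 WW[OF that] by (intro has_bochner_integral_nn_integral) auto
  case (Suc n)
  \<comment> \<open>The time is cut into equal pieces. Removing a piece of length \<tau> instead
    would leave no positive time when \<open>t \<le> \<tau>\<close>.\<close>
  define s where "s = real (Suc n) * t / real (Suc (Suc n))"
  define u where "u = t / real (Suc (Suc n))"
  have N: "real (Suc (Suc n)) > 0" by simp
  have su: "s > 0" "u > 0" using Suc.prems by (auto simp: s_def u_def)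
  have t: "t = s + u"
    using N by (simp add: s_def u_def add_divide_distrib[symmetric] divide_simps) (simp add: algebra_simps)
  have u\<tau>: "u \<le> \<tau>" using Suc.prems N by (simp add: u_def pos_divide_le_eq mult.commute)
  have s\<tau>: "s \<le> real (Suc n) * \<tau>"
  proof -
    have "s = real (Suc n) * u" by (simp add: s_def u_def)
    then show ?thesis using u\<tau> by (simp add: mult_left_mono)
  qed
  have "\<bar>F t x y\<bar> = norm (LINT z|lborel. F s x z * F u z y)" unfolding t CK[OF su] by simp
  also have "\<dots> \<le> (LINT z|lborel. K ^ Suc (Suc n) * (W s x z * W u z y))"
  proof (rule norm_integral_le_majorant)
    show "integrable lborel (\<lambda>z. K ^ Suc (Suc n) * (W s x z * W u z y))"
      using W_has[OF su] by (intro integrable_mult_right) (auto simp: has_bochner_integral_iff)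
    show "norm (F s x z * F u z y) \<le> K ^ Suc (Suc n) * (W s x z * W u z y)" for z
    proof -
      have "\<bar>F s x z\<bar> * \<bar>F u z y\<bar> \<le> (K ^ Suc n * W s x z) * (K * W u z y)"
        using K W0 su by (intro mult_mono Suc.IH FW s\<tau> u\<tau>) auto
      then show ?thesis by (simp add: abs_mult mult_ac)
    qed
  qed
  also have "\<dots> = K ^ Suc (Suc n) * W t x y" unfolding integral_mult_right_zero t using W_has[OF su] by (simp add: has_bochner_integral_iff)
  finally show ?case .
qed (use FW in simp)

text \<open>In the application \<open>p\<close> is the unperturbed kernel and \<open>B s z y\<close>
  the derivative of \<open>p\<close> at time \<open>s\<close>, from \<open>z\<close> to
  \<open>y\<close>, in direction \<open>b z\<close>. Only measurability is assumed at this level;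
  size and semigroup properties enter lemma by lemma.\<close>

locale duhamel =
  fixes p B :: "real \<Rightarrow> 'a::euclidean_space \<Rightarrow> 'a \<Rightarrow> real" and t0 :: real
  assumes t0: "0 < t0"
    and p_meas: "(\<lambda>(t, x, y). p t x y) \<in> borel_measurable (borel \<Otimes>\<^sub>M borel \<Otimes>\<^sub>M borel)"
    and B_meas: "(\<lambda>(t, x, y). B t x y) \<in> borel_measurable (borel \<Otimes>\<^sub>M borel \<Otimes>\<^sub>M borel)"
begin

definition U :: "(real \<Rightarrow> 'a \<Rightarrow> 'a \<Rightarrow> real) \<Rightarrow> real \<Rightarrow> 'a \<Rightarrow> 'a \<Rightarrow> real" where
  "U F t x y = (LINT s:{0<..<t}|lborel. LINT z|lborel. F (t - s) x z * B s z y)"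

text \<open>Cutting the integrand off outside \<open>0 < s < t\<close> makes \<open>U\<close> a
  single integral over the whole of space-time, so that integrals can be exchanged and the time
  variable translated without changing the domain.\<close>

definition kern :: "(real \<Rightarrow> 'a \<Rightarrow> 'a \<Rightarrow> real) \<Rightarrow> real \<Rightarrow> 'a \<Rightarrow> 'a \<Rightarrow> real \<Rightarrow> 'a \<Rightarrow> real" where
  "kern F t x y s z = (if 0 < s \<and> s < t then F (t - s) x z * B s z y else 0)"

text \<open>The factor 1/2 makes \<open>U\<close> a contraction in the weighted supremum norm with
  weight \<open>Q\<close>. The use of nonnegative integrals means that the condition already
  contains absolute convergence.\<close>

definition majorant :: "(real \<Rightarrow> 'a \<Rightarrow> 'a \<Rightarrow> real) \<Rightarrow> bool" where
  "majorant Q \<longleftrightarrow> measurable3 Q \<and> (\<forall>t x y. 0 < t \<longrightarrow> 0 \<le> Q t x y) \<and>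
     (\<forall>t\<in>{0<..t0}. \<forall>x y. (\<integral>\<^sup>+s. (\<integral>\<^sup>+z. ennreal (Q (t - s) x z * \<bar>B s z y\<bar>) \<partial>lborel) * indicator {0<..<t} s \<partial>lborel)
        \<le> ennreal (Q t x y / 2))"

definition dominated :: "real \<Rightarrow> (real \<Rightarrow> 'a \<Rightarrow> 'a \<Rightarrow> real) \<Rightarrow> (real \<Rightarrow> 'a \<Rightarrow> 'a \<Rightarrow> real) \<Rightarrow> bool" where
  "dominated K F Q \<longleftrightarrow> 0 \<le> K \<and> (\<forall>t\<in>{0<..t0}. \<forall>x y. \<bar>F t x y\<bar> \<le> K * Q t x y)"

definition solves :: "(real \<Rightarrow> 'a \<Rightarrow> 'a \<Rightarrow> real) \<Rightarrow> real \<Rightarrow> bool" where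
  "solves F t \<longleftrightarrow> (\<forall>x y. F t x y = p t x y + U F t x y)"

lemma kern_measurable:
  assumes [measurable]: "measurable3 F"
    and [measurable]: "f \<in> borel_measurable M" "g \<in> borel_measurable M" "h \<in> borel_measurable M"
      "k \<in> borel_measurable M" "l \<in> borel_measurable M"
  shows "(\<lambda>w. kern F (f w) (g w) (h w) (k w) (l w)) \<in> borel_measurable M"
proof -
  have [measurable]: "(\<lambda>w. F (f w - k w) (g w) (l w)) \<in> borel_measurable M"
    by (intro measurable3_compose[OF assms(1)]) measurable
  have [measurable]: "(\<lambda>w. B (k w) (l w) (h w)) \<in> borel_measurable M"
    by (intro measurable3_compose[OF B_meas]) measurable
  show ?thesis unfolding kern_def by measurable
qed

lemma U_eq_iterated: "U F t x y = (LINT s|lborel. LINT z|lborel. kern F t x y s z)"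
  unfolding U_def set_lebesgue_integral_def
  by (intro Bochner_Integration.integral_cong refl) (auto simp: kern_def indicator_def)

lemma U_measurable:
  assumes F: "measurable3 F"
  shows "measurable3 (U F)"
proof -
  note [measurable] = kern_measurable[OF F]
  show ?thesis unfolding U_eq_iterated by measurable
qed

lemma nn_integral_kern_le:
  assumes F: "measurable3 F" and Q: "majorant Q" and FQ: "dominated K F Q" and t: "0 < t" "t \<le> t0"
  shows "(\<integral>\<^sup>+v. ennreal \<bar>case v of (s, z) \<Rightarrow> kern F t x y s z\<bar> \<partial>(lborel \<Otimes>\<^sub>M lborel)) \<le> ennreal (K / 2 * Q t x y)"
proof -
  note [measurable] = kern_measurable[OF F]
  have K: "K \<ge> 0" using FQ by (simp add: dominated_def)
  have "(\<integral>\<^sup>+v. ennreal \<bar>case v of (s, z) \<Rightarrow> kern F t x y s z\<bar> \<partial>(lborel \<Otimes>\<^sub>M lborel)) =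
      (\<integral>\<^sup>+s. (\<integral>\<^sup>+z. ennreal \<bar>kern F t x y s z\<bar> \<partial>lborel) \<partial>lborel)"
    by (subst lborel.nn_integral_fst[symmetric]) auto
  also have "\<dots> \<le> (\<integral>\<^sup>+s. (\<integral>\<^sup>+z. ennreal K * ennreal (Q (t - s) x z * \<bar>B s z y\<bar>) \<partial>lborel) * indicator {0<..<t} s \<partial>lborel)"
  proof (rule nn_integral_mono)
    fix s :: real
    show "(\<integral>\<^sup>+z. ennreal \<bar>kern F t x y s z\<bar> \<partial>lborel) \<le> (\<integral>\<^sup>+z. ennreal K * ennreal (Q (t - s) x z * \<bar>B s z y\<bar>) \<partial>lborel) * indicator {0<..<t} s"
    proof (cases "0 < s \<and> s < t")
      case True
      have "\<bar>kern F t x y s z\<bar> \<le> K * (Q (t - s) x z * \<bar>B s z y\<bar>)" for z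
      proof -
        have "\<bar>F (t - s) x z\<bar> \<le> K * Q (t - s) x z" using FQ True t by (simp add: dominated_def)
        then have "\<bar>F (t - s) x z\<bar> * \<bar>B s z y\<bar> \<le> K * Q (t - s) x z * \<bar>B s z y\<bar>" by (rule mult_right_mono) simp
        then show ?thesis using True by (simp add: kern_def abs_mult mult.assoc)
      qed
      then have "ennreal \<bar>kern F t x y s z\<bar> \<le> ennreal K * ennreal (Q (t - s) x z * \<bar>B s z y\<bar>)" for z
        using K by (simp add: ennreal_mult'[symmetric] ennreal_leI)
      then show ?thesis using True by (auto intro!: nn_integral_mono)
    qed (auto simp: kern_def)
  qed
  also have "\<dots> = ennreal K * (\<integral>\<^sup>+s. (\<integral>\<^sup>+z. ennreal (Q (t - s) x z * \<bar>B s z y\<bar>) \<partial>lborel) * indicator {0<..<t} s \<partial>lborel)"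
  proof -
    have Qm: "measurable3 Q" using Q by (simp add: majorant_def)
    note [measurable] = measurable3_compose[OF Qm] measurable3_compose[OF B_meas]
    have m1: "(\<lambda>z. ennreal (Q (t - s) x z * \<bar>B s z y\<bar>)) \<in> borel_measurable lborel" for s by measurable
    have m2: "(\<lambda>s. (\<integral>\<^sup>+z. ennreal (Q (t - s) x z * \<bar>B s z y\<bar>) \<partial>lborel) * indicator {0<..<t} s) \<in> borel_measurable lborel" by measurable
    show ?thesis by (simp only: nn_integral_cmult[OF m1] mult.assoc nn_integral_cmult[OF m2])
  qed
  also have "\<dots> \<le> ennreal K * ennreal (Q t x y / 2)"
    using Q t by (intro mult_left_mono) (auto simp: majorant_def)
  also have "\<dots> = ennreal (K / 2 * Q t x y)"
    using K Q t by (simp add: ennreal_mult'[symmetric])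
  finally show ?thesis .
qed

lemma
  assumes F: "measurable3 F" and Q: "majorant Q" and FQ: "dominated K F Q" and t: "0 < t" "t \<le> t0"
  shows integrable_kern: "integrable (lborel \<Otimes>\<^sub>M lborel) (\<lambda>(s, z). kern F t x y s z)"
    and U_eq_product: "U F t x y = (LINT v|(lborel \<Otimes>\<^sub>M lborel). (case v of (s, z) \<Rightarrow> kern F t x y s z))"
    and integral_abs_kern_le: "(LINT v|(lborel \<Otimes>\<^sub>M lborel). norm (case v of (s, z) \<Rightarrow> kern F t x y s z)) \<le> K / 2 * Q t x y"
proof -
  note [measurable] = kern_measurable[OF F]
  have K: "K \<ge> 0" using FQ by (simp add: dominated_def)
  have m: "(\<lambda>(s, z). kern F t x y s z) \<in> borel_measurable (lborel \<Otimes>\<^sub>M lborel)" by measurable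
  note le = nn_integral_kern_le[OF F Q FQ t, of x y]
  show i: "integrable (lborel \<Otimes>\<^sub>M lborel) (\<lambda>(s, z). kern F t x y s z)"
    unfolding integrable_iff_bounded using m le by (auto intro: le_less_trans)
  show "U F t x y = (LINT v|(lborel \<Otimes>\<^sub>M lborel). (case v of (s, z) \<Rightarrow> kern F t x y s z))"
    unfolding U_eq_iterated by (rule lborel_pair.integral_fst[OF i])
  have "ennreal (LINT v|(lborel \<Otimes>\<^sub>M lborel). norm (case v of (s, z) \<Rightarrow> kern F t x y s z)) \<le> ennreal (K / 2 * Q t x y)"
    using le nn_integral_eq_integral[OF integrable_norm[OF i]] by simp
  moreover have "0 \<le> K / 2 * Q t x y" using K Q t by (auto simp: majorant_def)
  ultimately show "(LINT v|(lborel \<Otimes>\<^sub>M lborel). norm (case v of (s, z) \<Rightarrow> kern F t x y s z)) \<le> K / 2 * Q t x y"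
    by (simp add: ennreal_le_iff)
qed

lemma dominated_U:
  assumes F: "measurable3 F" and Q: "majorant Q" and FQ: "dominated K F Q"
  shows "dominated (K / 2) (U F) Q"
  unfolding dominated_def
proof (intro conjI ballI allI)
  show "0 \<le> K / 2" using FQ by (simp add: dominated_def)
  fix t x y assume "t \<in> {0<..t0}"
  then have t: "0 < t" "t \<le> t0" by auto
  have "\<bar>U F t x y\<bar> \<le> (LINT v|(lborel \<Otimes>\<^sub>M lborel). norm (case v of (s, z) \<Rightarrow> kern F t x y s z))"
    unfolding U_eq_product[OF assms t] real_norm_def[symmetric] by (rule integral_norm_bound)
  also have "\<dots> \<le> K / 2 * Q t x y" by (rule integral_abs_kern_le[OF assms t])
  finally show "\<bar>U F t x y\<bar> \<le> K / 2 * Q t x y" .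
qed

lemma iterate_measurable: "measurable3 ((U ^^ k) p)"
  by (induction k) (auto intro: U_measurable p_meas)

lemma iterate_dominated:
  assumes "majorant Q" "dominated C p Q"
  shows "dominated (C * (1 / 2) ^ k) ((U ^^ k) p) Q"
proof (induction k)
  case (Suc k)
  then show ?case using dominated_U[OF iterate_measurable assms(1) Suc] by simp
qed (use assms in simp)

text \<open>The Neumann series of the equation \<open>F = p + U F\<close>.\<close>

definition S :: "real \<Rightarrow> 'a \<Rightarrow> 'a \<Rightarrow> real" where
  "S t x y = (\<Sum>k. (U ^^ k) p t x y)"

lemma S_measurable: "measurable3 S"
proof -
  note [measurable] = measurable3_compose[OF iterate_measurable]
  show ?thesis unfolding S_def by measurable
qed

lemma
  assumes Q: "majorant Q" and p: "dominated C p Q" and t: "0 < t" "t \<le> t0"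
  shows summable_iterates: "summable (\<lambda>k. \<bar>(U ^^ k) p t x y\<bar>)"
    and suminf_abs_iterates_le: "(\<Sum>k. \<bar>(U ^^ k) p t x y\<bar>) \<le> 2 * C * Q t x y"
proof -
  have le: "\<bar>(U ^^ k) p t x y\<bar> \<le> C * Q t x y * (1 / 2) ^ k" for k
    using iterate_dominated[OF Q p, of k] t by (simp add: dominated_def mult_ac)
  have g: "summable (\<lambda>k. C * Q t x y * (1 / 2) ^ k)" by (intro summable_mult summable_geometric) simp
  show s: "summable (\<lambda>k. \<bar>(U ^^ k) p t x y\<bar>)"
    by (rule summable_comparison_test'[OF g]) (use le in simp)
  have "(\<Sum>k. \<bar>(U ^^ k) p t x y\<bar>) \<le> (\<Sum>k. C * Q t x y * (1 / 2) ^ k)"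
    by (rule suminf_le[OF le s g])
  also have "\<dots> = 2 * C * Q t x y"
    by (subst suminf_mult) (simp_all add: suminf_geometric)
  finally show "(\<Sum>k. \<bar>(U ^^ k) p t x y\<bar>) \<le> 2 * C * Q t x y" .
qed

lemma S_dominated:
  assumes Q: "majorant Q" and p: "dominated C p Q"
  shows "dominated (2 * C) S Q"
  unfolding dominated_def
proof (intro conjI ballI allI)
  show "0 \<le> 2 * C" using p by (simp add: dominated_def)
  fix t x y assume "t \<in> {0<..t0}"
  then have t: "0 < t" "t \<le> t0" by auto
  show "\<bar>S t x y\<bar> \<le> 2 * C * Q t x y"
    unfolding S_def using summable_rabs[OF summable_iterates[OF Q p t]] suminf_abs_iterates_le[OF Q p t]
    by (rule order_trans)
qed

lemma S_solves:
  assumes Q: "majorant Q" and p: "dominated C p Q" and t: "0 < t" "t \<le> t0"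
  shows "solves S t"
  unfolding solves_def
proof (intro allI)
  fix x y
  let ?k = "\<lambda>k v. case v of (s, z) \<Rightarrow> kern ((U ^^ k) p) t x y s z"
  note dom = iterate_dominated[OF Q p]
  note sum = summable_iterates[OF Q p]
  have Q0: "0 \<le> Q t x y" using Q t by (simp add: majorant_def)
  have kS: "(case v of (s, z) \<Rightarrow> kern S t x y s z) = (\<Sum>k. ?k k v)" and sk: "summable (\<lambda>k. norm (?k k v))" for v
  proof -
    obtain s z where v: "v = (s, z)" by fastforce
    have "kern S t x y s z = (\<Sum>k. kern ((U ^^ k) p) t x y s z) \<and> summable (\<lambda>k. norm (kern ((U ^^ k) p) t x y s z))"
    proof (cases "0 < s \<and> s < t")
      case True
      then have ts: "0 < t - s" "t - s \<le> t0" using t by auto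
      have "summable (\<lambda>k. (U ^^ k) p (t - s) x z)" by (rule summable_rabs_cancel[OF sum[OF ts]])
      then have "(\<Sum>k. (U ^^ k) p (t - s) x z * B s z y) = (\<Sum>k. (U ^^ k) p (t - s) x z) * B s z y"
        by (rule suminf_mult2[symmetric])
      moreover have "summable (\<lambda>k. \<bar>(U ^^ k) p (t - s) x z\<bar> * \<bar>B s z y\<bar>)" by (rule summable_mult2[OF sum[OF ts]])
      ultimately show ?thesis using True by (simp add: kern_def S_def abs_mult)
    qed (auto simp: kern_def)
    then show "(case v of (s, z) \<Rightarrow> kern S t x y s z) = (\<Sum>k. ?k k v)" "summable (\<lambda>k. norm (?k k v))"
      using v by auto
  qed
  have "U S t x y = (LINT v|(lborel \<Otimes>\<^sub>M lborel). (\<Sum>k. ?k k v))"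
    unfolding U_eq_product[OF S_measurable Q S_dominated[OF Q p] t] kS ..
  also have "\<dots> = (\<Sum>k. LINT v|(lborel \<Otimes>\<^sub>M lborel). ?k k v)"
  proof (rule integral_suminf)
    show "integrable (lborel \<Otimes>\<^sub>M lborel) (?k k)" for k
      by (rule integrable_kern[OF iterate_measurable Q dom t])
    show "AE v in lborel \<Otimes>\<^sub>M lborel. summable (\<lambda>k. norm (?k k v))" using sk by (intro AE_I2)
    have g: "summable (\<lambda>k. C / 2 * Q t x y * (1 / 2) ^ k)" by (intro summable_mult summable_geometric) simp
    show "summable (\<lambda>k. LINT v|(lborel \<Otimes>\<^sub>M lborel). norm (?k k v))"
      by (rule summable_comparison_test'[OF g])
         (use integral_abs_kern_le[OF iterate_measurable Q dom t] in \<open>simp add: mult_ac\<close>)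
  qed
  also have "\<dots> = (\<Sum>k. (U ^^ Suc k) p t x y)"
    by (simp add: U_eq_product[OF iterate_measurable Q dom t])
  also have "\<dots> = S t x y - p t x y"
    unfolding S_def using suminf_split_head[OF summable_rabs_cancel[OF sum[OF t]], of x y] by simp
  finally show "S t x y = p t x y + U S t x y" by simp
qed

text \<open>The difference of two solutions is a fixed point of \<open>U\<close>, hence is bounded
  by \<open>Q\<close> times arbitrarily high powers of 1/2. The two dominating constants are
  arbitrary, so very crude bounds suffice to identify a solution.\<close>

lemma solution_unique:
  assumes Q: "majorant Q" and F: "measurable3 F" "dominated K F Q" "\<And>t. 0 < t \<Longrightarrow> t \<le> t0 \<Longrightarrow> solves F t"
    and G: "measurable3 G" "dominated L G Q" "\<And>t. 0 < t \<Longrightarrow> t \<le> t0 \<Longrightarrow> solves G t"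
    and t: "0 < t" "t \<le> t0"
  shows "F t x y = G t x y"
proof -
  define H where "H t x y = F t x y - G t x y" for t x y
  have Hm: "measurable3 H"
  proof -
    note [measurable] = measurable3_compose[OF F(1)] measurable3_compose[OF G(1)]
    show ?thesis unfolding H_def by measurable
  qed
  have UH: "U H t x y = H t x y" if t: "0 < t" "t \<le> t0" for t x y
  proof -
    have "dominated (K + L) H Q"
      unfolding dominated_def
    proof (intro conjI ballI allI)
      show "0 \<le> K + L" using F(2) G(2) by (simp add: dominated_def)
      fix t x y assume "t \<in> {0<..t0}"
      then have "\<bar>F t x y\<bar> \<le> K * Q t x y" "\<bar>G t x y\<bar> \<le> L * Q t x y" using F(2) G(2) by (auto simp: dominated_def)
      then show "\<bar>H t x y\<bar> \<le> (K + L) * Q t x y" unfolding H_def distrib_right by linarith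
    qed
    have eq: "(case v of (s, z) \<Rightarrow> kern H t x y s z) = (case v of (s, z) \<Rightarrow> kern F t x y s z) - (case v of (s, z) \<Rightarrow> kern G t x y s z)" for v
      by (auto simp: kern_def H_def left_diff_distrib split: prod.split)
    have "U H t x y = U F t x y - U G t x y"
      unfolding U_eq_product[OF Hm Q \<open>dominated (K + L) H Q\<close> t] U_eq_product[OF F(1) Q F(2) t] U_eq_product[OF G(1) Q G(2) t]
      by (subst Bochner_Integration.integral_diff[OF integrable_kern[OF F(1) Q F(2) t] integrable_kern[OF G(1) Q G(2) t], symmetric])
         (intro Bochner_Integration.integral_cong refl eq)
    then show ?thesis using F(3)[OF t] G(3)[OF t] by (simp add: solves_def H_def)
  qed
  have dom: "dominated ((K + L) * (1 / 2) ^ n) H Q" for n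
  proof (induction n)
    case 0
    show ?case
      unfolding dominated_def
    proof (intro conjI ballI allI)
      show "0 \<le> (K + L) * (1 / 2) ^ 0" using F(2) G(2) by (simp add: dominated_def)
      fix t x y assume "t \<in> {0<..t0}"
      then have "\<bar>F t x y\<bar> \<le> K * Q t x y" "\<bar>G t x y\<bar> \<le> L * Q t x y" using F(2) G(2) by (auto simp: dominated_def)
      then show "\<bar>H t x y\<bar> \<le> (K + L) * (1 / 2) ^ 0 * Q t x y" unfolding H_def by (simp add: distrib_right)
    qed
  next
    case (Suc n)
    then show ?case using dominated_U[OF Hm Q Suc] by (simp add: dominated_def UH)
  qed
  have "(\<lambda>n. (K + L) * (1 / 2) ^ n * Q t x y) \<longlonglongrightarrow> (K + L) * 0 * Q t x y"
    by (intro tendsto_intros LIMSEQ_power_zero) auto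
  moreover have "\<bar>H t x y\<bar> \<le> (K + L) * (1 / 2) ^ n * Q t x y" for n
    using dom[of n] t by (simp add: dominated_def)
  ultimately have "\<bar>H t x y\<bar> \<le> 0"
    by (intro LIMSEQ_le_const[where X="\<lambda>n. (K + L) * (1 / 2) ^ n * Q t x y"]) auto
  then show ?thesis by (simp add: H_def)
qed

section \<open>Propagation of Duhamel's formula in time\<close>

lemma
  assumes F: "measurable3 F" and Q: "majorant Q" and FQ: "dominated K F Q" and t: "0 < t" "t \<le> t0"
  shows U_eq_lborel: "U F t x y = (LINT v|lborel. kern F t x y (fst v) (snd v))"
    and nn_integral_kern_lborel_le: "(\<integral>\<^sup>+v. ennreal \<bar>kern F t x y (fst v) (snd v)\<bar> \<partial>lborel) \<le> ennreal (K / 2 * Q t x y)"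
    and integrable_kern_lborel: "integrable lborel (\<lambda>v. kern F t x y (fst v) (snd v))"
  using U_eq_product[OF assms, of x y] nn_integral_kern_le[OF assms, of x y] integrable_kern[OF assms, of x y]
  by (simp_all add: lborel_prod split_beta')

lemma dominated_trans:
  assumes "dominated K F W" "dominated L W Q"
  shows "dominated (K * L) F Q"
  unfolding dominated_def
proof (intro conjI ballI allI)
  show "0 \<le> K * L" using assms by (simp add: dominated_def)
  fix t x y assume t: "t \<in> {0<..t0}"
  have "\<bar>F t x y\<bar> \<le> K * W t x y" using assms(1) t by (simp add: dominated_def)
  also have "\<dots> \<le> K * (L * Q t x y)"
    using assms t by (intro mult_left_mono) (auto simp: dominated_def intro: order_trans[OF abs_ge_self])
  finally show "\<bar>F t x y\<bar> \<le> K * L * Q t x y" by simp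
qed

text \<open>In the composition of \<open>F t\<close> with itself, first the right factor is replaced
  by \<open>p + U F\<close>, then the left factor of the term ending in \<open>p\<close>. This
  leaves \<open>p\<close> with \<open>p\<close>, \<open>U F\<close> with \<open>p\<close>, and
  \<open>F\<close> with \<open>U F\<close>. The first is \<open>p (2 * t)\<close>. In the last,
  composing \<open>F t\<close> with \<open>F (t - s)\<close> gives the part \<open>0 < s < t\<close>
  of \<open>U F (2 * t)\<close>; in the middle one, composing \<open>B s\<close> with
  \<open>p t\<close> gives \<open>B (s + t)\<close> and hence the part
  \<open>t < s < 2 * t\<close>.\<close>

lemma solves_double:
  assumes F: "measurable3 F" and Q: "majorant Q" and pQ: "dominated C p Q"
    and FW: "dominated K F W" and WQ: "dominated L W Q"
    and CK: "\<And>t s x y. 0 < t \<Longrightarrow> 0 < s \<Longrightarrow> F (t + s) x y = (LINT z|lborel. F t x z * F s z y)"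
    and W0: "\<And>t x y. 0 < t \<Longrightarrow> 0 \<le> W t x y" and Wm: "measurable3 W"
    and WW: "\<And>t s x y. 0 < t \<Longrightarrow> 0 < s \<Longrightarrow> (\<integral>\<^sup>+z. ennreal (W t x z * W s z y) \<partial>lborel) = ennreal (W (t + s) x y)"
    and pp: "\<And>t s x y. 0 < t \<Longrightarrow> 0 < s \<Longrightarrow> (LINT z|lborel. p t x z * p s z y) = p (t + s) x y"
    and Bp: "\<And>t s x y. 0 < t \<Longrightarrow> 0 < s \<Longrightarrow> (LINT z|lborel. B s x z * p t z y) = B (s + t) x y"
    and Qp: "\<And>t s x y. 0 < t \<Longrightarrow> t \<le> t0 \<Longrightarrow> 0 < s \<Longrightarrow> (\<integral>\<^sup>+z. ennreal (Q t x z * \<bar>p s z y\<bar>) \<partial>lborel) < \<infinity>"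
    and t: "0 < t" "2 * t \<le> t0" and sol: "solves F t"
  shows "solves F (2 * t)"
  unfolding solves_def
proof (intro allI)
  fix x y
  have tt: "0 < t" "t \<le> t0" "0 < 2 * t" using t by auto
  have Qm: "measurable3 Q" and Q0: "\<And>t x y. 0 < t \<Longrightarrow> 0 \<le> Q t x y" using Q by (auto simp: majorant_def)
  have fst_snd [measurable]: "(fst :: real \<times> 'a \<Rightarrow> real) \<in> borel_measurable borel" "(snd :: real \<times> 'a \<Rightarrow> 'a) \<in> borel_measurable borel"
    using measurable_fst[of "borel :: real measure" "borel :: 'a measure"]
      measurable_snd[of "borel :: real measure" "borel :: 'a measure"] by (simp_all add: borel_prod)
  note [measurable] = measurable3_compose[OF F] measurable3_compose[OF Wm] measurable3_compose[OF Qm]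
    measurable3_compose[OF p_meas] measurable3_compose[OF B_meas] kern_measurable[OF F]
  have FQ: "dominated (K * L) F Q" by (rule dominated_trans[OF FW WQ])
  have K: "K \<ge> 0" and KL: "K * L \<ge> 0" using FW FQ by (auto simp: dominated_def)
  have FWle: "\<bar>F r u w\<bar> \<le> K * W r u w" if "0 < r" "r \<le> t0" for r u w using FW that by (simp add: dominated_def)
  define f1 where "f1 w v = F t x w * kern F t w y (fst v) (snd v)" for w and v :: "real \<times> 'a"
  define f2 where "f2 w v = kern F t x w (fst v) (snd v) * p t w y" for w and v :: "real \<times> 'a"
  define h1 where "h1 v = (if 0 < fst v \<and> fst v < t then F (2 * t - fst v) x (snd v) * B (fst v) (snd v) y else 0)" for v :: "real \<times> 'a"
  define h2 where "h2 v = (if t < fst v \<and> fst v < 2 * t then F (2 * t - fst v) x (snd v) * B (fst v) (snd v) y else 0)" for v :: "real \<times> 'a"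
  have m1: "(\<lambda>(w, v). f1 w v) \<in> borel_measurable (borel \<Otimes>\<^sub>M borel)" unfolding f1_def by measurable
  have m2: "(\<lambda>(w, v). f2 w v) \<in> borel_measurable (borel \<Otimes>\<^sub>M borel)" unfolding f2_def by measurable
  have mh [measurable]: "h1 \<in> borel_measurable borel" "h2 \<in> borel_measurable borel"
    unfolding h1_def[abs_def] h2_def[abs_def] by measurable
  \<comment> \<open>The Chapman-Kolmogorov equation for \<open>F\<close> says nothing about the
    composition of absolute values. Absolute convergence is obtained from \<open>W\<close>, which is
    nonnegative and reproduces itself, and then from the majorant \<open>Q\<close> at time
    \<open>2 * t\<close>.\<close>
  have fin1: "(\<integral>\<^sup>+w. (\<integral>\<^sup>+v. ennreal \<bar>f1 w v\<bar> \<partial>lborel) \<partial>lborel) < \<infinity>"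
  proof -
    have m1': "(\<lambda>(v, w). ennreal \<bar>f1 w v\<bar>) \<in> borel_measurable (lborel \<Otimes>\<^sub>M lborel)"
      unfolding f1_def by measurable
    have "(\<integral>\<^sup>+w. (\<integral>\<^sup>+v. ennreal \<bar>f1 w v\<bar> \<partial>lborel) \<partial>lborel) = (\<integral>\<^sup>+v. (\<integral>\<^sup>+w. ennreal \<bar>f1 w v\<bar> \<partial>lborel) \<partial>lborel)"
      by (rule lborel_pair.Fubini'[OF m1'])
    also have "\<dots> \<le> (\<integral>\<^sup>+v. ennreal (K * K) * ennreal \<bar>kern W (2 * t) x y (fst v) (snd v)\<bar> \<partial>lborel)"
    proof (rule nn_integral_mono)
      fix v :: "real \<times> 'a"
      obtain s z where v: "v = (s, z)" by fastforce
      show "(\<integral>\<^sup>+w. ennreal \<bar>f1 w v\<bar> \<partial>lborel) \<le> ennreal (K * K) * ennreal \<bar>kern W (2 * t) x y (fst v) (snd v)\<bar>"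
      proof (cases "0 < s \<and> s < t")
        case True
        then have s: "0 < t - s" "t - s \<le> t0" using tt by auto
        have "ennreal \<bar>f1 w v\<bar> \<le> ennreal (K * K * \<bar>B s z y\<bar>) * ennreal (W t x w * W (t - s) w z)" for w
        proof -
          have "\<bar>F t x w\<bar> * \<bar>F (t - s) w z\<bar> \<le> (K * W t x w) * (K * W (t - s) w z)"
            using K W0 s tt by (intro mult_mono FWle) auto
          then have "\<bar>F t x w\<bar> * \<bar>F (t - s) w z\<bar> * \<bar>B s z y\<bar> \<le> (K * W t x w) * (K * W (t - s) w z) * \<bar>B s z y\<bar>"
            by (rule mult_right_mono) simp
          then have "\<bar>f1 w v\<bar> \<le> K * K * \<bar>B s z y\<bar> * (W t x w * W (t - s) w z)"
            using True by (simp add: f1_def v kern_def abs_mult mult_ac)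
          then show ?thesis
            using K by (subst ennreal_mult'[symmetric]) (auto intro!: ennreal_leI)
        qed
        then have "(\<integral>\<^sup>+w. ennreal \<bar>f1 w v\<bar> \<partial>lborel) \<le> (\<integral>\<^sup>+w. ennreal (K * K * \<bar>B s z y\<bar>) * ennreal (W t x w * W (t - s) w z) \<partial>lborel)"
          by (rule nn_integral_mono)
        also have "\<dots> = ennreal (K * K * \<bar>B s z y\<bar>) * (\<integral>\<^sup>+w. ennreal (W t x w * W (t - s) w z) \<partial>lborel)"
          by (intro nn_integral_cmult) measurable
        also have "\<dots> = ennreal (K * K * \<bar>B s z y\<bar>) * ennreal (W (2 * t - s) x z)"
          using WW[OF tt(1) s(1), of x z] by (simp add: algebra_simps)
        also have "\<dots> = ennreal (K * K) * ennreal \<bar>kern W (2 * t) x y (fst v) (snd v)\<bar>"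
          using True W0[of "2 * t - s" x z] K by (simp add: kern_def v abs_mult ennreal_mult'[symmetric] mult_ac)
        finally show ?thesis .
      qed (auto simp: f1_def v kern_def)
    qed
    also have "\<dots> = ennreal (K * K) * (\<integral>\<^sup>+v. ennreal \<bar>kern W (2 * t) x y (fst v) (snd v)\<bar> \<partial>lborel)"
    proof -
      note [measurable] = kern_measurable[OF Wm]
      show ?thesis by (intro nn_integral_cmult) measurable
    qed
    also have "\<dots> \<le> ennreal (K * K) * ennreal (L / 2 * Q (2 * t) x y)"
      by (intro mult_left_mono nn_integral_kern_lborel_le[OF Wm Q WQ tt(3) t(2)]) auto
    also have "\<dots> < \<infinity>" by (simp add: ennreal_mult_less_top)
    finally show ?thesis .
  qed
  \<comment> \<open>Here the space-time integral of the left factor comes first: it is bounded by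
    \<open>Q t x w\<close>, and \<open>Qp\<close> gives convergence of the remaining integral over
    \<open>w\<close>.\<close>
  have fin2: "(\<integral>\<^sup>+w. (\<integral>\<^sup>+v. ennreal \<bar>f2 w v\<bar> \<partial>lborel) \<partial>lborel) < \<infinity>"
  proof -
    have "(\<integral>\<^sup>+w. (\<integral>\<^sup>+v. ennreal \<bar>f2 w v\<bar> \<partial>lborel) \<partial>lborel) \<le> (\<integral>\<^sup>+w. ennreal (K * L / 2) * ennreal (Q t x w * \<bar>p t w y\<bar>) \<partial>lborel)"
    proof (rule nn_integral_mono)
      fix w :: 'a
      have mk: "(\<lambda>v. ennreal \<bar>kern F t x w (fst v) (snd v)\<bar>) \<in> borel_measurable lborel" by measurable
      have "(\<integral>\<^sup>+v. ennreal \<bar>f2 w v\<bar> \<partial>lborel) = (\<integral>\<^sup>+v. ennreal \<bar>kern F t x w (fst v) (snd v)\<bar> * ennreal \<bar>p t w y\<bar> \<partial>lborel)"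
        by (simp add: f2_def abs_mult ennreal_mult')
      also have "\<dots> = (\<integral>\<^sup>+v. ennreal \<bar>kern F t x w (fst v) (snd v)\<bar> \<partial>lborel) * ennreal \<bar>p t w y\<bar>"
        by (rule nn_integral_multc[OF mk])
      also have "\<dots> \<le> ennreal (K * L / 2 * Q t x w) * ennreal \<bar>p t w y\<bar>"
        by (intro mult_right_mono nn_integral_kern_lborel_le[OF F Q FQ tt(1,2)]) auto
      also have "\<dots> = ennreal (K * L / 2) * ennreal (Q t x w * \<bar>p t w y\<bar>)"
        using KL Q0[OF tt(1)] by (simp add: ennreal_mult'[symmetric] mult_ac)
      finally show "(\<integral>\<^sup>+v. ennreal \<bar>f2 w v\<bar> \<partial>lborel) \<le> ennreal (K * L / 2) * ennreal (Q t x w * \<bar>p t w y\<bar>)" .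
    qed
    also have "\<dots> = ennreal (K * L / 2) * (\<integral>\<^sup>+w. ennreal (Q t x w * \<bar>p t w y\<bar>) \<partial>lborel)"
      by (intro nn_integral_cmult) measurable
    also have "\<dots> < \<infinity>" using Qp[OF tt(1,2) tt(1), of x y] by (simp add: ennreal_mult_less_top)
    finally show ?thesis .
  qed
  have FU: "F t x w * U F t w y = (LINT v|lborel. f1 w v)" for w
    unfolding f1_def U_eq_lborel[OF F Q FQ tt(1,2)] by simp
  have Up: "U F t x w * p t w y = (LINT v|lborel. f2 w v)" for w
    unfolding f2_def U_eq_lborel[OF F Q FQ tt(1,2)] by simp
  have I1: "(LINT w|lborel. F t x w * U F t w y) = (LINT v|lborel. h1 v)"
  proof -
    have "(LINT w|lborel. f1 w v) = h1 v" for v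
    proof -
      obtain s z where v: "v = (s, z)" by fastforce
      show ?thesis
      proof (cases "0 < s \<and> s < t")
        case True
        then have "f1 w v = (F t x w * F (t - s) w z) * B s z y" for w by (simp add: f1_def v kern_def)
        then have "(LINT w|lborel. f1 w v) = (LINT w|lborel. F t x w * F (t - s) w z) * B s z y" by simp
        also have "\<dots> = F (t + (t - s)) x z * B s z y" using True by (subst CK) auto
        finally show ?thesis using True by (simp add: h1_def v algebra_simps)
      qed (auto simp: f1_def h1_def v kern_def)
    qed
    then show ?thesis unfolding FU integral_swap_if_finite(2)[OF m1 fin1] by simp
  qed
  have I2: "(LINT w|lborel. U F t x w * p t w y) = (LINT v|lborel. h2 v)"
  proof -
    have "(LINT w|lborel. f2 w v) = h2 (v + (t, 0))" for v
    proof -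
      obtain s z where v: "v = (s, z)" by fastforce
      show ?thesis
      proof (cases "0 < s \<and> s < t")
        case True
        then have "f2 w v = F (t - s) x z * (B s z w * p t w y)" for w by (simp add: f2_def v kern_def)
        then have "(LINT w|lborel. f2 w v) = F (t - s) x z * (LINT w|lborel. B s z w * p t w y)" by simp
        also have "\<dots> = F (t - s) x z * B (s + t) z y" using True tt by (subst Bp) auto
        finally show ?thesis using True by (simp add: h2_def v algebra_simps)
      qed (auto simp: f2_def h2_def v kern_def)
    qed
    then have "(LINT v|lborel. LINT w|lborel. f2 w v) = (LINT v|lborel. h2 (v + (t, 0)))" by simp
    also have "\<dots> = (LINT v|lborel. h2 v)" by (rule integral_translate[OF mh(2)])
    finally show ?thesis unfolding Up integral_swap_if_finite(2)[OF m2 fin2] .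
  qed
  have ipp: "integrable lborel (\<lambda>w. p t x w * p t w y)"
    unfolding integrable_iff_bounded
  proof
    have "(\<integral>\<^sup>+w. ennreal (norm (p t x w * p t w y)) \<partial>lborel) \<le> (\<integral>\<^sup>+w. ennreal C * ennreal (Q t x w * \<bar>p t w y\<bar>) \<partial>lborel)"
    proof (rule nn_integral_mono)
      fix w
      have "\<bar>p t x w\<bar> * \<bar>p t w y\<bar> \<le> C * Q t x w * \<bar>p t w y\<bar>"
        using pQ tt by (intro mult_right_mono) (auto simp: dominated_def)
      then show "ennreal (norm (p t x w * p t w y)) \<le> ennreal C * ennreal (Q t x w * \<bar>p t w y\<bar>)"
        using pQ by (subst ennreal_mult'[symmetric]) (auto simp: dominated_def abs_mult mult.assoc intro!: ennreal_leI)
    qed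
    also have "\<dots> = ennreal C * (\<integral>\<^sup>+w. ennreal (Q t x w * \<bar>p t w y\<bar>) \<partial>lborel)"
      by (intro nn_integral_cmult) measurable
    also have "\<dots> < \<infinity>" using Qp[OF tt(1,2) tt(1), of x y] by (simp add: ennreal_mult_less_top)
    finally show "(\<integral>\<^sup>+w. ennreal (norm (p t x w * p t w y)) \<partial>lborel) < \<infinity>" .
  qed measurable
  have iFU: "integrable lborel (\<lambda>w. F t x w * U F t w y)" unfolding FU by (rule integral_swap_if_finite(3)[OF m1 fin1])
  have iUp: "integrable lborel (\<lambda>w. U F t x w * p t w y)" unfolding Up by (rule integral_swap_if_finite(3)[OF m2 fin2])
  have sol': "F t u w = p t u w + U F t u w" for u w using sol by (simp add: solves_def)
  have "F (2 * t) x y = (LINT w|lborel. F t x w * F t w y)" unfolding mult_2 by (rule CK[OF tt(1) tt(1)])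
  also have "\<dots> = (LINT w|lborel. (p t x w * p t w y + U F t x w * p t w y) + F t x w * U F t w y)"
  proof (intro Bochner_Integration.integral_cong refl)
    fix w
    have "F t x w * F t w y = F t x w * p t w y + F t x w * U F t w y" by (subst sol'[of w y]) (rule distrib_left)
    also have "F t x w * p t w y = p t x w * p t w y + U F t x w * p t w y" by (subst sol'[of x w]) (rule distrib_right)
    finally show "F t x w * F t w y = (p t x w * p t w y + U F t x w * p t w y) + F t x w * U F t w y" .
  qed
  also have "\<dots> = p (2 * t) x y + (LINT v|lborel. h2 v) + (LINT v|lborel. h1 v)"
    unfolding mult_2 Bochner_Integration.integral_add[OF Bochner_Integration.integrable_add[OF ipp iUp] iFU]
        Bochner_Integration.integral_add[OF ipp iUp] I1 I2 pp[OF tt(1) tt(1)] ..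
  also have "p (2 * t) x y + (LINT v|lborel. h2 v) + (LINT v|lborel. h1 v) = p (2 * t) x y + U F (2 * t) x y"
  proof -
    note ik = integrable_kern_lborel[OF F Q FQ tt(3) t(2), of x y]
    have ih: "integrable lborel h1" "integrable lborel h2"
      by (rule Bochner_Integration.integrable_bound[OF ik]; force simp: h1_def h2_def kern_def)+
    \<comment> \<open>The two parts miss exactly the slice \<open>s = t\<close>, a null set in
      space-time.\<close>
    have "AE v in (lborel :: real measure) \<Otimes>\<^sub>M (lborel :: 'a measure). fst v \<noteq> t"
    proof (rule lborel_pair.AE_pair_measure)
      show "{v \<in> space ((lborel :: real measure) \<Otimes>\<^sub>M (lborel :: 'a measure)). fst v \<noteq> t} \<in> sets (lborel \<Otimes>\<^sub>M lborel)"
        by measurable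
      show "AE s in lborel. AE z in (lborel :: 'a measure). fst (s, z) \<noteq> t"
        using AE_lborel_singleton[of t] by eventually_elim simp
    qed
    then have "AE v in (lborel :: (real \<times> 'a) measure). fst v \<noteq> t" unfolding lborel_prod .
    then have "AE v in lborel. kern F (2 * t) x y (fst v) (snd v) = h1 v + h2 v"
      by eventually_elim (use tt in \<open>auto simp: kern_def h1_def h2_def\<close>)
    then have "U F (2 * t) x y = (LINT v|lborel. h1 v + h2 v)"
      unfolding U_eq_lborel[OF F Q FQ tt(3) t(2)] by (intro integral_cong_AE) auto
    also have "\<dots> = (LINT v|lborel. h1 v) + (LINT v|lborel. h2 v)" by (rule Bochner_Integration.integral_add[OF ih])
    finally show ?thesis by simp
  qed
  finally show "F (2 * t) x y = p (2 * t) x y + U F (2 * t) x y" .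
qed

text \<open>Agreement on \<open>(0, \<epsilon>]\<close> makes \<open>F\<close> solve Duhamel's
  equation there, doubling spreads the equation to \<open>(0, t0]\<close>, and uniqueness identifies
  \<open>F\<close> with \<open>S\<close>. No relation between \<epsilon> and the other constants is
  imposed, so \<epsilon> may depend on the solution under consideration.\<close>

lemma solution_eq_S:
  assumes F: "measurable3 F" and Q: "majorant Q" and pQ: "dominated C p Q" and WQ: "dominated L W Q"
    and CK: "\<And>t s x y. 0 < t \<Longrightarrow> 0 < s \<Longrightarrow> F (t + s) x y = (LINT z|lborel. F t x z * F s z y)"
    and W0: "\<And>t x y. 0 < t \<Longrightarrow> 0 \<le> W t x y" and Wm: "measurable3 W"
    and WW: "\<And>t s x y. 0 < t \<Longrightarrow> 0 < s \<Longrightarrow> (\<integral>\<^sup>+z. ennreal (W t x z * W s z y) \<partial>lborel) = ennreal (W (t + s) x y)"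
    and pp: "\<And>t s x y. 0 < t \<Longrightarrow> 0 < s \<Longrightarrow> (LINT z|lborel. p t x z * p s z y) = p (t + s) x y"
    and Bp: "\<And>t s x y. 0 < t \<Longrightarrow> 0 < s \<Longrightarrow> (LINT z|lborel. B s x z * p t z y) = B (s + t) x y"
    and Qp: "\<And>t s x y. 0 < t \<Longrightarrow> t \<le> t0 \<Longrightarrow> 0 < s \<Longrightarrow> (\<integral>\<^sup>+z. ennreal (Q t x z * \<bar>p s z y\<bar>) \<partial>lborel) < \<infinity>"
    and \<epsilon>: "0 < \<epsilon>" "\<epsilon> \<le> t0" and FS: "\<And>t x y. 0 < t \<Longrightarrow> t \<le> \<epsilon> \<Longrightarrow> F t x y = S t x y"
    and K: "1 \<le> K" and SW: "dominated K S W"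
    and t: "0 < t" "t \<le> t0"
  shows "F t x y = S t x y"
proof -
  obtain n where n: "t0 \<le> real (Suc n) * \<epsilon>"
  proof -
    obtain m where "t0 / \<epsilon> < real m" using reals_Archimedean2 by blast
    then have "t0 \<le> real (Suc m) * \<epsilon>" using \<epsilon> by (simp add: pos_divide_less_eq distrib_right)
    then show ?thesis using that by blast
  qed
  \<comment> \<open>This constant deteriorates as \<epsilon> shrinks, but it only certifies that
    \<open>F\<close> belongs to the class in which solutions are unique; it does not enter the
    conclusion.\<close>
  have FW: "dominated (K ^ Suc n) F W"
    unfolding dominated_def
  proof (intro conjI ballI allI)
    show "0 \<le> K ^ Suc n" using K by simp
    fix t x y assume "t \<in> {0<..t0}"
    then have t: "0 < t" "t \<le> real (Suc n) * \<epsilon>" using n by auto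
    have "\<bar>F t x y\<bar> \<le> K * W t x y" if "0 < t" "t \<le> \<epsilon>" for t x y
      using that FS SW \<epsilon> by (simp add: dominated_def)
    then show "\<bar>F t x y\<bar> \<le> K ^ Suc n * W t x y"
      by (rule iterated_kernel_bound[OF K _ \<epsilon>(1) CK W0 Wm WW t])
  qed
  have small: "solves F t" if "0 < t" "t \<le> \<epsilon>" for t
  proof -
    have "U F t x y = U S t x y" for x y
      unfolding U_eq_iterated
      by (intro Bochner_Integration.integral_cong refl) (use that FS in \<open>auto simp: kern_def\<close>)
    then show ?thesis
      using S_solves[OF Q pQ, of t] that \<epsilon> FS by (simp add: solves_def)
  qed
  have dbl: "solves F t" if "0 < t" "t \<le> t0" "t \<le> 2 ^ k * \<epsilon>" for t k
    using that
  proof (induction k arbitrary: t)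
    case (Suc k)
    have "solves F (t / 2)" using Suc.prems by (intro Suc.IH) auto
    then have "solves F (2 * (t / 2))"
      using Suc.prems by (intro solves_double[OF F Q pQ FW WQ CK W0 Wm WW pp Bp Qp]) auto
    then show ?case by simp
  qed (use small in simp)
  have all: "solves F t" if "0 < t" "t \<le> t0" for t
  proof -
    obtain k where "t / \<epsilon> < 2 ^ k" using real_arch_pow[of 2 "t / \<epsilon>"] by auto
    then have "t \<le> 2 ^ k * \<epsilon>" using \<epsilon> by (simp add: pos_divide_less_eq)
    then show ?thesis by (rule dbl[OF that])
  qed
  show ?thesis
    by (rule solution_unique[OF Q F dominated_trans[OF FW WQ] all S_measurable S_dominated[OF Q pQ] S_solves[OF Q pQ] t])
qed

end

section \<open>The fundamental solution\<close>

lemma qa_measurable [measurable]: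
  "(\<lambda>(t, z::'a::euclidean_space). qa \<alpha> a \<beta> t z) \<in> borel_measurable (borel \<Otimes>\<^sub>M borel)"
  unfolding qa_def by measurable

lemma qa_nonneg: "0 < t \<Longrightarrow> 0 \<le> qa \<alpha> a \<beta> t z"
  unfolding qa_eq_bell_jump by (intro add_nonneg_nonneg bell_nonneg jump_nonneg) auto

lemma bell_antimono:
  assumes "\<beta> \<le> \<beta>'" "0 < t"
  shows "bell d \<beta>' t R \<le> bell d \<beta> t R"
proof -
  have "\<beta> * R\<^sup>2 / t \<le> \<beta>' * R\<^sup>2 / t" using assms by (intro divide_right_mono mult_right_mono) auto
  then show ?thesis unfolding bell_def by (intro mult_left_mono) auto
qed

lemma qa_antimono: "\<beta> \<le> \<beta>' \<Longrightarrow> 0 < t \<Longrightarrow> qa \<alpha> a \<beta>' t z \<le> qa \<alpha> a \<beta> t z"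
  unfolding qa_eq_bell_jump by (intro add_mono bell_antimono) auto

lemma qa_le_powr:
  assumes "0 \<le> \<beta>" "0 < t"
  shows "qa \<alpha> a \<beta> t (z::'a::euclidean_space) \<le> 2 * t powr (- real DIM('a) / 2)"
  using bell_le_powr[OF assms, of "real DIM('a)" "norm z"] jump_le_powr[of "real DIM('a)" \<alpha> "a powr \<alpha> * t" t "norm z"]
  unfolding qa_eq_bell_jump by linarith

text \<open>Under \<open>t \<mapsto> c t\<close> the Gaussian and the cap of the jump part scale by
  \<open>k = c powr (- d / 2)\<close>, while the jump tail scales by \<open>c\<close>. Hence
  \<open>min k c\<close> and \<open>max k c\<close>; the exponent \<beta> becomes
  \<open>\<beta> / c\<close>.\<close>

lemma qa_time_scale:
  fixes z :: "'a::euclidean_space"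
  assumes c: "0 < c" and t: "0 < t"
  defines "k \<equiv> c powr (- real DIM('a) / 2)"
  shows "min k c * qa \<alpha> a (\<beta> / c) t z \<le> qa \<alpha> a \<beta> (c * t) z"
    and "qa \<alpha> a \<beta> (c * t) z \<le> max k c * qa \<alpha> a (\<beta> / c) t z"
proof -
  let ?d = "real DIM('a)" and ?R = "norm z"
  have k: "k > 0" using c by (simp add: k_def)
  have bell: "bell ?d \<beta> (c * t) ?R = k * bell ?d (\<beta> / c) t ?R"
    using c t by (simp add: bell_def k_def powr_mult)
  have kt: "(c * t) powr (- ?d / 2) = k * t powr (- ?d / 2)"
    using c t by (simp add: k_def powr_mult)
  let ?J = "jump ?d \<alpha> (a powr \<alpha> * t) t ?R" and ?J' = "jump ?d \<alpha> (a powr \<alpha> * (c * t)) (c * t) ?R"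
  have nn: "0 \<le> a powr \<alpha> * t" "0 \<le> a powr \<alpha> * (c * t)" using c t by auto
  have J0: "0 \<le> ?J" "0 \<le> ?J'" using nn by (auto intro: jump_nonneg)
  have b0: "0 \<le> bell ?d (\<beta> / c) t ?R" by (rule bell_nonneg)
  have "min k c * ?J \<le> ?J'"
    unfolding le_jump_iff[OF nn(2) norm_ge_zero]
  proof
    have "min k c * ?J \<le> k * t powr (- ?d / 2)"
      using k J0 jump_le_powr by (intro mult_mono) auto
    then show "min k c * ?J \<le> (c * t) powr (- ?d / 2)" unfolding kt .
    have "min k c * (?J * ?R powr (?d + \<alpha>)) \<le> c * (a powr \<alpha> * t)"
      using c J0 by (intro mult_mono[OF _ jump_mult_le[OF nn(1) norm_ge_zero]]) auto
    then show "min k c * ?J * ?R powr (?d + \<alpha>) \<le> a powr \<alpha> * (c * t)" by (simp add: mult_ac)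
  qed
  moreover have "min k c * bell ?d (\<beta> / c) t ?R \<le> k * bell ?d (\<beta> / c) t ?R"
    using b0 by (intro mult_right_mono) auto
  ultimately show "min k c * qa \<alpha> a (\<beta> / c) t z \<le> qa \<alpha> a \<beta> (c * t) z"
    unfolding qa_eq_bell_jump distrib_left bell by linarith
  have "?J' / max k c \<le> ?J"
    unfolding le_jump_iff[OF nn(1) norm_ge_zero]
  proof
    have "?J' \<le> k * t powr (- ?d / 2)" using jump_le_powr[of ?d \<alpha> "a powr \<alpha> * (c * t)" "c * t" ?R] unfolding kt .
    also have "\<dots> \<le> max k c * t powr (- ?d / 2)" by (intro mult_right_mono) auto
    finally show "?J' / max k c \<le> t powr (- ?d / 2)" using k by (simp add: pos_divide_le_eq less_max_iff_disj mult.commute)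
    have "?J' * ?R powr (?d + \<alpha>) \<le> a powr \<alpha> * (c * t)" by (rule jump_mult_le[OF nn(2) norm_ge_zero])
    also have "\<dots> = (a powr \<alpha> * t) * c" by simp
    also have "\<dots> \<le> (a powr \<alpha> * t) * max k c" using nn by (intro mult_left_mono) auto
    finally have "?J' * ?R powr (?d + \<alpha>) / max k c \<le> a powr \<alpha> * t" using k by (simp add: pos_divide_le_eq less_max_iff_disj)
    then show "?J' / max k c * ?R powr (?d + \<alpha>) \<le> a powr \<alpha> * t" by simp
  qed
  then have "?J' \<le> max k c * ?J" using k by (simp add: pos_divide_le_eq less_max_iff_disj mult.commute)
  moreover have "k * bell ?d (\<beta> / c) t ?R \<le> max k c * bell ?d (\<beta> / c) t ?R"
    using b0 by (intro mult_right_mono) auto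
  ultimately show "qa \<alpha> a \<beta> (c * t) z \<le> max k c * qa \<alpha> a (\<beta> / c) t z"
    unfolding qa_eq_bell_jump distrib_left bell by linarith
qed

section \<open>Convolution identities in two-point form\<close>

context positive_pa begin

lemma nn_integral_pa_semigroup:
  fixes x y :: 'a
  assumes a: "a > 0" and t: "t > 0" and s: "s > 0"
  shows "(\<integral>\<^sup>+z. ennreal (pa \<alpha> a t (x - z) * pa \<alpha> a s (z - y)) \<partial>lborel) = ennreal (pa \<alpha> a (t + s) (x - y))"
    and "(LINT z|lborel. pa \<alpha> a t (x - z) * pa \<alpha> a s (z - y)) = pa \<alpha> a (t + s) (x - y)"
proof -
  have [measurable]: "(pa \<alpha> a t :: 'a \<Rightarrow> real) \<in> borel_measurable borel" for t by measurable
  let ?h = "\<lambda>z. pa \<alpha> a t (x - z) * pa \<alpha> a s (z - y)"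
  let ?K = "(1 / (2 * pi) ^ DIM('a)) * (LINT \<xi>::'a|lborel. phi \<alpha> a t \<xi>)"
  have "(LINT z|lborel. ?h z) = (LINT w|lborel. ?h (w + y))"
    by (rule integral_translate[symmetric]) measurable
  also have "\<dots> = (LINT w|lborel. pa \<alpha> a t ((x - y) - w) * pa \<alpha> a s w)"
    by (simp add: algebra_simps)
  also have "\<dots> = pa \<alpha> a (t + s) (x - y)" by (rule pa_semigroup[OF a t s])
  finally show eq: "(LINT z|lborel. ?h z) = pa \<alpha> a (t + s) (x - y)" .
  have "integrable lborel (\<lambda>z. pa \<alpha> a s (y - z))" by (rule integrable_reflect[OF integrable_pa[OF a s]])
  then have i: "integrable lborel (\<lambda>z. ?K * pa \<alpha> a s (z - y))"
    using pa_minus[of \<alpha> a s "y - z" for z] by (intro integrable_mult_right) (simp add: minus_diff_eq)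
  have "integrable lborel ?h"
  proof (rule Bochner_Integration.integrable_bound[OF i])
    have "\<bar>pa \<alpha> a t (x - z) * pa \<alpha> a s (z - y)\<bar> \<le> ?K * pa \<alpha> a s (z - y)" for z
      using pa_le[OF t, of \<alpha> a "x - z"] pa_nonneg[OF a t, of "x - z"] pa_nonneg[OF a s, of "z - y"]
      by (simp only: abs_mult abs_of_nonneg) (rule mult_right_mono)
    then show "AE z in lborel. norm (?h z) \<le> norm (?K * pa \<alpha> a s (z - y))"
      by (intro AE_I2) (metis abs_ge_self order_trans real_norm_def)
  qed measurable
  then have "(\<integral>\<^sup>+z. ennreal (?h z) \<partial>lborel) = ennreal (LINT z|lborel. ?h z)"
    by (rule nn_integral_eq_integral) (use pa_nonneg a t s in auto)
  then show "(\<integral>\<^sup>+z. ennreal (?h z) \<partial>lborel) = ennreal (pa \<alpha> a (t + s) (x - y))" by (simp only: eq)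
qed

lemma dpa_pa_convolution:
  fixes x y e :: 'a
  assumes a: "a > 0" and t: "t > 0" and s: "s > 0"
  shows "(LINT z|lborel. dpa \<alpha> a s (x - z) e * pa \<alpha> a t (z - y)) = dpa \<alpha> a (s + t) (x - y) e"
proof -
  have [measurable]: "(pa \<alpha> a t :: 'a \<Rightarrow> real) \<in> borel_measurable borel"
    "(\<lambda>z. dpa \<alpha> a s z e) \<in> borel_measurable borel" by measurable
  let ?h = "\<lambda>z. dpa \<alpha> a s (x - z) e * pa \<alpha> a t (z - y)"
  have "(LINT z|lborel. ?h z) = (LINT w|lborel. ?h (x - w))"
    by (rule integral_reflect[symmetric]) measurable
  also have "\<dots> = (LINT w|lborel. pa \<alpha> a t ((x - y) - w) * dpa \<alpha> a s w e)"
    by (intro Bochner_Integration.integral_cong refl) (simp add: mult.commute diff_diff_eq add.commute)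
  also have "\<dots> = dpa \<alpha> a (t + s) (x - y) e" by (rule dpa_convolution[OF a t s])
  finally show ?thesis by (simp add: add.commute)
qed

end

section \<open>Estimates based on the two-sided kernel bounds\<close>

locale two_sided =
  fixes \<alpha> \<beta>L \<beta>U M :: real and dummy :: "'a::euclidean_space itself"
  assumes dim: "DIM('a) \<ge> 2" and \<alpha>: "0 < \<alpha>" "\<alpha> < 2"
    and ts: "two_sided_constants TYPE('a) \<alpha> \<beta>L \<beta>U" and M: "M > 0"
begin

lemma beta_pos: "\<beta>L > 0" "\<beta>U > 0"
  using ts by (auto simp: two_sided_constants_def)

lemma two_sidedE:
  assumes "N > 0" "T > 0"
  obtains CL CU where "CL > 0" "CU > 0"
    "\<And>a t (z::'a). 0 < a \<Longrightarrow> a \<le> N \<Longrightarrow> 0 < t \<Longrightarrow> t \<le> T \<Longrightarrow> CL * qa \<alpha> a \<beta>L t z \<le> pa \<alpha> a t z"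
    "\<And>a t (z::'a). 0 < a \<Longrightarrow> a \<le> N \<Longrightarrow> 0 < t \<Longrightarrow> t \<le> T \<Longrightarrow> pa \<alpha> a t z \<le> CU * qa \<alpha> a \<beta>U t z"
proof -
  obtain CL CU where "CL > 0" "CU > 0" "\<forall>a\<in>{0<..N}. \<forall>t\<in>{0<..T}. \<forall>z::'a.
        CL * qa \<alpha> a \<beta>L t z \<le> pa \<alpha> a t z \<and> pa \<alpha> a t z \<le> CU * qa \<alpha> a \<beta>U t z"
    using ts assms unfolding two_sided_constants_def by metis
  then show ?thesis by (intro that[of CL CU]) auto
qed

sublocale positive_pa \<alpha> dummy
proof
  fix a t :: real and z :: 'a assume a: "0 < a" and t: "0 < t"
  obtain CL CU where "CL > 0" "\<And>a' t' (z::'a). 0 < a' \<Longrightarrow> a' \<le> a \<Longrightarrow> 0 < t' \<Longrightarrow> t' \<le> t \<Longrightarrow> CL * qa \<alpha> a' \<beta>L t' z \<le> pa \<alpha> a' t' z"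
    using two_sidedE[OF a t] by metis
  then have "CL * qa \<alpha> a \<beta>L t z \<le> pa \<alpha> a t z" using a t by auto
  moreover have "0 \<le> CL * qa \<alpha> a \<beta>L t z" using \<open>CL > 0\<close> qa_nonneg[OF t, of \<alpha> a \<beta>L z] by simp
  ultimately show "0 \<le> pa \<alpha> a t z" by linarith
qed (rule \<alpha>)+

text \<open>The lower bound at \<open>a = t = 1\<close> and \<open>\<integral>p \<le> 1\<close> give integrability without polar coordinates.\<close>

lemma jump_integral_finite: "(\<integral>\<^sup>+z. ennreal (jump (real DIM('a)) \<alpha> 1 1 (norm (z::'a))) \<partial>lborel) < \<infinity>"
proof -
  obtain CL where CL: "CL > 0" "\<And>a t (z::'a). 0 < a \<Longrightarrow> a \<le> 1 \<Longrightarrow> 0 < t \<Longrightarrow> t \<le> 1 \<Longrightarrow> CL * qa \<alpha> a \<beta>L t z \<le> pa \<alpha> a t z"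
    using two_sidedE[of 1 1] by (metis zero_less_one)
  have [measurable]: "(pa \<alpha> 1 1 :: 'a \<Rightarrow> real) \<in> borel_measurable borel" by measurable
  have le: "jump (real DIM('a)) \<alpha> 1 1 (norm z) \<le> 1 / CL * pa \<alpha> 1 1 z" for z :: 'a
  proof -
    have "jump (real DIM('a)) \<alpha> 1 1 (norm z) \<le> qa \<alpha> 1 \<beta>L 1 z"
      unfolding qa_eq_bell_jump using bell_nonneg[of "real DIM('a)" \<beta>L 1 "norm z"] by simp
    also have "\<dots> \<le> 1 / CL * pa \<alpha> 1 1 z" using CL(1) CL(2)[of 1 1 z] by (simp add: field_simps)
    finally show ?thesis .
  qed
  have "(\<integral>\<^sup>+z. ennreal (jump (real DIM('a)) \<alpha> 1 1 (norm (z::'a))) \<partial>lborel) \<le> (\<integral>\<^sup>+z. ennreal (1 / CL) * ennreal (pa \<alpha> 1 1 (z::'a)) \<partial>lborel)"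
    using CL(1) by (intro nn_integral_mono) (simp only: ennreal_mult'[symmetric] ennreal_leI le zero_le_one less_imp_le divide_nonneg_nonneg)
  also have "\<dots> = ennreal (1 / CL) * (\<integral>\<^sup>+z. ennreal (pa \<alpha> 1 1 (z::'a)) \<partial>lborel)"
    by (intro nn_integral_cmult) measurable
  also have "\<dots> \<le> ennreal (1 / CL) * 1"
    by (intro mult_left_mono nn_integral_pa_le) auto
  also have "\<dots> < \<infinity>" by simp
  finally show ?thesis .
qed

lemma gradient_bound:
  obtains K where "K > 0"
    "\<And>a t (z::'a) e. 0 < a \<Longrightarrow> a \<le> M \<Longrightarrow> 0 < t \<Longrightarrow> t \<le> 1 \<Longrightarrow>
       \<bar>dpa \<alpha> a t z e\<bar> \<le> K * norm e * t powr (- 1 / 2) * qa \<alpha> a (3 / 4 * \<beta>U) t z"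
proof -
  \<comment> \<open>The horizon 2 covers the enlarged time \<open>4 / 3 * t\<close> for
    \<open>t \<le> 1\<close>.\<close>
  obtain CL CU where CU: "CU > 0"
    "\<And>a t (z::'a). 0 < a \<Longrightarrow> a \<le> M \<Longrightarrow> 0 < t \<Longrightarrow> t \<le> 2 \<Longrightarrow> pa \<alpha> a t z \<le> CU * qa \<alpha> a \<beta>U t z"
    using two_sidedE[of M 2] M by (metis zero_less_numeral)
  define A where "A = 2 * 2 powr (real DIM('a) / 2) * sqrt 3"
  have A: "A > 0" by (simp add: A_def)
  have "\<bar>dpa \<alpha> a t z e\<bar> \<le> A * CU * norm e * t powr (- 1 / 2) * qa \<alpha> a (3 / 4 * \<beta>U) t z"
    if a: "0 < a" "a \<le> M" and t: "0 < t" "t \<le> 1" for a t and z e :: 'a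
  proof -
    define a' where "a' = a * (3 / 4) powr (1 / \<alpha>)"
    have a': "a' > 0" "a' powr \<alpha> * (4 / 3) = a powr \<alpha>" using a \<alpha> by (auto simp: a'_def powr_mult powr_powr)
    have "(3 / 4 :: real) powr (1 / \<alpha>) \<le> 1" using \<alpha> by (intro powr_le1) auto
    then have "a' \<le> a" unfolding a'_def using a mult_left_le[of "(3 / 4) powr (1 / \<alpha>)" a] by simp
    then have a'M: "a' \<le> M" using a by simp
    \<comment> \<open>The enlarged time weakens the Gaussian exponent by the factor 3/4. The jump
      coefficient is unchanged because
      \<open>a' powr \<alpha> * (4 / 3 * t) = a powr \<alpha> * t\<close>.\<close>
    have q: "qa \<alpha> a' \<beta>U (4 / 3 * t) z \<le> qa \<alpha> a (3 / 4 * \<beta>U) t z"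
    proof -
      let ?d = "real DIM('a)"
      have p: "(4 / 3 * t) powr (- ?d / 2) \<le> t powr (- ?d / 2)" using t by (intro powr_mono2') auto
      have "bell ?d \<beta>U (4 / 3 * t) (norm z) \<le> bell ?d (3 / 4 * \<beta>U) t (norm z)"
        unfolding bell_def by (rule mult_mono) (use p in \<open>auto simp: field_simps\<close>)
      moreover have "a' powr \<alpha> * (4 / 3 * t) = a powr \<alpha> * t" by (simp flip: a'(2))
      then have "jump ?d \<alpha> (a' powr \<alpha> * (4 / 3 * t)) (4 / 3 * t) (norm z) \<le> jump ?d \<alpha> (a powr \<alpha> * t) t (norm z)"
        using p unfolding jump_def by (simp only:) (auto intro: min.mono)
      ultimately show ?thesis unfolding qa_eq_bell_jump by (rule add_mono)
    qed
    have "\<bar>dpa \<alpha> a t z e\<bar> \<le> A / sqrt t * norm e * pa \<alpha> a' (4 / 3 * t) z"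
      unfolding A_def by (rule dpa_bound[OF a(1) t(1) a'])
    also have "\<dots> \<le> A / sqrt t * norm e * (CU * qa \<alpha> a (3 / 4 * \<beta>U) t z)"
    proof (intro mult_left_mono)
      have "pa \<alpha> a' (4 / 3 * t) z \<le> CU * qa \<alpha> a' \<beta>U (4 / 3 * t) z" using a' a'M t by (intro CU) auto
      also have "\<dots> \<le> CU * qa \<alpha> a (3 / 4 * \<beta>U) t z" using CU(1) by (intro mult_left_mono q) auto
      finally show "pa \<alpha> a' (4 / 3 * t) z \<le> CU * qa \<alpha> a (3 / 4 * \<beta>U) t z" .
    qed (use A t in auto)
    also have "\<dots> = A * CU * norm e * t powr (- 1 / 2) * qa \<alpha> a (3 / 4 * \<beta>U) t z"
      using t by (simp add: powr_minus powr_half_sqrt field_simps)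
    finally show ?thesis .
  qed
  with A CU(1) that[of "A * CU"] show ?thesis by auto
qed

text \<open>Gradient bound, three-point inequality and Kato estimate combined. The constant
  \<open>N\<close> is uniform in \<open>a\<close> and \<open>b\<close>; all dependence on the drift
  sits in the Kato modulus at radius \<open>sqrt t\<close>, whose smallness later yields the
  contraction factor.\<close>

lemma qa_majorant:
  assumes g: "0 < \<gamma>" "\<gamma> < 3 / 4 * \<beta>U"
  obtains N where "N > 0"
    "\<And>a (b :: 'a \<Rightarrow> 'a) t x y. 0 < a \<Longrightarrow> a \<le> M \<Longrightarrow> b \<in> borel_measurable borel \<Longrightarrow> 0 < t \<Longrightarrow> t \<le> 1 \<Longrightarrow>
       (\<integral>\<^sup>+s. (\<integral>\<^sup>+z. ennreal (qa \<alpha> a \<gamma> (t - s) (x - z) * \<bar>dpa \<alpha> a s (z - y) (b z)\<bar>) \<partial>lborel) * indicator {0<..<t} s \<partial>lborel)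
         \<le> ennreal (N * qa \<alpha> a \<gamma> t (x - y)) * kato_M (\<lambda>x. norm (b x)) (sqrt t)"
proof -
  let ?d = "real DIM('a)"
  obtain K where K: "K > 0" "\<And>a t (z::'a) e. 0 < a \<Longrightarrow> a \<le> M \<Longrightarrow> 0 < t \<Longrightarrow> t \<le> 1 \<Longrightarrow>
       \<bar>dpa \<alpha> a t z e\<bar> \<le> K * norm e * t powr (- 1 / 2) * qa \<alpha> a (3 / 4 * \<beta>U) t z"
    by (rule gradient_bound, rule that)
  obtain C where C: "C \<ge> 1"
    "\<And>a u v x y z. 0 < a \<Longrightarrow> a \<le> M \<Longrightarrow> u > 0 \<Longrightarrow> v > 0 \<Longrightarrow> u + v \<le> 1 \<Longrightarrow>
      qa \<alpha> a \<gamma> u (x - z) * qa \<alpha> a (3 / 4 * \<beta>U) v (z - y) \<le> C * qa \<alpha> a \<gamma> (u + v) (x - y :: 'a) *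
        (envelope ?d \<alpha> u (norm (x - z)) + envelope ?d \<alpha> v (norm (z - y)))"
    by (rule qa_3P[OF \<alpha> M g, where 'a='a], rule that)
  obtain E where E: "E > 0"
    "\<And>(f :: 'a \<Rightarrow> real) t x y. f \<in> borel_measurable borel \<Longrightarrow> t > 0 \<Longrightarrow>
      (\<integral>\<^sup>+s. (\<integral>\<^sup>+z. ennreal (s powr (- 1 / 2) * \<bar>f z\<bar> *
         (envelope ?d \<alpha> (t - s) (norm (x - z)) + envelope ?d \<alpha> s (norm (z - y)))) \<partial>lborel) * indicator {0<..<t} s \<partial>lborel)
      \<le> ennreal E * kato_M f (sqrt t)"
    by (rule envelope_kato_integral[OF dim \<alpha>(1) jump_integral_finite], rule that)
  have "(\<integral>\<^sup>+s. (\<integral>\<^sup>+z. ennreal (qa \<alpha> a \<gamma> (t - s) (x - z) * \<bar>dpa \<alpha> a s (z - y) (b z)\<bar>) \<partial>lborel) * indicator {0<..<t} s \<partial>lborel)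
         \<le> ennreal (C * K * E * qa \<alpha> a \<gamma> t (x - y)) * kato_M (\<lambda>x. norm (b x)) (sqrt t)"
    if a: "0 < a" "a \<le> M" and b [measurable]: "b \<in> borel_measurable borel" and t: "0 < t" "t \<le> 1"
    for a t and b :: "'a \<Rightarrow> 'a" and x y
  proof -
    let ?g = "\<lambda>s z. s powr (- 1 / 2) * \<bar>norm (b z)\<bar> * (envelope ?d \<alpha> (t - s) (norm (x - z)) + envelope ?d \<alpha> s (norm (z - y)))"
    define q where "q = C * K * qa \<alpha> a \<gamma> t (x - y)"
    have q0: "0 \<le> q" using C K qa_nonneg[OF t(1), of \<alpha> a \<gamma> "x - y"] by (simp add: q_def)
    have pw: "qa \<alpha> a \<gamma> (t - s) (x - z) * \<bar>dpa \<alpha> a s (z - y) (b z)\<bar> \<le> q * ?g s z" if s: "0 < s" "s < t" for s z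
    proof -
      have qn: "0 \<le> qa \<alpha> a \<gamma> (t - s) (x - z)" using s by (intro qa_nonneg) simp
      have "qa \<alpha> a \<gamma> (t - s) (x - z) * \<bar>dpa \<alpha> a s (z - y) (b z)\<bar> \<le>
          qa \<alpha> a \<gamma> (t - s) (x - z) * (K * norm (b z) * s powr (- 1 / 2) * qa \<alpha> a (3 / 4 * \<beta>U) s (z - y))"
        using s t a qn by (intro mult_left_mono K) auto
      also have "\<dots> = (K * norm (b z) * s powr (- 1 / 2)) * (qa \<alpha> a \<gamma> (t - s) (x - z) * qa \<alpha> a (3 / 4 * \<beta>U) s (z - y))"
        by (simp only: mult_ac)
      also have "\<dots> \<le> (K * norm (b z) * s powr (- 1 / 2)) * (C * qa \<alpha> a \<gamma> ((t - s) + s) (x - y) *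
        (envelope ?d \<alpha> (t - s) (norm (x - z)) + envelope ?d \<alpha> s (norm (z - y))))"
        using s t a K by (intro mult_left_mono C) auto
      also have "\<dots> = q * ?g s z" by (simp add: q_def mult_ac)
      finally show ?thesis .
    qed
    have "(\<integral>\<^sup>+s. (\<integral>\<^sup>+z. ennreal (qa \<alpha> a \<gamma> (t - s) (x - z) * \<bar>dpa \<alpha> a s (z - y) (b z)\<bar>) \<partial>lborel) * indicator {0<..<t} s \<partial>lborel)
       \<le> (\<integral>\<^sup>+s. (\<integral>\<^sup>+z. ennreal q * ennreal (?g s z) \<partial>lborel) * indicator {0<..<t} s \<partial>lborel)"
    proof (rule nn_integral_mono)
      fix s :: real
      show "(\<integral>\<^sup>+z. ennreal (qa \<alpha> a \<gamma> (t - s) (x - z) * \<bar>dpa \<alpha> a s (z - y) (b z)\<bar>) \<partial>lborel) * indicator {0<..<t} s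
        \<le> (\<integral>\<^sup>+z. ennreal q * ennreal (?g s z) \<partial>lborel) * indicator {0<..<t} s"
      proof (cases "0 < s \<and> s < t")
        case True
        have "ennreal (qa \<alpha> a \<gamma> (t - s) (x - z) * \<bar>dpa \<alpha> a s (z - y) (b z)\<bar>) \<le> ennreal q * ennreal (?g s z)" for z
          unfolding ennreal_mult'[OF q0, symmetric] using pw True by (intro ennreal_leI) auto
        then show ?thesis by (intro mult_right_mono nn_integral_mono) auto
      qed auto
    qed
    also have "\<dots> = ennreal q * (\<integral>\<^sup>+s. (\<integral>\<^sup>+z. ennreal (?g s z) \<partial>lborel) * indicator {0<..<t} s \<partial>lborel)"
    proof -
      have m1: "(\<lambda>z. ennreal (?g s z)) \<in> borel_measurable lborel" for s by measurable
      have m2: "(\<lambda>s. (\<integral>\<^sup>+z. ennreal (?g s z) \<partial>lborel) * indicator {0<..<t} s) \<in> borel_measurable lborel" by measurable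
      show ?thesis
        unfolding nn_integral_cmult[OF m1] nn_integral_cmult[OF m2, symmetric]
        by (intro nn_integral_cong mult.assoc)
    qed
    also have "\<dots> \<le> ennreal q * (ennreal E * kato_M (\<lambda>x. norm (b x)) (sqrt t))"
      using t by (intro mult_left_mono E) auto
    also have "\<dots> = ennreal (C * K * E * qa \<alpha> a \<gamma> t (x - y)) * kato_M (\<lambda>x. norm (b x)) (sqrt t)"
    proof -
      have "ennreal q * ennreal E = ennreal (C * K * E * qa \<alpha> a \<gamma> t (x - y))"
        using q0 E by (simp add: ennreal_mult'[symmetric] q_def mult_ac)
      then show ?thesis by (simp only: mult.assoc[symmetric])
    qed
    finally show ?thesis .
  qed
  moreover have "C * K * E > 0" using C K E by simp
  ultimately show ?thesis using that[of "C * K * E"] by blast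
qed

text \<open>The recursion integrates only over \<open>0 < s < t\<close>, where the Frechet
  derivative of the kernel is \<open>dpa\<close>; therefore the identity holds without any
  restriction on \<open>t\<close>.\<close>

lemma pk_eq_iterate:
  fixes b :: "'a \<Rightarrow> 'a" and t0 :: real
  assumes "duhamel (\<lambda>t x y. pa \<alpha> a t (x - y)) (\<lambda>s z y. dpa \<alpha> a s (z - y) (b z)) t0"
  shows "pk \<alpha> a b k t x y = (duhamel.U (\<lambda>s z y. dpa \<alpha> a s (z - y) (b z)) ^^ k) (\<lambda>t x y. pa \<alpha> a t (x - y)) t x y"
proof -
  interpret duhamel "\<lambda>t x y. pa \<alpha> a t (x - y)" "\<lambda>s z y. dpa \<alpha> a s (z - y) (b z)" t0 by (rule assms)
  show ?thesis
  proof (induction k arbitrary: t x y)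
    case (Suc k)
    have "pk \<alpha> a b (Suc k) t x y = U (pk \<alpha> a b k) t x y"
      unfolding pk.simps U_def set_lebesgue_integral_def
      by (intro Bochner_Integration.integral_cong refl) (auto simp: indicator_def frechet_derivative_pa)
    also have "pk \<alpha> a b k = (U ^^ k) (\<lambda>t x y. pa \<alpha> a t (x - y))"
      by (intro ext Suc)
    finally show ?case by simp
  qed simp
qed

text \<open>The order of the quantifiers is the point: \<open>C\<close> precedes the drift, and
  \<open>t0\<close> precedes both \<open>a\<close> and the solution \<open>P\<close>, although the
  interval on which \<open>P\<close> equals its series may depend on these.\<close>

lemma small_time_bound:
  obtains C where "C \<ge> 1"
    "\<And>b :: 'a \<Rightarrow> 'a. b \<in> borel_measurable borel \<Longrightarrow> kato_class (\<lambda>x. norm (b x)) \<Longrightarrow>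
      \<exists>t0>0. \<forall>a P. 0 < a \<longrightarrow> a \<le> M \<longrightarrow> fund_sol \<alpha> a b P \<longrightarrow>
        (\<forall>t x y. 0 < t \<longrightarrow> t \<le> t0 \<longrightarrow> \<bar>P t x y\<bar> \<le> C * pa \<alpha> a (2 * \<beta>L / \<beta>U * t) (x - y))"
proof -
  define c where "c = 2 * \<beta>L / \<beta>U"
  define \<gamma> where "\<gamma> = \<beta>U / 2"
  txt \<open>Iterating Chapman-Kolmogorov only gives bounds by \<open>p^a(c t)\<close>, whose upper bound has the weaker Gaussian
    exponent \<open>\<beta>U / c\<close>; hence uniqueness is applied with the smaller exponent \<open>\<gamma>s\<close>.\<close>
  define \<gamma>s where "\<gamma>s = min \<gamma> (\<beta>U / c)"
  define k where "k = c powr (- real DIM('a) / 2)"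
  have c: "c > 0" using beta_pos by (simp add: c_def)
  have k: "k > 0" "min k c > 0" "max k c > 0" using c by (auto simp: k_def)
  have \<gamma>: "0 < \<gamma>" "\<gamma> < 3 / 4 * \<beta>U" "\<gamma> \<le> \<beta>U" "\<beta>L / c = \<gamma>" using beta_pos by (auto simp: \<gamma>_def c_def)
  have \<gamma>s: "0 < \<gamma>s" "\<gamma>s < 3 / 4 * \<beta>U" "\<gamma>s \<le> \<gamma>" "\<gamma>s \<le> \<beta>U / c"
  proof -
    show "0 < \<gamma>s" "\<gamma>s \<le> \<beta>U / c" using \<gamma>(1) beta_pos c by (simp_all add: \<gamma>s_def)
    show "\<gamma>s \<le> \<gamma>" unfolding \<gamma>s_def by (rule min.cobounded1)
    then show "\<gamma>s < 3 / 4 * \<beta>U" using \<gamma>(2) by (rule le_less_trans)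
  qed
  \<comment> \<open>A common horizon for the kernel at the times \<open>t\<close> and
    \<open>c * t\<close> with \<open>t \<le> 1\<close>.\<close>
  have "max c 1 > 0" by simp
  obtain CL CU where CL: "CL > 0" and CU: "CU > 0" and
    lower: "\<And>a t (z::'a). 0 < a \<Longrightarrow> a \<le> M \<Longrightarrow> 0 < t \<Longrightarrow> t \<le> max c 1 \<Longrightarrow> CL * qa \<alpha> a \<beta>L t z \<le> pa \<alpha> a t z" and
    upper: "\<And>a t (z::'a). 0 < a \<Longrightarrow> a \<le> M \<Longrightarrow> 0 < t \<Longrightarrow> t \<le> max c 1 \<Longrightarrow> pa \<alpha> a t z \<le> CU * qa \<alpha> a \<beta>U t z"
    by (rule two_sidedE[OF M \<open>max c 1 > 0\<close>], rule that)
  have p_le: "pa \<alpha> a t z \<le> CU * qa \<alpha> a \<beta> t z" if "0 < a" "a \<le> M" "0 < t" "t \<le> 1" "\<beta> \<le> \<gamma>" for a t \<beta> and z :: 'a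
  proof -
    have "pa \<alpha> a t z \<le> CU * qa \<alpha> a \<beta>U t z" using that by (intro upper) auto
    also have "\<dots> \<le> CU * qa \<alpha> a \<beta> t z" using that CU \<gamma> by (intro mult_left_mono qa_antimono) auto
    finally show ?thesis .
  qed
  have W_ge: "qa \<alpha> a \<gamma> t z \<le> 1 / (CL * min k c) * pa \<alpha> a (c * t) z" if "0 < a" "a \<le> M" "0 < t" "t \<le> 1" for a t and z :: 'a
  proof -
    have ct: "0 < c * t" "c * t \<le> max c 1" using that c by (auto intro: max.coboundedI1 mult_left_le)
    have "CL * (min k c * qa \<alpha> a \<gamma> t z) \<le> CL * qa \<alpha> a \<beta>L (c * t) z"
      using qa_time_scale(1)[OF c that(3), of \<alpha> a \<beta>L z] CL unfolding k_def \<gamma>(4) by (intro mult_left_mono) auto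
    also have "\<dots> \<le> pa \<alpha> a (c * t) z" by (intro lower that ct)
    finally show ?thesis using CL k by (simp add: field_simps)
  qed
  have W_le: "pa \<alpha> a (c * t) z \<le> CU * max k c * qa \<alpha> a \<gamma>s t z" if "0 < a" "a \<le> M" "0 < t" "t \<le> 1" for a t and z :: 'a
  proof -
    have ct: "0 < c * t" "c * t \<le> max c 1" using that c by (auto intro: max.coboundedI1 mult_left_le)
    have "pa \<alpha> a (c * t) z \<le> CU * qa \<alpha> a \<beta>U (c * t) z" by (intro upper that ct)
    also have "\<dots> \<le> CU * (max k c * qa \<alpha> a (\<beta>U / c) t z)"
      using qa_time_scale(2)[OF c that(3), of \<alpha> a \<beta>U z] CU unfolding k_def by (intro mult_left_mono) auto
    also have "\<dots> \<le> CU * (max k c * qa \<alpha> a \<gamma>s t z)"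
      using CU k that \<gamma>s by (intro mult_left_mono qa_antimono) auto
    finally show ?thesis by (simp add: mult.assoc)
  qed
  obtain N where N: "N > 0"
    "\<And>a (b :: 'a \<Rightarrow> 'a) t x y. 0 < a \<Longrightarrow> a \<le> M \<Longrightarrow> b \<in> borel_measurable borel \<Longrightarrow> 0 < t \<Longrightarrow> t \<le> 1 \<Longrightarrow>
       (\<integral>\<^sup>+s. (\<integral>\<^sup>+z. ennreal (qa \<alpha> a \<gamma> (t - s) (x - z) * \<bar>dpa \<alpha> a s (z - y) (b z)\<bar>) \<partial>lborel) * indicator {0<..<t} s \<partial>lborel)
         \<le> ennreal (N * qa \<alpha> a \<gamma> t (x - y)) * kato_M (\<lambda>x. norm (b x)) (sqrt t)"
    by (rule qa_majorant[OF \<gamma>(1,2)], rule that)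
  obtain Ns where Ns: "Ns > 0"
    "\<And>a (b :: 'a \<Rightarrow> 'a) t x y. 0 < a \<Longrightarrow> a \<le> M \<Longrightarrow> b \<in> borel_measurable borel \<Longrightarrow> 0 < t \<Longrightarrow> t \<le> 1 \<Longrightarrow>
       (\<integral>\<^sup>+s. (\<integral>\<^sup>+z. ennreal (qa \<alpha> a \<gamma>s (t - s) (x - z) * \<bar>dpa \<alpha> a s (z - y) (b z)\<bar>) \<partial>lborel) * indicator {0<..<t} s \<partial>lborel)
         \<le> ennreal (Ns * qa \<alpha> a \<gamma>s t (x - y)) * kato_M (\<lambda>x. norm (b x)) (sqrt t)"
    by (rule qa_majorant[OF \<gamma>s(1,2)], rule that)
  \<comment> \<open>The factor \<open>2 * CU\<close> is the sum of the geometric series with first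
    term \<open>CU\<close>, and \<open>1 / (CL * min k c)\<close> converts \<open>qa\<close> with
    exponent \<gamma> into the kernel at time \<open>c * t\<close>. The maximum with 1 keeps powers
    of \<open>C\<close> increasing when the bound is iterated.\<close>
  define C where "C = max 1 (2 * CU / (CL * min k c))"
  have "\<exists>t0>0. \<forall>a P. 0 < a \<longrightarrow> a \<le> M \<longrightarrow> fund_sol \<alpha> a b P \<longrightarrow>
        (\<forall>t x y. 0 < t \<longrightarrow> t \<le> t0 \<longrightarrow> \<bar>P t x y\<bar> \<le> C * pa \<alpha> a (2 * \<beta>L / \<beta>U * t) (x - y))"
    if b: "b \<in> borel_measurable borel" and kato: "kato_class (\<lambda>x. norm (b x))" for b :: "'a \<Rightarrow> 'a"
  proof -
    \<comment> \<open>Small enough for both exponents, so that multiplication by \<open>N\<close> or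
      \<open>Ns\<close> gives at most the contraction factor 1/2.\<close>
    define \<eta> where "\<eta> = 1 / (2 * max N Ns)"
    have \<eta>: "\<eta> > 0" "N * \<eta> \<le> 1 / 2" "Ns * \<eta> \<le> 1 / 2" using N(1) Ns(1) by (auto simp: \<eta>_def divide_simps)
    obtain r where r: "r > 0" "\<And>s. 0 < s \<Longrightarrow> s < r \<Longrightarrow> kato_M (\<lambda>x. norm (b x)) s \<le> ennreal \<eta>"
      using kato_class_small[OF kato \<eta>(1)] by blast
    define t0 where "t0 = min 1 ((r / 2)\<^sup>2)"
    have tau0: "0 < t0" "t0 \<le> 1" using r by (auto simp: t0_def)
    have kato_small: "kato_M (\<lambda>x. norm (b x)) (sqrt t) \<le> ennreal \<eta>" if "0 < t" "t \<le> t0" for t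
    proof (rule r)
      have "sqrt t \<le> r / 2" using that r by (intro real_le_lsqrt) (auto simp: t0_def)
      then show "sqrt t < r" using r by simp
    qed (use that in simp)
    show ?thesis
    proof (intro exI conjI allI impI)
      show "0 < t0" by (rule tau0)
      fix a P t and x y :: 'a
      assume a: "0 < a" "a \<le> M" and P: "fund_sol \<alpha> a b P" and t: "0 < t" "t \<le> t0"
      let ?p = "\<lambda>t x y. pa \<alpha> a t (x - y :: 'a)" and ?B = "\<lambda>s z y. dpa \<alpha> a s (z - y) (b z)"
      let ?Q = "\<lambda>\<beta> t x y. qa \<alpha> a \<beta> t (x - y :: 'a)" and ?W = "\<lambda>t x y. pa \<alpha> a (c * t) (x - y :: 'a)"
      note [measurable] = b
      have pm: "(\<lambda>(t, x, y). ?p t x y) \<in> borel_measurable (borel \<Otimes>\<^sub>M borel \<Otimes>\<^sub>M borel)" by measurable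
      have Bm: "(\<lambda>(t, x, y). ?B t x y) \<in> borel_measurable (borel \<Otimes>\<^sub>M borel \<Otimes>\<^sub>M borel)"
      proof -
        have "(\<lambda>v::real \<times> 'a \<times> 'a. (fst v, fst (snd v) - snd (snd v), b (fst (snd v))))
            \<in> borel \<Otimes>\<^sub>M borel \<Otimes>\<^sub>M borel \<rightarrow>\<^sub>M borel \<Otimes>\<^sub>M borel \<Otimes>\<^sub>M borel" by measurable
        from measurable_compose[OF this dpa_measurable[of \<alpha> a]] show ?thesis by (simp add: split_beta')
      qed
      interpret duhamel ?p ?B t0
        by unfold_locales (rule tau0(1) pm Bm)+
      have Q: "majorant (?Q \<beta>)" if \<beta>: "N' > 0" "N' * \<eta> \<le> 1 / 2"
        "\<And>t x y. 0 < t \<Longrightarrow> t \<le> 1 \<Longrightarrow>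
         (\<integral>\<^sup>+s. (\<integral>\<^sup>+z. ennreal (qa \<alpha> a \<beta> (t - s) (x - z) * \<bar>dpa \<alpha> a s (z - y) (b z)\<bar>) \<partial>lborel) * indicator {0<..<t} s \<partial>lborel)
         \<le> ennreal (N' * qa \<alpha> a \<beta> t (x - y)) * kato_M (\<lambda>x. norm (b x)) (sqrt t)" for \<beta> N'
        unfolding majorant_def
      proof (intro conjI ballI allI impI)
        show "measurable3 (?Q \<beta>)" by measurable
        show "0 \<le> ?Q \<beta> t x y" if "0 < t" for t x y using qa_nonneg[OF that] .
        fix t and x y :: 'a assume "t \<in> {0<..t0}"
        then have t: "0 < t" "t \<le> t0" "t \<le> 1" using tau0 by auto
        have q0: "0 \<le> qa \<alpha> a \<beta> t (x - y)" by (rule qa_nonneg[OF t(1)])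
        have "(\<integral>\<^sup>+s. (\<integral>\<^sup>+z. ennreal (qa \<alpha> a \<beta> (t - s) (x - z) * \<bar>dpa \<alpha> a s (z - y) (b z)\<bar>) \<partial>lborel) * indicator {0<..<t} s \<partial>lborel)
          \<le> ennreal (N' * qa \<alpha> a \<beta> t (x - y)) * ennreal \<eta>"
          by (intro order_trans[OF \<beta>(3)] mult_left_mono kato_small t) simp
        also have "\<dots> = ennreal (N' * \<eta> * qa \<alpha> a \<beta> t (x - y))"
          using \<beta>(1) q0 \<eta>(1) by (subst ennreal_mult[symmetric]) (auto simp: mult_ac)
        also have "\<dots> \<le> ennreal (1 / 2 * qa \<alpha> a \<beta> t (x - y))"
          by (intro ennreal_leI mult_right_mono \<beta>(2) q0)
        finally show "(\<integral>\<^sup>+s. (\<integral>\<^sup>+z. ennreal (qa \<alpha> a \<beta> (t - s) (x - z) * \<bar>dpa \<alpha> a s (z - y) (b z)\<bar>) \<partial>lborel) * indicator {0<..<t} s \<partial>lborel)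
          \<le> ennreal (qa \<alpha> a \<beta> t (x - y) / 2)" by simp
      qed
      have Q\<gamma>: "majorant (?Q \<gamma>)" by (rule Q[OF N(1) \<eta>(2)]) (use a b in \<open>intro N(2)\<close>)
      have Q\<gamma>s: "majorant (?Q \<gamma>s)" by (rule Q[OF Ns(1) \<eta>(3)]) (use a b in \<open>intro Ns(2)\<close>)
      have p_dom: "dominated CU ?p (?Q \<beta>)" if "\<beta> \<le> \<gamma>" for \<beta>
        unfolding dominated_def
      proof (intro conjI ballI allI)
        fix t and x y :: 'a assume "t \<in> {0<..t0}"
        then have t: "0 < t" "t \<le> 1" using tau0 by auto
        show "\<bar>pa \<alpha> a t (x - y)\<bar> \<le> CU * qa \<alpha> a \<beta> t (x - y)"
          using p_le[OF a t that] pa_nonneg[OF a(1) t(1), of "x - y"] by simp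
      qed (use CU in simp)
      have W_dom: "dominated (CU * max k c) ?W (?Q \<gamma>s)"
        unfolding dominated_def
      proof (intro conjI ballI allI)
        fix t and x y :: 'a assume "t \<in> {0<..t0}"
        then have t: "0 < t" "t \<le> 1" using tau0 by auto
        show "\<bar>pa \<alpha> a (c * t) (x - y)\<bar> \<le> CU * max k c * qa \<alpha> a \<gamma>s t (x - y)"
          using W_le[OF a t] pa_nonneg[OF a(1), of "c * t" "x - y"] c t by simp
      qed (use CU k in simp)
      have QW: "dominated (1 / (CL * min k c)) (?Q \<gamma>) ?W"
        unfolding dominated_def
      proof (intro conjI ballI allI)
        show "0 \<le> 1 / (CL * min k c)" using CL k by simp
        fix t and x y :: 'a assume "t \<in> {0<..t0}"
        then have t: "0 < t" "t \<le> 1" using tau0 by auto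
        show "\<bar>qa \<alpha> a \<gamma> t (x - y)\<bar> \<le> 1 / (CL * min k c) * pa \<alpha> a (c * t) (x - y)"
          using W_ge[OF a t] qa_nonneg[OF t(1), of \<alpha> a \<gamma> "x - y"] by simp
      qed
      have W0: "0 \<le> ?W t x y" if "0 < t" for t x y using that c a by (intro pa_nonneg) auto
      \<comment> \<open>The series is measured with the majorant of exponent \<gamma>, which is what
        makes this constant independent of \<open>P\<close>. The exponent \<open>\<gamma>s\<close>
        is reserved for identifying \<open>P\<close> with the series.\<close>
      have SW: "dominated C S ?W"
      proof -
        have d: "dominated (2 * CU * (1 / (CL * min k c))) S ?W"
          by (rule dominated_trans[OF S_dominated[OF Q\<gamma> p_dom[OF order_refl]] QW])
        have KC: "2 * CU * (1 / (CL * min k c)) \<le> C" by (simp add: C_def)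
        show ?thesis
          unfolding dominated_def
        proof (intro conjI ballI allI)
          show "0 \<le> C" by (simp add: C_def le_max_iff_disj)
          fix t and x y :: 'a assume t: "t \<in> {0<..t0}"
          then have "\<bar>S t x y\<bar> \<le> 2 * CU * (1 / (CL * min k c)) * ?W t x y" using d unfolding dominated_def by blast
          also have "\<dots> \<le> C * ?W t x y" using t by (intro mult_right_mono KC W0) auto
          finally show "\<bar>S t x y\<bar> \<le> C * ?W t x y" .
        qed
      qed
      \<comment> \<open>A fundamental solution is arbitrary for \<open>t \<le> 0\<close>. Setting it
        to 0 there turns continuity on the open half-space into joint Borel measurability
        everywhere.\<close>
      define F where "F t x y = (if 0 < t then P t x y else 0)" for t x y
      have Pc: "continuous_on ({0<..} \<times> UNIV \<times> UNIV) (\<lambda>(t, x, y). P t x y)"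
        and PCK: "\<And>t s x y. 0 < t \<Longrightarrow> 0 < s \<Longrightarrow> P (t + s) x y = (LINT z|lborel. P t x z * P s z y)"
        using P by (auto simp: fund_sol_def)
      obtain \<epsilon>0 where \<epsilon>0: "\<epsilon>0 > 0" "\<And>t x y. 0 < t \<Longrightarrow> t \<le> \<epsilon>0 \<Longrightarrow> P t x y = (\<Sum>k. pk \<alpha> a b k t x y)"
        using P by (auto simp: fund_sol_def)
      have Fm: "measurable3 F"
      proof -
        have "(\<lambda>v. if v \<in> {0<..} \<times> UNIV \<times> UNIV then (\<lambda>(t, x, y). P t x y) v else 0) \<in> borel_measurable borel"
          by (intro borel_measurable_continuous_on_if Pc) (auto intro!: borel_open open_Times)
        also have "(\<lambda>v. if v \<in> {0<..} \<times> UNIV \<times> UNIV then (\<lambda>(t, x, y). P t x y) v else 0) = (\<lambda>(t, x, y). F t x y)"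
          by (auto simp: F_def fun_eq_iff)
        finally show ?thesis by (simp add: borel_prod)
      qed
      have FCK: "F (t + s) x y = (LINT z|lborel. F t x z * F s z y)" if "0 < t" "0 < s" for t s x y
        using PCK[OF that] that by (simp add: F_def)
      have WW: "(\<integral>\<^sup>+z. ennreal (?W t x z * ?W s z y) \<partial>lborel) = ennreal (?W (t + s) x y)" if "0 < t" "0 < s" for t s x y
        using nn_integral_pa_semigroup(1)[OF a(1), of "c * t" "c * s" x y] that c by (simp add: distrib_left)
      \<comment> \<open>At fixed \<open>t\<close> the factor \<open>qa\<close> is bounded, and
        \<open>pa\<close> has total mass at most 1.\<close>
      have Qp: "(\<integral>\<^sup>+z. ennreal (?Q \<gamma>s t x z * \<bar>?p s z y\<bar>) \<partial>lborel) < \<infinity>" if "0 < t" "t \<le> t0" "0 < s" for t s x y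
      proof -
        let ?K = "2 * t powr (- real DIM('a) / 2)"
        have [measurable]: "(pa \<alpha> a s :: 'a \<Rightarrow> real) \<in> borel_measurable borel" by measurable
        have "(\<integral>\<^sup>+z. ennreal (?Q \<gamma>s t x z * \<bar>?p s z y\<bar>) \<partial>lborel) \<le> (\<integral>\<^sup>+z. ennreal ?K * ennreal (pa \<alpha> a s (y - z)) \<partial>lborel)"
        proof (rule nn_integral_mono)
          fix z
          have "pa \<alpha> a s (z - y) = pa \<alpha> a s (y - z)" using pa_minus[of \<alpha> a s "y - z"] by simp
          then have "?Q \<gamma>s t x z * \<bar>?p s z y\<bar> \<le> ?K * pa \<alpha> a s (y - z)"
            using pa_nonneg[OF a(1) that(3), of "y - z"] qa_le_powr[of \<gamma>s t \<alpha> a "x - z"] \<gamma>s that by (simp add: mult_right_mono)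
          then show "ennreal (?Q \<gamma>s t x z * \<bar>?p s z y\<bar>) \<le> ennreal ?K * ennreal (pa \<alpha> a s (y - z))"
            by (subst ennreal_mult'[symmetric]) (auto intro: ennreal_leI)
        qed
        also have "\<dots> = ennreal ?K * (\<integral>\<^sup>+z. ennreal (pa \<alpha> a s (y - z)) \<partial>lborel)" by (intro nn_integral_cmult) measurable
        also have "(\<integral>\<^sup>+z. ennreal (pa \<alpha> a s (y - z)) \<partial>lborel) = (\<integral>\<^sup>+z. ennreal (pa \<alpha> a s (z::'a)) \<partial>lborel)"
          by (rule nn_integral_reflect) measurable
        also have "ennreal ?K * \<dots> \<le> ennreal ?K * 1"
          by (intro mult_left_mono nn_integral_pa_le a that) auto
        also have "\<dots> < \<infinity>" by simp
        finally show ?thesis .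
      qed
      define \<epsilon> where "\<epsilon> = min \<epsilon>0 t0"
      have \<epsilon>: "0 < \<epsilon>" "\<epsilon> \<le> t0" using \<epsilon>0(1) tau0(1) by (auto simp: \<epsilon>_def)
      have FS: "F t x y = S t x y" if "0 < t" "t \<le> \<epsilon>" for t x y
        using that unfolding \<epsilon>_def using \<epsilon>0(2)[of t x y] pk_eq_iterate[OF duhamel_axioms] by (simp add: F_def S_def)
      have Wm: "measurable3 ?W" by measurable
      have "F t x y = S t x y"
      proof (rule solution_eq_S[OF Fm Q\<gamma>s p_dom[OF \<gamma>s(3)] W_dom FCK W0 Wm WW _ _ Qp \<epsilon> FS _ SW t])
        show "(LINT z|lborel. ?p t x z * ?p s z y) = ?p (t + s) x y" if "0 < t" "0 < s" for t s x y
          by (rule nn_integral_pa_semigroup(2)[OF a(1) that])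
        show "(LINT z|lborel. ?B s x z * ?p t z y) = ?B (s + t) x y" if "0 < t" "0 < s" for t s x y
          by (rule dpa_pa_convolution[OF a(1) that])
        show "1 \<le> C" by (simp add: C_def)
      qed
      then have "\<bar>P t x y\<bar> = \<bar>S t x y\<bar>" using t by (simp add: F_def)
      also have "\<dots> \<le> C * pa \<alpha> a (2 * \<beta>L / \<beta>U * t) (x - y)"
        using SW t by (simp add: dominated_def c_def)
      finally show "\<bar>P t x y\<bar> \<le> C * pa \<alpha> a (2 * \<beta>L / \<beta>U * t) (x - y)" .
    qed
  qed
  moreover have "C \<ge> 1" by (simp add: C_def)
  ultimately show ?thesis using that[of C] by blast
qed

end

section \<open>Exponential growth for large times\<close>

context positive_pa begin

text \<open>With \<open>n\<close> the integer part of \<open>t / t0\<close>, the time fits into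
  \<open>n + 1\<close> steps of length at most \<open>t0\<close>, each costing a factor
  \<open>C\<close>. Since \<open>C \<ge> 1\<close>, \<open>C ^ n\<close> is at most
  \<open>exp (ln C * t / t0)\<close>, and the remaining factor \<open>C\<close> stays in
  front.\<close>

lemma fund_sol_long_time_bound:
  fixes P :: "real \<Rightarrow> 'a \<Rightarrow> 'a \<Rightarrow> real"
  assumes a: "0 < a" and c: "0 < c" and C: "1 \<le> C" and t0: "0 < t0"
    and P: "fund_sol \<alpha> a b P"
    and le: "\<And>t x y. 0 < t \<Longrightarrow> t \<le> t0 \<Longrightarrow> \<bar>P t x y\<bar> \<le> C * pa \<alpha> a (c * t) (x - y)"
    and t: "0 < t"
  shows "\<bar>P t x y\<bar> \<le> C * exp (ln C / t0 * t) * pa \<alpha> a (c * t) (x - y)"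
proof -
  let ?W = "\<lambda>t x y. pa \<alpha> a (c * t) (x - y :: 'a)"
  define n where "n = nat \<lfloor>t / t0\<rfloor>"
  have q: "0 \<le> t / t0" using t t0 by simp
  have n: "real n \<le> t / t0" "t \<le> real (Suc n) * t0"
  proof -
    show "real n \<le> t / t0" unfolding n_def using q by simp
    have "t / t0 < real n + 1" unfolding n_def using q by linarith
    then show "t \<le> real (Suc n) * t0" using t0 by (simp add: pos_divide_less_eq add.commute)
  qed
  have W0: "0 \<le> ?W t x y" if "0 < t" for t x y using that c a by (intro pa_nonneg) auto
  have PCK: "P (t + s) x y = (LINT z|lborel. P t x z * P s z y)" if "0 < t" "0 < s" for t s x y
    using P that by (auto simp: fund_sol_def)
  have WW: "(\<integral>\<^sup>+z. ennreal (?W t x z * ?W s z y) \<partial>lborel) = ennreal (?W (t + s) x y)" if "0 < t" "0 < s" for t s x y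
    using nn_integral_pa_semigroup(1)[OF a, of "c * t" "c * s" x y] that c by (simp add: distrib_left)
  have "\<bar>P t x y\<bar> \<le> C ^ Suc n * ?W t x y"
    by (rule iterated_kernel_bound[OF C le t0 PCK W0 _ WW t n(2)]) measurable
  also have "\<dots> \<le> C * exp (ln C / t0 * t) * ?W t x y"
  proof (rule mult_right_mono[OF _ W0[OF t]])
    have "C ^ n = exp (ln C * real n)" using C by (simp add: mult.commute[of "ln C"] exp_of_nat_mult)
    also have "\<dots> \<le> exp (ln C * (t / t0))" using mult_left_mono[OF n(1), of "ln C"] C by simp
    finally show "C ^ Suc n \<le> C * exp (ln C / t0 * t)" using C by simp
  qed
  finally show ?thesis .
qed

end

theorem theorem4p1:
  fixes \<alpha> \<beta>L \<beta>U M :: real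
  assumes "DIM('a::euclidean_space) \<ge> 2"
    and "0 < \<alpha>" and "\<alpha> < 2"
    and "two_sided_constants TYPE('a) \<alpha> \<beta>L \<beta>U"
    and "M > 0"
  shows "\<exists>C>0. \<exists>C2::real \<Rightarrow> real. (\<forall>T>0. C2 T > 0) \<and>
     (\<forall>b::'a \<Rightarrow> 'a. b \<in> borel_measurable borel \<and> kato_class (\<lambda>x. norm (b x)) \<longrightarrow>
        (\<exists>C'::real.
          (\<forall>a\<in>{0<..M}. \<forall>P. fund_sol \<alpha> a b P \<longrightarrow>
             (\<forall>t>0. \<forall>x y. \<bar>P t x y\<bar> \<le> C * exp (C' * t) * pa \<alpha> a (2 * \<beta>L * t / \<beta>U) (x - y))) \<and>
          (\<forall>T>0. \<forall>a\<in>{0<..M}. \<forall>P. fund_sol \<alpha> a b P \<longrightarrow>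
             (\<forall>t\<in>{0<..T}. \<forall>x y. \<bar>P t x y\<bar> \<le>
                C2 T * exp (C' * t) * qa \<alpha> a (\<beta>U\<^sup>2 / (2 * \<beta>L)) t (x - y)))))"
proof -
  interpret two_sided \<alpha> \<beta>L \<beta>U M "TYPE('a)"
    by unfold_locales (use assms in auto)
  define c where "c = 2 * \<beta>L / \<beta>U"
  have c: "c > 0" using beta_pos by (simp add: c_def)
  have ct: "2 * \<beta>L * t / \<beta>U = c * t" for t by (simp add: c_def)
  \<comment> \<open>The exponent in the second estimate is that of the upper kernel bound, read at
    time \<open>c * t\<close> instead of \<open>t\<close>.\<close>
  have \<beta>c: "\<beta>U / c = \<beta>U\<^sup>2 / (2 * \<beta>L)" by (simp add: c_def power2_eq_square)
  define k where "k = max (c powr (- real DIM('a) / 2)) c"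
  have k: "k > 0" using c by (simp add: k_def less_max_iff_disj)
  obtain C where C: "C \<ge> 1" and small: "\<And>b :: 'a \<Rightarrow> 'a. b \<in> borel_measurable borel \<Longrightarrow> kato_class (\<lambda>x. norm (b x)) \<Longrightarrow>
      \<exists>t0>0. \<forall>a P. 0 < a \<longrightarrow> a \<le> M \<longrightarrow> fund_sol \<alpha> a b P \<longrightarrow>
        (\<forall>t x y. 0 < t \<longrightarrow> t \<le> t0 \<longrightarrow> \<bar>P t x y\<bar> \<le> C * pa \<alpha> a (c * t) (x - y))"
    by (rule small_time_bound[folded c_def], rule that)
  have upper_ex: "\<forall>T>0. \<exists>CU>0. \<forall>a t. \<forall>z::'a. 0 < a \<longrightarrow> a \<le> M \<longrightarrow> 0 < t \<longrightarrow> t \<le> T \<longrightarrow> pa \<alpha> a (c * t) z \<le> CU * qa \<alpha> a (\<beta>U / c) t z"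
  proof (intro allI impI)
    fix T :: real assume T: "T > 0"
    then have cT: "c * T > 0" using c by simp
    obtain CL CU where CU: "CU > 0" "\<And>a t (z::'a). 0 < a \<Longrightarrow> a \<le> M \<Longrightarrow> 0 < t \<Longrightarrow> t \<le> c * T \<Longrightarrow> pa \<alpha> a t z \<le> CU * qa \<alpha> a \<beta>U t z"
      by (rule two_sidedE[OF M cT], rule that)
    have "pa \<alpha> a (c * t) z \<le> CU * k * qa \<alpha> a (\<beta>U / c) t z" if "0 < a" "a \<le> M" "0 < t" "t \<le> T" for a t and z :: 'a
    proof -
      have "pa \<alpha> a (c * t) z \<le> CU * qa \<alpha> a \<beta>U (c * t) z" using that c by (intro CU) auto
      also have "\<dots> \<le> CU * (k * qa \<alpha> a (\<beta>U / c) t z)"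
        using CU(1) qa_time_scale(2)[OF c that(3), of \<alpha> a \<beta>U z] unfolding k_def by (intro mult_left_mono) auto
      finally show ?thesis by (simp add: mult.assoc)
    qed
    with CU(1) k show "\<exists>CU>0. \<forall>a t. \<forall>z::'a. 0 < a \<longrightarrow> a \<le> M \<longrightarrow> 0 < t \<longrightarrow> t \<le> T \<longrightarrow> pa \<alpha> a (c * t) z \<le> CU * qa \<alpha> a (\<beta>U / c) t z"
      by (intro exI[of _ "CU * k"]) auto
  qed
  \<comment> \<open>The bound depending on \<open>T\<close> has to be a single function fixed before
    the drift, so a constant is chosen for every \<open>T\<close> at once.\<close>
  define CU where "CU T = (SOME u. u > 0 \<and> (\<forall>a t. \<forall>z::'a. 0 < a \<longrightarrow> a \<le> M \<longrightarrow> 0 < t \<longrightarrow> t \<le> T \<longrightarrow> pa \<alpha> a (c * t) z \<le> u * qa \<alpha> a (\<beta>U / c) t z))" for T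
  have CU_prop: "CU T > 0 \<and> (\<forall>a t. \<forall>z::'a. 0 < a \<longrightarrow> a \<le> M \<longrightarrow> 0 < t \<longrightarrow> t \<le> T \<longrightarrow> pa \<alpha> a (c * t) z \<le> CU T * qa \<alpha> a (\<beta>U / c) t z)" if "T > 0" for T
    unfolding CU_def by (rule someI_ex) (use upper_ex that in blast)
  have CU: "CU T > 0" if "T > 0" for T using CU_prop[OF that] by (rule conjunct1)
  have CU_le: "pa \<alpha> a (c * t) z \<le> CU T * qa \<alpha> a (\<beta>U / c) t z"
    if "T > 0" "0 < a" "a \<le> M" "0 < t" "t \<le> T" for T a t and z :: 'a
    using conjunct2[OF CU_prop[OF that(1)], rule_format, OF that(2-)] .
  show ?thesis
    unfolding ct \<beta>c[symmetric]
  proof (rule exI[of _ C], rule conjI, goal_cases)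
    case 2
    show ?case
    proof (rule exI[of _ "\<lambda>T. C * CU T"], intro conjI allI impI)
      show "C * CU T > 0" if "T > 0" for T using C CU[OF that] by simp
      fix b :: "'a \<Rightarrow> 'a"
      assume b: "b \<in> borel_measurable borel \<and> kato_class (\<lambda>x. norm (b x))"
      then have "\<exists>t0>0. \<forall>a P. 0 < a \<longrightarrow> a \<le> M \<longrightarrow> fund_sol \<alpha> a b P \<longrightarrow>
          (\<forall>t x y. 0 < t \<longrightarrow> t \<le> t0 \<longrightarrow> \<bar>P t x y\<bar> \<le> C * pa \<alpha> a (c * t) (x - y))"
        by (intro small) auto
      then obtain t0 where t0: "t0 > 0" and le: "\<forall>a P. 0 < a \<longrightarrow> a \<le> M \<longrightarrow> fund_sol \<alpha> a b P \<longrightarrow>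
          (\<forall>t x y. 0 < t \<longrightarrow> t \<le> t0 \<longrightarrow> \<bar>P t x y\<bar> \<le> C * pa \<alpha> a (c * t) (x - y))"
        by (elim exE conjE) (rule that)
      have main: "\<bar>P t x y\<bar> \<le> C * exp (ln C / t0 * t) * pa \<alpha> a (c * t) (x - y)"
        if "a \<in> {0<..M}" "fund_sol \<alpha> a b P" "0 < t" for a t :: real and x y :: 'a and P
      proof (rule fund_sol_long_time_bound[OF _ c C t0 that(2) _ that(3)])
        have a: "0 < a" "a \<le> M" using that(1) by simp_all
        show "0 < a" by (rule a)
        show "\<bar>P t x y\<bar> \<le> C * pa \<alpha> a (c * t) (x - y)" if "0 < t" "t \<le> t0" for t :: real and x y :: 'a
          by (rule le[rule_format, OF a \<open>fund_sol \<alpha> a b P\<close> that])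
      qed
      show "\<exists>C'. (\<forall>a\<in>{0<..M}. \<forall>P. fund_sol \<alpha> a b P \<longrightarrow>
               (\<forall>t>0. \<forall>x y. \<bar>P t x y\<bar> \<le> C * exp (C' * t) * pa \<alpha> a (c * t) (x - y))) \<and>
            (\<forall>T>0. \<forall>a\<in>{0<..M}. \<forall>P. fund_sol \<alpha> a b P \<longrightarrow>
               (\<forall>t\<in>{0<..T}. \<forall>x y. \<bar>P t x y\<bar> \<le> C * CU T * exp (C' * t) * qa \<alpha> a (\<beta>U / c) t (x - y)))"
      proof (intro exI[of _ "ln C / t0"] conjI ballI allI impI)
        fix a t :: real and x y :: 'a and P assume "a \<in> {0<..M}" "fund_sol \<alpha> a b P" "0 < t"
        then show "\<bar>P t x y\<bar> \<le> C * exp (ln C / t0 * t) * pa \<alpha> a (c * t) (x - y)" by (rule main)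
      next
        fix T a t :: real and x y :: 'a and P assume T: "T > 0" and a: "a \<in> {0<..M}" and P: "fund_sol \<alpha> a b P" and t: "t \<in> {0<..T}"
        have "\<bar>P t x y\<bar> \<le> C * exp (ln C / t0 * t) * pa \<alpha> a (c * t) (x - y)" using t by (intro main a P) auto
        also have "\<dots> \<le> C * exp (ln C / t0 * t) * (CU T * qa \<alpha> a (\<beta>U / c) t (x - y))"
          using C T a t by (intro mult_left_mono CU_le) auto
        also have "\<dots> = C * CU T * exp (ln C / t0 * t) * qa \<alpha> a (\<beta>U / c) t (x - y)" by (simp only: mult_ac)
        finally show "\<bar>P t x y\<bar> \<le> C * CU T * exp (ln C / t0 * t) * qa \<alpha> a (\<beta>U / c) t (x - y)" .
      qed
    qed
  qed (use C in simp)
qed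

end
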